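(* Let $G$ be a second countable, locally compact, Hausdorff, étale groupoid with compact unit space, and suppose that $G$ has topological property (T). Then for every ergodic invariant probability measure $\mu$ on $G^{(0)}$, the measured groupoid $(G,\mu)$ has measured property (T).
   Context: Notation: $r,s$ are the range and source maps, $G^x=r^{-1}(x)$, $G_x=s^{-1}(x)$. Étale means the topology has a basis of open bisections (open sets on which $r$ and $s$ are homeomorphisms onto their images in $G^{(0)}$). Topological property (T). $C_c(G)$ is the convolution $*$-algebra: $(f_1f_2)(g)=\sum_{hk=g}f_1(h)f_2(k)$, $f^*(g)=\overline{f(g^{-1})}$. $\|f\|_I=\max\{\sup_{x}\sum_{g\in G^x}|f(g)|,\sup_x\sum_{g\in G_x}|f(g)|\}$. A representation $(H,\pi)$ of $C_c(G)$ is a unital $*$-homomorphism $\pi:C_c(G)\to\mathcal{B}(H)$, $H$ a complex Hilbert space; write $f\xi=\pi(f)\xi$. Put $\Psi:C_c(G)\to C(G^{(0)})$, $\Psi(f)(x)=\sum_{g\in G^x}f(g)$. A vector $\xi$ is constant if $f\xi=\Psi(f)\xi$ for all $f\in C_c(G)$; $H_\pi$ is the orthogonal complement of the space of constant vectors. $G$ has topological property (T) if there are a compact $K\subseteq G$ and $c>0$ such that for every representation $(H,\pi)$ of $C_c(G)$ and every $\xi\in H_\pi$ there is $f\in C_c(G)$ supported in $K$ with $\|f\|_I\le1$ and $\|f\xi-\Psi(f)\xi\|\ge c\|\xi\|$. Measures. A probability measure $\mu$ on $G^{(0)}$ (Radon) is invariant if $\int_{G^{(0)}}\sum_{g\in G^x}f(g)\,d\mu(x)=\int_{G^{(0)}}\sum_{g\in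 G_x}f(g)\,d\mu(x)$ for all $f\in C_c(G)$. The left side defines a measure $r^*\mu$ on $G$. "Almost every" refers to $\mu$ on $G^{(0)}$ and to $r^*\mu$ on $G$. $\mu$ is ergodic if every Borel set $E\subseteq G^{(0)}$ that is invariant (i.e. $s(g)\in E\iff r(g)\in E$) is $\mu$-null or $\mu$-conull. Measured property (T) (Zimmer, Anantharaman-Delaroche). A Hilbert bundle over $X=G^{(0)}$ is a family $H=(H_x)_{x\in X}$ of separable Hilbert spaces with a Borel structure on $X*H=\{(x,v):v\in H_x\}$ for which the projection to $X$ is Borel and there is a sequence of sections $(\xi_n)$ such that the maps $(x,v)\mapsto\langle\xi_n(x),v\rangle$ and $x\mapsto\langle\xi_n(x),\xi_m(x)\rangle$ are Borel, and the maps $(x,v)\mapsto\langle\xi_n(x),v\rangle$ together with the projection separate the points of $X*H$. Let $\mathrm{Iso}(X*H)$ be the groupoid of triples $(x,V,y)$ with $V:H_y\to H_x$ unitary, with the weakest Borel structure making $(x,V,y)\mapsto x$, $(x,V,y)\mapsto y$ and $(x,V,y)\mapsto\langle\xi_n(x),V\xi_m(y)\rangle$ Borel. A representation $(H,\pi)$ of $G$ is a Hilbert bundle $H$ over $G^{(0)}$ with a Borel groupoid homomorphism $\pi:G\to\mathrm{Iso}(G^{(0)}*H)$ sending each unit $x$ to $(x,\mathrm{Id}_{H_x},x)$; write $\pi_g:H_{s(g)}\to H_{r(g)}$ for the corresponding unitaries. A unit section is a Borel section $x\mapsto\xi_x\in H_x$ (modulo almost everywhere equality) with $\|\xi_x\|=1$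 for almost every $x$. It is invariant if $\xi_{r(g)}=\pi_g\xi_{s(g)}$ for almost every $g\in G$. $(H,\pi)$ almost contains unit invariant sections if there is a sequence $(\xi^n)$ of unit sections with $\|\xi^n_{r(g)}-\pi_g\xi^n_{s(g)}\|\to0$ for almost every $g\in G$. $(G,\mu)$ has measured property (T) if every representation of $G$ that almost contains unit invariant sections contains a unit invariant section.
   Formalization: The Borel structure on X*H in a Hilbert bundle is required to be standard; with an arbitrary σ-algebra the claim fails, since one can adjoin a non-measurable set that leaves the almost invariant sections Borel but no invariant one. *)

theory Defs
  imports "HOL-Analysis.Analysis" "HOL-Algebra.Module"
begin

section \<open>Groupoids\<close>

text \<open>Units are arrows; \<open>src\<close> and \<open>rng\<close> send an arrow to its source and range unit.
  \<open>gmult G g h\<close> is meaningful only when \<open>src G g = rng G h\<close>.\<close>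

record 'a groupoid =
  arr :: "'a set"
  src :: "'a \<Rightarrow> 'a"
  rng :: "'a \<Rightarrow> 'a"
  gmult :: "'a \<Rightarrow> 'a \<Rightarrow> 'a"
  ginv :: "'a \<Rightarrow> 'a"

definition units :: "'a groupoid \<Rightarrow> 'a set" where
  "units G = src G ` arr G"

locale groupoid =
  fixes G :: "'a groupoid"
  assumes closed: "g \<in> arr G \<Longrightarrow> src G g \<in> arr G \<and> rng G g \<in> arr G \<and> ginv G g \<in> arr G"
    and src_unit: "g \<in> arr G \<Longrightarrow> src G (src G g) = src G g \<and> rng G (src G g) = src G g"
    and rng_unit: "g \<in> arr G \<Longrightarrow> src G (rng G g) = rng G g \<and> rng G (rng G g) = rng G g"
    and mult_closed: "\<lbrakk>g \<in> arr G; h \<in> arr G; src G g = rng G h\<rbrakk> \<Longrightarrow>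
      gmult G g h \<in> arr G \<and> src G (gmult G g h) = src G h \<and> rng G (gmult G g h) = rng G g"
    and assoc: "\<lbrakk>g \<in> arr G; h \<in> arr G; k \<in> arr G; src G g = rng G h; src G h = rng G k\<rbrakk> \<Longrightarrow>
      gmult G (gmult G g h) k = gmult G g (gmult G h k)"
    and unit_laws: "g \<in> arr G \<Longrightarrow> gmult G (rng G g) g = g \<and> gmult G g (src G g) = g"
    and inv_ends: "g \<in> arr G \<Longrightarrow> src G (ginv G g) = rng G g \<and> rng G (ginv G g) = src G g"
    and inv_laws: "g \<in> arr G \<Longrightarrow>
      gmult G (ginv G g) g = src G g \<and> gmult G g (ginv G g) = rng G g"

definition groupoid_hom :: "'a groupoid \<Rightarrow> 'b groupoid \<Rightarrow> ('a \<Rightarrow> 'b) \<Rightarrow> bool" where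
  "groupoid_hom G K \<phi> \<longleftrightarrow>
     \<phi> \<in> arr G \<rightarrow> arr K \<and>
     (\<forall>g\<in>arr G. \<forall>h\<in>arr G. src G g = rng G h \<longrightarrow>
        src K (\<phi> g) = rng K (\<phi> h) \<and> \<phi> (gmult G g h) = gmult K (\<phi> g) (\<phi> h))"

abbreviation rng_fibre :: "'a groupoid \<Rightarrow> 'a \<Rightarrow> 'a set" where
  "rng_fibre G x \<equiv> {g \<in> arr G. rng G g = x}"

abbreviation src_fibre :: "'a groupoid \<Rightarrow> 'a \<Rightarrow> 'a set" where
  "src_fibre G x \<equiv> {g \<in> arr G. src G g = x}"

text \<open>The arrows of a topological groupoid form a whole type, whose type class carries the
  topology. Continuity of \<open>src\<close> and \<open>rng\<close> follows from that of multiplication and inversion.\<close>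

definition topological_groupoid :: "'g::topological_space groupoid \<Rightarrow> bool" where
  "topological_groupoid G \<longleftrightarrow>
     groupoid G \<and> arr G = UNIV \<and>
     continuous_on {(g, h). src G g = rng G h} (\<lambda>(g, h). gmult G g h) \<and>
     continuous_on UNIV (ginv G)"

text \<open>The images of an open bisection are required to be open in the unit space, as is
  implicit in the notion of an etale groupoid: the range and source maps are local
  homeomorphisms. Otherwise \<open>C\<^sub>c(G)\<close> need not be closed under convolution.\<close>

definition open_bisection :: "'g::topological_space groupoid \<Rightarrow> 'g set \<Rightarrow> bool" where
  "open_bisection G U \<longleftrightarrow>
     open U \<and>
     openin (top_of_set (units G)) (rng G ` U) \<and> (\<exists>t. homeomorphism U (rng G ` U) (rng G) t) \<and>
     openin (top_of_set (units G)) (src G ` U) \<and> (\<exists>t. homeomorphism U (src G ` U) (src G) t)"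

definition etale_groupoid :: "'g::topological_space groupoid \<Rightarrow> bool" where
  "etale_groupoid G \<longleftrightarrow>
     topological_groupoid G \<and>
     (\<exists>\<B>. topological_basis \<B> \<and> (\<forall>U\<in>\<B>. open_bisection G U))"


section \<open>Complex Hilbert spaces\<close>

definition complex_ring :: "complex ring" where
  "complex_ring = \<lparr>carrier = UNIV, monoid.mult = (*), one = 1, zero = 0, add = (+)\<rparr>"

text \<open>Hilbert spaces are modules with explicit carriers, so that one can quantify over them.
  The ring multiplication and the ring unit which \<^typ>\<open>('a, 'b) module\<close> inherits are unused.
  The inner product is linear in the first argument.\<close>

record 'h hilbert = "(complex, 'h) module" +
  inner_prod :: "'h \<Rightarrow> 'h \<Rightarrow> complex"

definition hnorm :: "'h hilbert \<Rightarrow> 'h \<Rightarrow> real" where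
  "hnorm H x = sqrt (Re (inner_prod H x x))"

locale hilbert_space = module complex_ring H for H :: "'h hilbert" +
  assumes inner_add: "\<lbrakk>x \<in> carrier H; y \<in> carrier H; z \<in> carrier H\<rbrakk> \<Longrightarrow>
      inner_prod H (x \<oplus>\<^bsub>H\<^esub> y) z = inner_prod H x z + inner_prod H y z"
    and inner_scale: "\<lbrakk>x \<in> carrier H; y \<in> carrier H\<rbrakk> \<Longrightarrow>
      inner_prod H (a \<odot>\<^bsub>H\<^esub> x) y = a * inner_prod H x y"
    and inner_cnj: "\<lbrakk>x \<in> carrier H; y \<in> carrier H\<rbrakk> \<Longrightarrow>
      inner_prod H y x = cnj (inner_prod H x y)"
    and inner_nonneg: "x \<in> carrier H \<Longrightarrow> 0 \<le> Re (inner_prod H x x)"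
    and inner_definite: "\<lbrakk>x \<in> carrier H; inner_prod H x x = 0\<rbrakk> \<Longrightarrow> x = \<zero>\<^bsub>H\<^esub>"
    and complete: "\<lbrakk>\<And>n. X n \<in> carrier H;
        \<And>e. e > 0 \<Longrightarrow> \<exists>N. \<forall>m\<ge>N. \<forall>n\<ge>N. hnorm H (X m \<ominus>\<^bsub>H\<^esub> X n) < e\<rbrakk> \<Longrightarrow>
      \<exists>l\<in>carrier H. (\<lambda>n. hnorm H (X n \<ominus>\<^bsub>H\<^esub> l)) \<longlonglongrightarrow> 0"

definition separable_hilbert :: "'h hilbert \<Rightarrow> bool" where
  "separable_hilbert H \<longleftrightarrow>
     (\<exists>D. countable D \<and> D \<subseteq> carrier H \<and>
        (\<forall>x\<in>carrier H. \<forall>e>0. \<exists>d\<in>D. hnorm H (x \<ominus>\<^bsub>H\<^esub> d) < e))"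

definition linear_map :: "'h hilbert \<Rightarrow> 'k hilbert \<Rightarrow> ('h \<Rightarrow> 'k) \<Rightarrow> bool" where
  "linear_map H K T \<longleftrightarrow>
     T \<in> carrier H \<rightarrow> carrier K \<and>
     (\<forall>x\<in>carrier H. \<forall>y\<in>carrier H. T (x \<oplus>\<^bsub>H\<^esub> y) = T x \<oplus>\<^bsub>K\<^esub> T y) \<and>
     (\<forall>a. \<forall>x\<in>carrier H. T (a \<odot>\<^bsub>H\<^esub> x) = a \<odot>\<^bsub>K\<^esub> T x)"

definition bounded_operator :: "'h hilbert \<Rightarrow> ('h \<Rightarrow> 'h) \<Rightarrow> bool" where
  "bounded_operator H T \<longleftrightarrow>
     linear_map H H T \<and> (\<exists>C. \<forall>x\<in>carrier H. hnorm H (T x) \<le> C * hnorm H x)"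

text \<open>Unitaries are extensional, i.e. \<open>undefined\<close> off the carrier, so that they are
  determined by their values on \<open>H\<close>.\<close>

definition unitaries :: "'h hilbert \<Rightarrow> 'h hilbert \<Rightarrow> ('h \<Rightarrow> 'h) set" where
  "unitaries H K = {V \<in> carrier H \<rightarrow>\<^sub>E carrier K.
     linear_map H K V \<and> V ` carrier H = carrier K \<and>
     (\<forall>x\<in>carrier H. \<forall>y\<in>carrier H. inner_prod K (V x) (V y) = inner_prod H x y)}"

definition unitary_id :: "'h hilbert \<Rightarrow> 'h \<Rightarrow> 'h" where
  "unitary_id H = (\<lambda>v\<in>carrier H. v)"


section \<open>Topological property (T)\<close>

definition supp :: "('g::topological_space \<Rightarrow> complex) \<Rightarrow> 'g set" where
  "supp f = closure {g. f g \<noteq> 0}"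

definition Cc :: "('g::topological_space \<Rightarrow> complex) set" where
  "Cc = {f. continuous_on UNIV f \<and> compact (supp f)}"

text \<open>For an etale groupoid and functions in \<^const>\<open>Cc\<close> all sums below have only
  finitely many nonzero terms, and the suprema are over bounded sets.\<close>

definition conv :: "'g groupoid \<Rightarrow> ('g \<Rightarrow> complex) \<Rightarrow> ('g \<Rightarrow> complex) \<Rightarrow> 'g \<Rightarrow> complex" where
  "conv G f1 f2 g =
     (\<Sum>\<^sub>\<infinity>(h, k)\<in>{(h, k). h \<in> arr G \<and> k \<in> arr G \<and> src G h = rng G k \<and> gmult G h k = g}. f1 h * f2 k)"

definition adj :: "'g groupoid \<Rightarrow> ('g \<Rightarrow> complex) \<Rightarrow> 'g \<Rightarrow> complex" where
  "adj G f g = cnj (f (ginv G g))"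

definition conv_one :: "'g groupoid \<Rightarrow> 'g \<Rightarrow> complex" where
  "conv_one G g = (if g \<in> units G then 1 else 0)"

definition I_norm :: "'g groupoid \<Rightarrow> ('g \<Rightarrow> complex) \<Rightarrow> real" where
  "I_norm G f = max (SUP x\<in>units G. \<Sum>\<^sub>\<infinity>g\<in>rng_fibre G x. cmod (f g))
                    (SUP x\<in>units G. \<Sum>\<^sub>\<infinity>g\<in>src_fibre G x. cmod (f g))"

text \<open>\<open>C(G\<^sup>0)\<close> is viewed inside \<open>C\<^sub>c(G)\<close> through extension by zero, the unit space
  being clopen and compact.\<close>

definition Psi :: "'g groupoid \<Rightarrow> ('g \<Rightarrow> complex) \<Rightarrow> 'g \<Rightarrow> complex" where
  "Psi G f x = (if x \<in> units G then \<Sum>\<^sub>\<infinity>g\<in>rng_fibre G x. f g else 0)"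

definition Cc_representation ::
  "'g::topological_space groupoid \<Rightarrow> 'h hilbert \<Rightarrow> (('g \<Rightarrow> complex) \<Rightarrow> 'h \<Rightarrow> 'h) \<Rightarrow> bool" where
  "Cc_representation G H \<pi> \<longleftrightarrow>
     hilbert_space H \<and>
     (\<forall>f\<in>Cc. bounded_operator H (\<pi> f)) \<and>
     (\<forall>f1\<in>Cc. \<forall>f2\<in>Cc. \<forall>\<xi>\<in>carrier H. \<pi> (\<lambda>g. f1 g + f2 g) \<xi> = \<pi> f1 \<xi> \<oplus>\<^bsub>H\<^esub> \<pi> f2 \<xi>) \<and>
     (\<forall>a. \<forall>f\<in>Cc. \<forall>\<xi>\<in>carrier H. \<pi> (\<lambda>g. a * f g) \<xi> = a \<odot>\<^bsub>H\<^esub> \<pi> f \<xi>) \<and>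
     (\<forall>f1\<in>Cc. \<forall>f2\<in>Cc. \<forall>\<xi>\<in>carrier H. \<pi> (conv G f1 f2) \<xi> = \<pi> f1 (\<pi> f2 \<xi>)) \<and>
     (\<forall>f\<in>Cc. \<forall>\<xi>\<in>carrier H. \<forall>\<eta>\<in>carrier H.
        inner_prod H (\<pi> (adj G f) \<xi>) \<eta> = inner_prod H \<xi> (\<pi> f \<eta>)) \<and>
     (\<forall>\<xi>\<in>carrier H. \<pi> (conv_one G) \<xi> = \<xi>)"

definition constant_vectors ::
  "'g::topological_space groupoid \<Rightarrow> 'h hilbert \<Rightarrow> (('g \<Rightarrow> complex) \<Rightarrow> 'h \<Rightarrow> 'h) \<Rightarrow> 'h set" where
  "constant_vectors G H \<pi> = {\<xi> \<in> carrier H. \<forall>f\<in>Cc. \<pi> f \<xi> = \<pi> (Psi G f) \<xi>}"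

definition H_pi ::
  "'g::topological_space groupoid \<Rightarrow> 'h hilbert \<Rightarrow> (('g \<Rightarrow> complex) \<Rightarrow> 'h \<Rightarrow> 'h) \<Rightarrow> 'h set" where
  "H_pi G H \<pi> = {\<xi> \<in> carrier H. \<forall>\<eta>\<in>constant_vectors G H \<pi>. inner_prod H \<xi> \<eta> = 0}"

text \<open>HOL cannot quantify over Hilbert spaces of unbounded cardinality inside a formula, so the
  universe \<open>'h\<close> containing the carriers of the Hilbert spaces is a type parameter. Up to isomorphism, a universe
  \<open>'i \<Rightarrow> complex\<close> contains all separable Hilbert spaces whatever \<open>'i\<close> is, and every Hilbert
  space is contained in such a universe for some \<open>'i\<close>.\<close>

definition topological_property_T :: "'h itself \<Rightarrow> 'g::topological_space groupoid \<Rightarrow> bool" where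
  "topological_property_T _ G \<longleftrightarrow>
     (\<exists>K c. compact K \<and> c > 0 \<and>
        (\<forall>(H :: 'h hilbert) \<pi>. Cc_representation G H \<pi> \<longrightarrow>
           (\<forall>\<xi>\<in>H_pi G H \<pi>. \<exists>f\<in>Cc. supp f \<subseteq> K \<and> I_norm G f \<le> 1 \<and>
              hnorm H (\<pi> f \<xi> \<ominus>\<^bsub>H\<^esub> \<pi> (Psi G f) \<xi>) \<ge> c * hnorm H \<xi>)))"


section \<open>Measures on the unit space\<close>

definition unit_borel :: "'g::topological_space groupoid \<Rightarrow> 'g measure" where
  "unit_borel G = restrict_space borel (units G)"

definition radon_probability :: "'g::topological_space groupoid \<Rightarrow> 'g measure \<Rightarrow> bool" where
  "radon_probability G \<mu> \<longleftrightarrow>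
     space \<mu> = units G \<and> sets \<mu> = sets (unit_borel G) \<and> emeasure \<mu> (units G) = 1 \<and>
     (\<forall>A\<in>sets \<mu>. emeasure \<mu> A = (SUP K\<in>{K. compact K \<and> K \<subseteq> A}. emeasure \<mu> K))"

definition invariant_measure :: "'g::topological_space groupoid \<Rightarrow> 'g measure \<Rightarrow> bool" where
  "invariant_measure G \<mu> \<longleftrightarrow>
     (\<forall>f\<in>Cc. (\<integral>x. (\<Sum>\<^sub>\<infinity>g\<in>rng_fibre G x. f g) \<partial>\<mu>) = (\<integral>x. (\<Sum>\<^sub>\<infinity>g\<in>src_fibre G x. f g) \<partial>\<mu>))"

text \<open>The measure \<open>r\<^sup>*\<mu>\<close>: the integral over the unit space of the counting measures
  on the range fibres, evaluated on indicator functions.\<close>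

definition rng_pullback :: "'g::topological_space groupoid \<Rightarrow> 'g measure \<Rightarrow> 'g measure" where
  "rng_pullback G \<mu> = measure_of UNIV (sets borel)
     (\<lambda>A. \<integral>\<^sup>+x. (\<integral>\<^sup>+g. indicator A g \<partial>count_space (rng_fibre G x)) \<partial>\<mu>)"

definition ergodic_measure :: "'g::topological_space groupoid \<Rightarrow> 'g measure \<Rightarrow> bool" where
  "ergodic_measure G \<mu> \<longleftrightarrow>
     (\<forall>E\<in>sets \<mu>. (\<forall>g\<in>arr G. src G g \<in> E \<longleftrightarrow> rng G g \<in> E) \<longrightarrow>
        emeasure \<mu> E = 0 \<or> emeasure \<mu> (space \<mu> - E) = 0)"


section \<open>Measured property (T)\<close>

definition standard_borel :: "'a measure \<Rightarrow> bool" where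
  "standard_borel M \<longleftrightarrow>
     (\<exists>T. topspace T = space M \<and> completely_metrizable_space T \<and> second_countable T \<and>
          sets M = sigma_sets (space M) {U. openin T U})"

text \<open>\<open>fib x\<close> is the fibre \<open>H\<^sub>x\<close>, \<open>total\<close> carries the Borel structure of \<open>X * H\<close> (only its
  \<open>\<sigma>\<close>-algebra matters), and \<open>fund\<close> is the sequence of sections \<open>\<xi>\<^sub>n\<close>.\<close>

record ('x, 'v) hbundle =
  fib :: "'x \<Rightarrow> 'v hilbert"
  total :: "('x \<times> 'v) measure"
  fund :: "nat \<Rightarrow> 'x \<Rightarrow> 'v"

text \<open>As usual in the theory of measured groupoids, the Borel structure on the total space is
  a standard one. It is then generated by the projection and the functions
  \<open>(x, v) \<mapsto> \<langle>\<xi>\<^sub>n(x), v\<rangle>\<close>, since these separate points. With an arbitrary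
  \<open>\<sigma>\<close>-algebra the Borel sections could be made artificially scarce.\<close>

definition hilbert_bundle :: "'x measure \<Rightarrow> ('x, 'v) hbundle \<Rightarrow> bool" where
  "hilbert_bundle M E \<longleftrightarrow>
     (\<forall>x\<in>space M. hilbert_space (fib E x) \<and> separable_hilbert (fib E x)) \<and>
     space (total E) = (SIGMA x:space M. carrier (fib E x)) \<and>
     standard_borel (total E) \<and>
     fst \<in> measurable (total E) M \<and>
     (\<forall>n. \<forall>x\<in>space M. fund E n x \<in> carrier (fib E x)) \<and>
     (\<forall>n. (\<lambda>(x, v). inner_prod (fib E x) (fund E n x) v) \<in> borel_measurable (total E)) \<and>
     (\<forall>n m. (\<lambda>x. inner_prod (fib E x) (fund E n x) (fund E m x)) \<in> borel_measurable M) \<and>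
     (\<forall>x\<in>space M. \<forall>v\<in>carrier (fib E x). \<forall>w\<in>carrier (fib E x).
        (\<forall>n. inner_prod (fib E x) (fund E n x) v = inner_prod (fib E x) (fund E n x) w) \<longrightarrow> v = w)"

text \<open>The triple \<open>(x, V, y)\<close> is an arrow from \<open>y\<close> to \<open>x\<close>.\<close>

definition iso_groupoid :: "'x measure \<Rightarrow> ('x, 'v) hbundle \<Rightarrow> ('x \<times> ('v \<Rightarrow> 'v) \<times> 'x) groupoid" where
  "iso_groupoid M E = \<lparr>
     arr = {(x, V, y). x \<in> space M \<and> y \<in> space M \<and> V \<in> unitaries (fib E y) (fib E x)},
     src = (\<lambda>(x, V, y). (y, unitary_id (fib E y), y)),
     rng = (\<lambda>(x, V, y). (x, unitary_id (fib E x), x)),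
     gmult = (\<lambda>(x, V, y) (y', W, z). (x, compose (carrier (fib E z)) V W, z)),
     ginv = (\<lambda>(x, V, y).
       (y, restrict (inv_into (carrier (fib E y)) V) (carrier (fib E x)), x))\<rparr>"

definition iso_borel :: "'x measure \<Rightarrow> ('x, 'v) hbundle \<Rightarrow> ('x \<times> ('v \<Rightarrow> 'v) \<times> 'x) measure" where
  "iso_borel M E = (let I = arr (iso_groupoid M E) in sigma I
     ({{(x, V, y) \<in> I. x \<in> A} | A. A \<in> sets M} \<union>
      {{(x, V, y) \<in> I. y \<in> A} | A. A \<in> sets M} \<union>
      {{(x, V, y) \<in> I. inner_prod (fib E x) (fund E n x) (V (fund E m y)) \<in> B} | n m B.
         B \<in> sets (borel :: complex measure)}))"

definition groupoid_representation ::
  "'g::topological_space groupoid \<Rightarrow> ('g, 'v) hbundle \<Rightarrow> ('g \<Rightarrow> 'g \<times> ('v \<Rightarrow> 'v) \<times> 'g) \<Rightarrow> bool" where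
  "groupoid_representation G E \<pi> \<longleftrightarrow>
     hilbert_bundle (unit_borel G) E \<and>
     groupoid_hom G (iso_groupoid (unit_borel G) E) \<pi> \<and>
     \<pi> \<in> measurable borel (iso_borel (unit_borel G) E) \<and>
     (\<forall>x\<in>units G. \<pi> x = (x, unitary_id (fib E x), x))"

text \<open>If \<open>\<pi>\<close> is a representation then \<open>\<pi> g\<close> is \<open>(rng G g, rep_op \<pi> g, src G g)\<close>.\<close>

definition rep_op :: "('g \<Rightarrow> 'g \<times> ('v \<Rightarrow> 'v) \<times> 'g) \<Rightarrow> 'g \<Rightarrow> 'v \<Rightarrow> 'v" where
  "rep_op \<pi> g = fst (snd (\<pi> g))"

definition unit_section :: "'x measure \<Rightarrow> ('x, 'v) hbundle \<Rightarrow> ('x \<Rightarrow> 'v) \<Rightarrow> bool" where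
  "unit_section \<mu> E \<xi> \<longleftrightarrow>
     (\<lambda>x. (x, \<xi> x)) \<in> measurable \<mu> (total E) \<and> (AE x in \<mu>. hnorm (fib E x) (\<xi> x) = 1)"

definition contains_unit_invariant_section ::
  "'g::topological_space groupoid \<Rightarrow> 'g measure \<Rightarrow> ('g, 'v) hbundle \<Rightarrow>
     ('g \<Rightarrow> 'g \<times> ('v \<Rightarrow> 'v) \<times> 'g) \<Rightarrow> bool" where
  "contains_unit_invariant_section G \<mu> E \<pi> \<longleftrightarrow>
     (\<exists>\<xi>. unit_section \<mu> E \<xi> \<and>
        (AE g in rng_pullback G \<mu>. \<xi> (rng G g) = rep_op \<pi> g (\<xi> (src G g))))"

definition almost_contains_unit_invariant_sections ::
  "'g::topological_space groupoid \<Rightarrow> 'g measure \<Rightarrow> ('g, 'v) hbundle \<Rightarrow>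
     ('g \<Rightarrow> 'g \<times> ('v \<Rightarrow> 'v) \<times> 'g) \<Rightarrow> bool" where
  "almost_contains_unit_invariant_sections G \<mu> E \<pi> \<longleftrightarrow>
     (\<exists>\<xi> :: nat \<Rightarrow> 'g \<Rightarrow> 'v. (\<forall>n. unit_section \<mu> E (\<xi> n)) \<and>
        (AE g in rng_pullback G \<mu>.
           (\<lambda>n. hnorm (fib E (rng G g))
                  (\<xi> n (rng G g) \<ominus>\<^bsub>fib E (rng G g)\<^esub> rep_op \<pi> g (\<xi> n (src G g)))) \<longlonglongrightarrow> 0))"

text \<open>The universe \<open>'v\<close> of the fibres is again a type parameter.\<close>

definition measured_property_T ::
  "'v itself \<Rightarrow> 'g::topological_space groupoid \<Rightarrow> 'g measure \<Rightarrow> bool" where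
  "measured_property_T _ G \<mu> \<longleftrightarrow>
     (\<forall>(E :: ('g, 'v) hbundle) \<pi>.
        groupoid_representation G E \<pi> \<longrightarrow>
        almost_contains_unit_invariant_sections G \<mu> E \<pi> \<longrightarrow>
        contains_unit_invariant_section G \<mu> E \<pi>)"

end

theory Submission
  imports Defs
begin

text \<open>The sections of a representation of \<open>G\<close> that are square integrable for \<open>\<mu>\<close> form a Hilbert
  space on which \<open>C\<^sub>c(G)\<close> acts by \<open>(f \<xi>)(x) = \<Sum>\<^bsub>r g = x\<^esub> f(g) \<pi>\<^sub>g \<xi>(s g)\<close>; this is a
  \<open>*\<close>-representation because \<open>\<mu>\<close> is invariant. If \<open>f\<close> is supported in the compact set \<open>K\<close> and
  \<open>\<parallel>f\<parallel>\<^sub>I \<le> 1\<close>, then \<open>\<parallel>f \<xi> - \<Psi>(f) \<xi>\<parallel>\<^sup>2\<close> is at most a constant times the integral of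
  \<open>\<parallel>\<pi>\<^sub>g \<xi>(s g) - \<xi>(r g)\<parallel>\<^sup>2\<close> over \<open>K\<close>, which tends to \<open>0\<close> along almost invariant unit sections.
  If \<open>0\<close> were the only constant vector, then these sections would lie in \<open>H\<^sub>\<pi>\<close>, contrary to
  property (T). A nonzero constant vector is a section that is invariant almost everywhere; by
  ergodicity it vanishes almost nowhere, and dividing by its norm makes it a unit section.

  Gram-Schmidt orthonormalisation of the fundamental sections replaces the fibres by closed
  subspaces of \<open>\<ell>\<^sup>2\<close>, and measurability of sections by measurability of coordinates. Returning from
  coordinates to the Borel structure of the bundle needs Lusin's separation theorem: a countable
  family of Borel sets separating the points of a standard Borel space generates its
  \<open>\<sigma>\<close>-algebra.\<close>

section \<open>Square-summable sequences\<close>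

text \<open>Three obstacles shape the argument. Property (T) is given only for Hilbert spaces with
  carrier in \<open>'i \<Rightarrow> complex\<close>, \<open>'i\<close> being arbitrary, so the
  classes of sections modulo null sets must be injected into that type; this works since countably
  many real numbers determine a section almost everywhere. Invariance of \<mu> is given only against
  \<open>Cc\<close>, while the adjoint relation and the behaviour of null sets under the source map
  concern Borel data; both follow once inversion is known to preserve
  \<open>rng_pullback G \<mu>\<close>. Finally, a constant vector satisfies one equation for each
  \<open>f\<close>, each off its own null set; invariance along almost every arrow is recovered from
  countably many \<open>f\<close> supported in bisections, for which a fibre sum has at most one
  term. The contradiction is quantitative: the compact set and \<open>c\<close> are fixed before any
  section, and a compact set meets all range fibres in a bounded number of arrows.\<close>

definition sq_summable :: "(nat \<Rightarrow> complex) \<Rightarrow> bool" where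
  "sq_summable a \<longleftrightarrow> summable (\<lambda>n. (cmod (a n))\<^sup>2)"

lemma norm_add_sq_le: "(norm (v + w))\<^sup>2 \<le> 2 * (norm v)\<^sup>2 + 2 * (norm w)\<^sup>2"
  for v w :: "'a::real_normed_vector"
proof -
  have "(norm (v + w))\<^sup>2 \<le> (norm v + norm w)\<^sup>2" by (intro power_mono norm_triangle_ineq) simp
  also have "\<dots> \<le> 2 * (norm v)\<^sup>2 + 2 * (norm w)\<^sup>2"
    using sum_squares_bound[of "norm v" "norm w"] by (simp add: power2_sum)
  finally show ?thesis .
qed

lemma norm_diff_sq_le: "(norm (v - w))\<^sup>2 \<le> 2 * (norm v)\<^sup>2 + 2 * (norm w)\<^sup>2"
  for v w :: "'a::real_normed_vector"
  using norm_add_sq_le[of v "- w"] by simp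

lemma sq_summable_add:
  assumes "sq_summable a" "sq_summable b"
  shows "sq_summable (\<lambda>n. a n + b n)"
  unfolding sq_summable_def
proof (rule summable_comparison_test'[where N = 0])
  show "summable (\<lambda>n. 2 * (cmod (a n))\<^sup>2 + 2 * (cmod (b n))\<^sup>2)"
    using assms unfolding sq_summable_def by (intro summable_add summable_mult)
qed (use norm_add_sq_le in auto)

lemma sq_summable_mult: "sq_summable a \<Longrightarrow> sq_summable (\<lambda>n. c * a n)"
  unfolding sq_summable_def by (simp add: norm_mult power_mult_distrib summable_mult)

lemma sq_summable_minus: "sq_summable a \<Longrightarrow> sq_summable (\<lambda>n. - a n)"
  unfolding sq_summable_def by simp

lemma sq_summable_prod:
  assumes "sq_summable a" "sq_summable b"
  shows "summable (\<lambda>n. norm (a n * cnj (b n)))" "summable (\<lambda>n. a n * cnj (b n))"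
proof -
  show 1: "summable (\<lambda>n. norm (a n * cnj (b n)))"
  proof (rule summable_comparison_test'[where N = 0])
    show "summable (\<lambda>n. (cmod (a n))\<^sup>2 + (cmod (b n))\<^sup>2)"
      using assms unfolding sq_summable_def by (rule summable_add)
    show "norm (norm (a n * cnj (b n))) \<le> (cmod (a n))\<^sup>2 + (cmod (b n))\<^sup>2" for n
    proof -
      have "norm (norm (a n * cnj (b n))) = cmod (a n) * cmod (b n)" by (simp add: norm_mult)
      moreover have "0 \<le> cmod (a n) * cmod (b n)" by simp
      ultimately show ?thesis using sum_squares_bound[of "cmod (a n)" "cmod (b n)"] by linarith
    qed
  qed
  then show "summable (\<lambda>n. a n * cnj (b n))" by (rule summable_norm_cancel)
qed

text \<open>A type rather than a \<open>hilbert\<close> record, so that norms, limits and series are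
  those of the type classes. The fibres of a bundle become subsets of it. Measurability of
  \<open>ell2\<close>-valued maps is always stated for each \<open>coord\<close>.\<close>

typedef ell2 = "{a. sq_summable a}"
  morphisms coord Abs_ell2
  by (rule exI[of _ "\<lambda>_. 0"]) (simp add: sq_summable_def)

lemma coord_sq_summable [simp]: "sq_summable (coord x)"
  using coord by simp

lemma coord_Abs [simp]: "sq_summable a \<Longrightarrow> coord (Abs_ell2 a) = a"
  by (simp add: Abs_ell2_inverse)

lemma ell2_eqI: "(\<And>n. coord x n = coord y n) \<Longrightarrow> x = y"
  by (simp add: coord_inject[symmetric] fun_eq_iff)

definition cinner :: "ell2 \<Rightarrow> ell2 \<Rightarrow> complex" where
  "cinner x y = (\<Sum>n. coord x n * cnj (coord y n))"

definition cscale :: "complex \<Rightarrow> ell2 \<Rightarrow> ell2" where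
  "cscale c x = Abs_ell2 (\<lambda>n. c * coord x n)"

lemma coord_cscale [simp]: "coord (cscale c x) n = c * coord x n"
  by (simp add: cscale_def sq_summable_mult)

text \<open>The class provides a real inner product, so it receives the real part of
  \<open>cinner\<close>; the complex structure stays in \<open>cinner\<close> and
  \<open>cscale\<close>.\<close>

instantiation ell2 :: real_inner
begin

definition "0 = Abs_ell2 (\<lambda>_. 0)"
definition "x + y = Abs_ell2 (\<lambda>n. coord x n + coord y n)"
definition "- x = Abs_ell2 (\<lambda>n. - coord x n)"
definition "x - y = Abs_ell2 (\<lambda>n. coord x n + - coord y n)"
definition "scaleR r x = Abs_ell2 (\<lambda>n. complex_of_real r * coord x n)"
definition "inner x y = Re (cinner x y)"
definition "norm x = sqrt (inner x x)" for x :: ell2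
definition "dist x y = norm (x - y)" for x y :: ell2
definition "sgn x = scaleR (inverse (norm x)) x" for x :: ell2
definition [code del]: "uniformity = (INF e\<in>{0 <..}. principal {(x, y). dist (x :: ell2) y < e})"
definition [code del]: "open U = (\<forall>x\<in>U. eventually (\<lambda>(x', y). x' = x \<longrightarrow> y \<in> U) uniformity)"
  for U :: "ell2 set"

lemma coord_zero [simp]: "coord 0 n = 0"
  by (simp add: zero_ell2_def sq_summable_def)

lemma coord_add [simp]: "coord (x + y) n = coord x n + coord y n"
  by (simp add: plus_ell2_def sq_summable_add)

lemma coord_uminus [simp]: "coord (- x) n = - coord x n"
  by (simp add: uminus_ell2_def sq_summable_minus)

lemma coord_diff [simp]: "coord (x - y) n = coord x n - coord y n"
  by (simp add: minus_ell2_def sq_summable_minus sq_summable_add del: add_uminus_conv_diff)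

lemma coord_scaleR [simp]: "coord (r *\<^sub>R x) n = complex_of_real r * coord x n"
  by (simp add: scaleR_ell2_def sq_summable_mult)

lemma cinner_summable: "summable (\<lambda>n. coord x n * cnj (coord y n))"
  by (simp add: sq_summable_prod)

lemma cinner_add_left: "cinner (x + y) z = cinner x z + cinner y z"
  by (simp add: cinner_def algebra_simps suminf_add cinner_summable)

lemma cinner_scale_left: "cinner (cscale c x) y = c * cinner x y"
  by (simp add: cinner_def mult.assoc suminf_mult cinner_summable)

lemma cinner_commute: "cinner y x = cnj (cinner x y)"
proof -
  have "(\<lambda>n. cnj (coord x n * cnj (coord y n))) sums cnj (cinner x y)"
    unfolding cinner_def by (intro sums_cnj[THEN iffD2] summable_sums cinner_summable)
  then show ?thesis by (simp add: cinner_def sums_iff mult.commute)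
qed

lemma cinner_self_sums: "(\<lambda>n. (cmod (coord x n))\<^sup>2) sums Re (cinner x x)"
  and cinner_self: "cinner x x = complex_of_real (Re (cinner x x))"
proof -
  have "(\<lambda>n. complex_of_real ((cmod (coord x n))\<^sup>2)) sums cinner x x"
    using summable_sums[OF cinner_summable[of x x]]
    by (simp add: cinner_def complex_norm_square del: of_real_power)
  then show s: "(\<lambda>n. (cmod (coord x n))\<^sup>2) sums Re (cinner x x)"
    using sums_Re by fastforce
  from sums_of_real[OF this] show "cinner x x = complex_of_real (Re (cinner x x))"
    using summable_sums[OF cinner_summable[of x x]]
    by (intro sums_unique2[of _ "cinner x x"]) (simp_all add: cinner_def complex_norm_square del: of_real_power)
qed

instance
proof
  fix x y z :: ell2 and r s :: real
  show "x + y + z = x + (y + z)" "x + y = y + x" "0 + x = x" "- x + x = 0" "x - y = x + - y"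
    by (auto intro!: ell2_eqI)
  show "r *\<^sub>R (x + y) = r *\<^sub>R x + r *\<^sub>R y" "(r + s) *\<^sub>R x = r *\<^sub>R x + s *\<^sub>R x"
    "r *\<^sub>R s *\<^sub>R x = (r * s) *\<^sub>R x" "1 *\<^sub>R x = x"
    by (auto intro!: ell2_eqI simp: algebra_simps)
  show "dist x y = norm (x - y)" "sgn x = scaleR (inverse (norm x)) x" "norm x = sqrt (inner x x)"
    by (simp_all add: dist_ell2_def sgn_ell2_def norm_ell2_def)
  show "uniformity = (INF e\<in>{0 <..}. principal {(x, y). dist (x :: ell2) y < e})"
    by (rule uniformity_ell2_def)
  show "open U = (\<forall>x\<in>U. eventually (\<lambda>(x', y). x' = x \<longrightarrow> y \<in> U) uniformity)" for U :: "ell2 set"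
    by (rule open_ell2_def)
  show "inner x y = inner y x"
    using cinner_commute[of x y] by (simp add: inner_ell2_def)
  show "inner (x + y) z = inner x z + inner y z" by (simp add: inner_ell2_def cinner_add_left)
  have "r *\<^sub>R x = cscale (complex_of_real r) x" by (rule ell2_eqI) simp
  then show "inner (r *\<^sub>R x) y = r * inner x y" by (simp add: inner_ell2_def cinner_scale_left)
  have pos: "0 \<le> (cmod (coord x n))\<^sup>2" for n by simp
  show "0 \<le> inner x x"
    using sums_le[OF _ sums_zero cinner_self_sums[of x]] by (simp add: inner_ell2_def)
  show "inner x x = 0 \<longleftrightarrow> x = 0"
  proof
    assume "inner x x = 0"
    then have "(\<lambda>n. (cmod (coord x n))\<^sup>2) sums 0" using cinner_self_sums[of x] by (simp add: inner_ell2_def)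
    then have "(cmod (coord x n))\<^sup>2 = 0" for n
      using suminf_eq_zero_iff[of "\<lambda>n. (cmod (coord x n))\<^sup>2"] by (auto simp: sums_iff)
    then show "x = 0" by (intro ell2_eqI) simp
  qed (simp add: inner_ell2_def cinner_def)
qed

end

lemma cinner_norm: "cinner x x = complex_of_real ((norm x)\<^sup>2)"
  unfolding power2_norm_eq_inner inner_ell2_def by (rule cinner_self)

lemma Re_cinner_self [simp]: "Re (cinner x x) = (norm x)\<^sup>2"
  by (simp add: cinner_norm)

lemma norm_sq_sums: "(\<lambda>n. (cmod (coord x n))\<^sup>2) sums (norm x)\<^sup>2"
  using cinner_self_sums[of x] by simp

lemma cinner_zero_left [simp]: "cinner 0 y = 0"
  by (simp add: cinner_def)

lemma cinner_add_right: "cinner z (x + y) = cinner z x + cinner z y"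
  by (metis cinner_add_left cinner_commute complex_cnj_add)

lemma cinner_scale_right: "cinner x (cscale c y) = cnj c * cinner x y"
  by (metis cinner_scale_left cinner_commute complex_cnj_mult)

lemma cinner_sum_left: "cinner (sum f A) z = (\<Sum>a\<in>A. cinner (f a) z)"
  by (induction A rule: infinite_finite_induct) (auto simp: cinner_add_left)

lemma norm_cscale [simp]: "norm (cscale c x) = cmod c * norm x"
proof -
  have "complex_of_real ((norm (cscale c x))\<^sup>2) = complex_of_real ((cmod c * norm x)\<^sup>2)"
    using complex_norm_square[of c]
    by (simp only: cinner_norm[symmetric] cinner_scale_left cinner_scale_right)
       (simp add: cinner_norm power_mult_distrib mult.assoc[symmetric])
  then have "(norm (cscale c x))\<^sup>2 = (cmod c * norm x)\<^sup>2"
    using of_real_eq_iff by blast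
  then show ?thesis using power2_eq_iff_nonneg[of "norm (cscale c x)" "cmod c * norm x"] by simp
qed

text \<open>Multiplying \<open>x\<close> by a unimodular constant makes the inner product real and
  nonnegative, which reduces the claim to the real Cauchy-Schwarz inequality.\<close>

lemma cinner_bound: "cmod (cinner x y) \<le> norm x * norm y"
proof (cases "cinner x y = 0")
  case False
  define c where "c = cnj (sgn (cinner x y))"
  have c: "cmod c = 1" using False by (simp add: c_def norm_sgn)
  have "c * cinner x y = complex_of_real (cmod (cinner x y))"
    using False complex_norm_square[of "cinner x y", symmetric]
    by (simp add: c_def sgn_eq power2_eq_square mult.commute)
  then have "cmod (cinner x y) = Re (cinner (cscale c x) y)"
    by (simp add: cinner_scale_left)
  also have "\<dots> = inner (cscale c x) y" by (simp add: inner_ell2_def)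
  also have "\<dots> \<le> norm (cscale c x) * norm y" by (rule norm_cauchy_schwarz)
  finally show ?thesis using c by simp
qed simp

lemma cscale_algebra:
  "cscale c (x + y) = cscale c x + cscale c y" "cscale (c + d) x = cscale c x + cscale d x"
  "cscale c (cscale d x) = cscale (c * d) x" "cscale 1 x = x" "cscale c 0 = 0" "cscale 0 x = 0"
  "cscale c (x - y) = cscale c x - cscale c y"
  by (auto intro!: ell2_eqI simp: algebra_simps)

lemma cscale_sum: "cscale c (sum f A) = (\<Sum>a\<in>A. cscale c (f a))"
  by (induction A rule: infinite_finite_induct) (auto simp: cscale_algebra)

lemma cscale_sum_left: "cscale (sum c A) x = (\<Sum>a\<in>A. cscale (c a) x)"
  by (induction A rule: infinite_finite_induct) (auto simp: cscale_algebra)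

lemma coord_sum: "coord (sum f A) n = (\<Sum>a\<in>A. coord (f a) n)"
  by (induction A rule: infinite_finite_induct) auto

lemma scaleR_eq_cscale: "r *\<^sub>R x = cscale (complex_of_real r) x"
  by (rule ell2_eqI) simp

lemma coord_bound: "cmod (coord x n) \<le> norm x"
proof -
  have "(cmod (coord x n))\<^sup>2 \<le> (norm x)\<^sup>2"
    using sum_le_suminf[of "\<lambda>n. (cmod (coord x n))\<^sup>2" "{n}"] norm_sq_sums[of x] by (simp add: sums_iff)
  then show ?thesis by (rule power2_le_imp_le) simp
qed

lemma norm_sum_sq_le:
  fixes f :: "'a \<Rightarrow> 'b::real_normed_vector"
  assumes "finite A"
  shows "(norm (sum f A))\<^sup>2 \<le> card A * (\<Sum>a\<in>A. (norm (f a))\<^sup>2)"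
proof -
  have "(norm (sum f A))\<^sup>2 \<le> (\<Sum>a\<in>A. norm (f a))\<^sup>2" by (intro power_mono norm_sum) simp
  also have "\<dots> \<le> card A * (\<Sum>a\<in>A. (norm (f a))\<^sup>2)"
    using Cauchy_Schwarz_ineq_sum[of "\<lambda>_. 1" "\<lambda>a. norm (f a)" A] by simp
  finally show ?thesis .
qed

instance ell2 :: complete_space
proof
  fix X :: "nat \<Rightarrow> ell2" assume X: "Cauchy X"
  have "Cauchy (\<lambda>m. coord (X m) n)" for n
  proof (rule CauchyI)
    fix e :: real assume "e > 0"
    then obtain M where "\<forall>m\<ge>M. \<forall>n\<ge>M. norm (X m - X n) < e" using CauchyD[OF X] by blast
    then show "\<exists>M. \<forall>m\<ge>M. \<forall>k\<ge>M. norm (coord (X m) n - coord (X k) n) < e"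
      by (metis coord_bound coord_diff le_less_trans)
  qed
  then have "\<forall>n. \<exists>l. (\<lambda>m. coord (X m) n) \<longlonglongrightarrow> l" by (simp add: Cauchy_convergent_iff convergent_def)
  then obtain a where a: "\<And>n. (\<lambda>m. coord (X m) n) \<longlonglongrightarrow> a n" by metis
  \<comment> \<open>The distance to the limit is first bounded on finitely many coordinates, where
    \<open>k\<close> can tend to infinity. As the bound does not depend on \<open>N\<close>, it
    gives both that \<open>a\<close> is square summable and that the convergence is in norm.\<close>
  have part: "(\<Sum>n<N. (cmod (coord (X m) n - a n))\<^sup>2) \<le> e\<^sup>2"
    if "\<forall>m\<ge>M. \<forall>n\<ge>M. norm (X m - X n) < e" "M \<le> m" for N m M e
  proof (rule tendsto_upperbound)
    show "(\<lambda>k. \<Sum>n<N. (cmod (coord (X m) n - coord (X k) n))\<^sup>2) \<longlonglongrightarrow> (\<Sum>n<N. (cmod (coord (X m) n - a n))\<^sup>2)"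
      by (intro tendsto_intros a)
    have "(\<Sum>n<N. (cmod (coord (X m) n - coord (X k) n))\<^sup>2) \<le> e\<^sup>2" if "M \<le> k" for k
    proof -
      have "(\<Sum>n<N. (cmod (coord (X m - X k) n))\<^sup>2) \<le> (norm (X m - X k))\<^sup>2"
        using norm_sq_sums[of "X m - X k"] by (metis sum_le_suminf finite_lessThan sums_iff zero_le_power2)
      also have "\<dots> \<le> e\<^sup>2"
        using \<open>\<forall>m\<ge>M. \<forall>n\<ge>M. norm (X m - X n) < e\<close> \<open>M \<le> m\<close> that by (intro power_mono) (auto simp: less_imp_le)
      finally show ?thesis by simp
    qed
    then show "\<forall>\<^sub>F k in sequentially. (\<Sum>n<N. (cmod (coord (X m) n - coord (X k) n))\<^sup>2) \<le> e\<^sup>2"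
      by (rule eventually_sequentiallyI)
  qed simp
  have sq: "sq_summable (\<lambda>n. coord (X m) n - a n)"
    if "\<forall>m\<ge>M. \<forall>n\<ge>M. norm (X m - X n) < e" "M \<le> m" for m M e
    unfolding sq_summable_def
  proof (rule bounded_imp_summable[where B = "e\<^sup>2"])
    show "(\<Sum>k\<le>N. (cmod (coord (X m) k - a k))\<^sup>2) \<le> e\<^sup>2" for N
      using part[OF that, of "Suc N"] by (simp only: lessThan_Suc_atMost)
  qed simp
  obtain M1 where M1: "\<forall>m\<ge>M1. \<forall>n\<ge>M1. norm (X m - X n) < 1" using CauchyD[OF X, of 1] by auto
  have a_sq: "sq_summable a"
    using sq_summable_add[OF coord_sq_summable[of "X M1"] sq_summable_minus[OF sq[OF M1 order_refl]]] by simp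
  have "X \<longlonglongrightarrow> Abs_ell2 a"
  proof (rule LIMSEQ_I)
    fix e :: real assume "e > 0"
    then obtain M where M: "\<forall>m\<ge>M. \<forall>n\<ge>M. norm (X m - X n) < e/2" using CauchyD[OF X, of "e/2"] by auto
    have "norm (X m - Abs_ell2 a) < e" if "M \<le> m" for m
    proof -
      have "(norm (X m - Abs_ell2 a))\<^sup>2 \<le> (e/2)\<^sup>2"
      proof (rule LIMSEQ_le_const2)
        show "(\<lambda>N. \<Sum>n<N. (cmod (coord (X m - Abs_ell2 a) n))\<^sup>2) \<longlonglongrightarrow> (norm (X m - Abs_ell2 a))\<^sup>2"
          using norm_sq_sums unfolding sums_def .
        show "\<exists>N. \<forall>n\<ge>N. (\<Sum>k<n. (cmod (coord (X m - Abs_ell2 a) k))\<^sup>2) \<le> (e/2)\<^sup>2"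
          using part[OF M that] by (simp only: coord_diff coord_Abs[OF a_sq]) blast
      qed
      then have "norm (X m - Abs_ell2 a) \<le> e/2" using \<open>e > 0\<close> by (auto dest: power2_le_imp_le)
      then show ?thesis using \<open>e > 0\<close> by simp
    qed
    then show "\<exists>M. \<forall>m\<ge>M. norm (X m - Abs_ell2 a) < e" by blast
  qed
  then show "convergent X" by (rule convergentI)
qed

instance ell2 :: banach ..

section \<open>Gram-Schmidt coordinates\<close>

text \<open>The coordinates with respect to the Gram-Schmidt orthonormalisation of a sequence are given
  by a recursion on scalars, which shows that they depend measurably on the Gram matrix. Where a
  vector depends linearly on the previous ones, the division by zero yields the coordinate \<open>0\<close>.\<close>

function gs_coeff :: "'h hilbert \<Rightarrow> (nat \<Rightarrow> 'h) \<Rightarrow> nat \<Rightarrow> 'h \<Rightarrow> complex" where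
  "gs_coeff H f n v =
     (inner_prod H v (f n) - (\<Sum>k<n. cnj (gs_coeff H f k (f n)) * gs_coeff H f k v)) /
     complex_of_real (sqrt (Re (inner_prod H (f n) (f n)) - (\<Sum>k<n. (cmod (gs_coeff H f k (f n)))\<^sup>2)))"
  by pat_completeness auto
termination by (relation "Wellfounded.measure (\<lambda>(H, f, n, v). n)") auto

declare gs_coeff.simps [simp del]

section \<open>Geometry of a Hilbert space with explicit carrier\<close>

context hilbert_space
begin

lemma complex_ring_simps [simp]:
  "carrier complex_ring = UNIV" "a \<oplus>\<^bsub>complex_ring\<^esub> b = a + b" "a \<otimes>\<^bsub>complex_ring\<^esub> b = a * b"
  "\<one>\<^bsub>complex_ring\<^esub> = 1" "\<zero>\<^bsub>complex_ring\<^esub> = 0"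
  by (simp_all add: complex_ring_def)

lemma scale_closed [simp]: "x \<in> carrier H \<Longrightarrow> a \<odot>\<^bsub>H\<^esub> x \<in> carrier H"
  using smult_closed[of a x] by simp

lemma inner_zero_left [simp]: "y \<in> carrier H \<Longrightarrow> inner_prod H \<zero>\<^bsub>H\<^esub> y = 0"
  using inner_add[of "\<zero>\<^bsub>H\<^esub>" "\<zero>\<^bsub>H\<^esub>" y] by simp

lemma inner_zero_right [simp]: "y \<in> carrier H \<Longrightarrow> inner_prod H y \<zero>\<^bsub>H\<^esub> = 0"
  using inner_cnj[of "\<zero>\<^bsub>H\<^esub>" y] by simp

lemma inner_neg: "\<lbrakk>x \<in> carrier H; y \<in> carrier H\<rbrakk> \<Longrightarrow> inner_prod H (\<ominus>\<^bsub>H\<^esub> x) y = - inner_prod H x y"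
  using inner_add[of "\<ominus>\<^bsub>H\<^esub> x" x y] by (simp add: M.l_neg eq_neg_iff_add_eq_0)

lemma inner_diff:
  "\<lbrakk>x \<in> carrier H; y \<in> carrier H; z \<in> carrier H\<rbrakk> \<Longrightarrow>
     inner_prod H (x \<ominus>\<^bsub>H\<^esub> y) z = inner_prod H x z - inner_prod H y z"
  by (simp add: M.minus_eq inner_add inner_neg)

lemma inner_add_right:
  "\<lbrakk>x \<in> carrier H; y \<in> carrier H; z \<in> carrier H\<rbrakk> \<Longrightarrow>
     inner_prod H z (x \<oplus>\<^bsub>H\<^esub> y) = inner_prod H z x + inner_prod H z y"
  using inner_cnj[of "x \<oplus>\<^bsub>H\<^esub> y" z] inner_cnj[of x z] inner_cnj[of y z] by (simp add: inner_add)

lemma inner_diff_right: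
  "\<lbrakk>x \<in> carrier H; y \<in> carrier H; z \<in> carrier H\<rbrakk> \<Longrightarrow>
     inner_prod H z (x \<ominus>\<^bsub>H\<^esub> y) = inner_prod H z x - inner_prod H z y"
  using inner_cnj[of "x \<ominus>\<^bsub>H\<^esub> y" z] inner_cnj[of x z] inner_cnj[of y z] by (simp add: inner_diff)

lemma inner_scale_right:
  "\<lbrakk>x \<in> carrier H; z \<in> carrier H\<rbrakk> \<Longrightarrow> inner_prod H z (a \<odot>\<^bsub>H\<^esub> x) = cnj a * inner_prod H z x"
  using inner_cnj[of "a \<odot>\<^bsub>H\<^esub> x" z] inner_cnj[of x z] by (simp add: inner_scale)

lemma hnorm_nonneg [simp]: "x \<in> carrier H \<Longrightarrow> 0 \<le> hnorm H x"
  by (simp add: hnorm_def inner_nonneg)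

lemma hnorm_sq: "x \<in> carrier H \<Longrightarrow> (hnorm H x)\<^sup>2 = Re (inner_prod H x x)"
  by (simp add: hnorm_def inner_nonneg)

lemma inner_self: "x \<in> carrier H \<Longrightarrow> inner_prod H x x = complex_of_real ((hnorm H x)\<^sup>2)"
  unfolding hnorm_sq using inner_cnj[of x x] by (simp add: complex_eq_iff)

lemma eq_if_diff_zero:
  assumes "x \<in> carrier H" "y \<in> carrier H" "x \<ominus>\<^bsub>H\<^esub> y = \<zero>\<^bsub>H\<^esub>"
  shows "x = y"
proof -
  have "(x \<ominus>\<^bsub>H\<^esub> y) \<oplus>\<^bsub>H\<^esub> y = x" using assms(1,2) by (simp add: M.minus_eq M.a_assoc M.l_neg)
  then show ?thesis using assms by simp
qed

lemma inner_eqI: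
  assumes "x \<in> carrier H" "y \<in> carrier H"
    "\<And>z. z \<in> carrier H \<Longrightarrow> inner_prod H z x = inner_prod H z y"
  shows "x = y"
proof -
  have "inner_prod H (x \<ominus>\<^bsub>H\<^esub> y) (x \<ominus>\<^bsub>H\<^esub> y) = 0"
    using assms by (subst inner_diff_right) auto
  then have "x \<ominus>\<^bsub>H\<^esub> y = \<zero>\<^bsub>H\<^esub>" using assms by (intro inner_definite) auto
  then show ?thesis by (rule eq_if_diff_zero[OF assms(1,2)])
qed

lemma Cauchy_Schwarz:
  assumes x: "x \<in> carrier H" and y: "y \<in> carrier H"
  shows "cmod (inner_prod H x y) \<le> hnorm H x * hnorm H y"
proof (cases "hnorm H y = 0")
  case True
  then have "y = \<zero>\<^bsub>H\<^esub>" using inner_self[OF y] y by (intro inner_definite) auto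
  then show ?thesis using x True by simp
next
  case False
  define z where "z = inner_prod H x y"
  define Y where "Y = (hnorm H y)\<^sup>2"
  \<comment> \<open>This is the component of \<open>x\<close> orthogonal to \<open>y\<close>,
    multiplied by the squared norm of \<open>y\<close> to avoid a division; its own squared norm is
    nonnegative.\<close>
  define w where "w = (complex_of_real Y \<odot>\<^bsub>H\<^esub> x) \<ominus>\<^bsub>H\<^esub> (z \<odot>\<^bsub>H\<^esub> y)"
  have wc: "w \<in> carrier H" using x y by (simp add: w_def)
  have zz: "inner_prod H y x = cnj z" "z * cnj z = complex_of_real ((cmod z)\<^sup>2)"
    using inner_cnj[OF x y] complex_norm_square[of z] by (simp_all add: z_def del: of_real_power)
  have "inner_prod H w w = complex_of_real Y * (complex_of_real Y * complex_of_real ((hnorm H x)\<^sup>2) - z * cnj z)"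
    unfolding w_def using x y inner_self[OF x] inner_self[OF y]
    by (simp add: inner_diff inner_diff_right inner_scale inner_scale_right zz(1) z_def[symmetric] Y_def[symmetric] algebra_simps del: of_real_power)
  also have "\<dots> = complex_of_real (Y * (Y * (hnorm H x)\<^sup>2 - (cmod z)\<^sup>2))"
    unfolding zz by simp
  finally have "0 \<le> Y * (Y * (hnorm H x)\<^sup>2 - (cmod z)\<^sup>2)" using inner_nonneg[OF wc] by simp
  moreover have "0 < Y" using False by (simp add: Y_def)
  ultimately have "(cmod z)\<^sup>2 \<le> (hnorm H x * hnorm H y)\<^sup>2"
    by (simp add: zero_le_mult_iff Y_def power_mult_distrib mult.commute)
  then show ?thesis unfolding z_def using x y by (auto intro: power2_le_imp_le)
qed

text \<open>The vector \<open>p\<close> is the combination of the \<open>e k\<close> with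
  coefficients \<open>c k\<close>. Inner products determine it, so no finite sums in the module are
  formed; the conjugates come from antilinearity in the second argument.\<close>

lemma linear_combination:
  fixes e :: "nat \<Rightarrow> 'h"
  assumes "\<And>k. e k \<in> carrier H"
  shows "\<exists>p\<in>carrier H. \<forall>v\<in>carrier H. inner_prod H v p = (\<Sum>k<n. cnj (c k) * inner_prod H v (e k))"
proof (induction n)
  case 0
  then show ?case by (intro bexI[of _ "\<zero>\<^bsub>H\<^esub>"]) auto
next
  case (Suc n)
  then obtain p where "p \<in> carrier H" "\<forall>v\<in>carrier H. inner_prod H v p = (\<Sum>k<n. cnj (c k) * inner_prod H v (e k))"
    by blast
  then show ?case using assms
    by (intro bexI[of _ "p \<oplus>\<^bsub>H\<^esub> (c n \<odot>\<^bsub>H\<^esub> e n)"]) (auto simp: inner_add_right inner_scale_right)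
qed

definition orthonormal_or_zero :: "(nat \<Rightarrow> 'h) \<Rightarrow> nat \<Rightarrow> bool" where
  "orthonormal_or_zero e n \<longleftrightarrow>
     (\<forall>k<n. e k \<in> carrier H \<and> (inner_prod H (e k) (e k) = 1 \<or> e k = \<zero>\<^bsub>H\<^esub>)) \<and>
     (\<forall>j<n. \<forall>k<n. j \<noteq> k \<longrightarrow> inner_prod H (e j) (e k) = 0)"

text \<open>One subtracts from \<open>f n\<close> its projection onto the earlier vectors and
  normalises. The last conjunct stands in for the equality of spans: a vector orthogonal to the new
  system is orthogonal to \<open>f n\<close>.\<close>

lemma gram_schmidt_step:
  assumes f: "f n \<in> carrier H" and e: "orthonormal_or_zero e n"
    and gs: "\<And>k v. k < n \<Longrightarrow> v \<in> carrier H \<Longrightarrow> gs_coeff H f k v = inner_prod H v (e k)"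
  shows "\<exists>w. w \<in> carrier H \<and> (\<forall>v\<in>carrier H. gs_coeff H f n v = inner_prod H v w) \<and>
     (inner_prod H w w = 1 \<or> w = \<zero>\<^bsub>H\<^esub>) \<and> (\<forall>k<n. inner_prod H (e k) w = 0) \<and>
     (\<forall>v\<in>carrier H. inner_prod H v w = 0 \<longrightarrow> (\<forall>k<n. inner_prod H v (e k) = 0) \<longrightarrow> inner_prod H v (f n) = 0)"
proof -
  have ec: "k < n \<Longrightarrow> e k \<in> carrier H" for k using e by (simp add: orthonormal_or_zero_def)
  define e' where "e' k = (if k < n then e k else \<zero>\<^bsub>H\<^esub>)" for k
  have "\<And>k. e' k \<in> carrier H" using ec by (simp add: e'_def)
  \<comment> \<open>The vector \<open>p\<close> is the orthogonal projection of \<open>f n\<close>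
    onto the span of the earlier \<open>e k\<close>.\<close>
  from linear_combination[of e', where n = n and c = "\<lambda>k. inner_prod H (f n) (e k)", OF this]
  obtain p where p: "p \<in> carrier H" "\<forall>v\<in>carrier H. inner_prod H v p = (\<Sum>k<n. cnj (inner_prod H (f n) (e k)) * inner_prod H v (e k))"
    by (auto simp: e'_def)
  define u where "u = f n \<ominus>\<^bsub>H\<^esub> p"
  have u: "u \<in> carrier H" using f p by (simp add: u_def)
  have vu: "inner_prod H v u = inner_prod H v (f n) - (\<Sum>k<n. cnj (inner_prod H (f n) (e k)) * inner_prod H v (e k))"
    if "v \<in> carrier H" for v
    using that f p by (simp add: u_def inner_diff_right)
  have eu: "inner_prod H (e j) u = 0" if "j < n" for j
  proof -
    have "(\<Sum>k<n. cnj (inner_prod H (f n) (e k)) * inner_prod H (e j) (e k)) =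
        (\<Sum>k<n. if k = j then cnj (inner_prod H (f n) (e j)) * inner_prod H (e j) (e j) else 0)"
      using e that by (intro sum.cong) (auto simp: orthonormal_or_zero_def)
    also have "\<dots> = cnj (inner_prod H (f n) (e j)) * inner_prod H (e j) (e j)"
      using that by (simp add: sum.delta)
    also have "\<dots> = inner_prod H (e j) (f n)"
      using e that f inner_cnj[OF f ec[OF that]] by (auto simp: orthonormal_or_zero_def)
    finally show ?thesis using vu[OF ec[OF that]] by simp
  qed
  have pu: "inner_prod H u p = 0"
    using p(2) u eu inner_cnj[OF ec u] by (intro trans[OF p(2)[rule_format, OF u]] sum.neutral) auto
  have uu: "inner_prod H u u = inner_prod H (f n) (f n) - (\<Sum>k<n. complex_of_real ((cmod (inner_prod H (f n) (e k)))\<^sup>2))"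
  proof -
    have "inner_prod H u u = inner_prod H u (f n)"
      using pu u f p by (simp add: u_def inner_diff_right)
    also have "\<dots> = cnj (inner_prod H (f n) u)" using inner_cnj[OF f u] .
    also have "inner_prod H (f n) u = inner_prod H (f n) (f n) - (\<Sum>k<n. complex_of_real ((cmod (inner_prod H (f n) (e k)))\<^sup>2))"
      unfolding vu[OF f] by (simp add: complex_norm_square mult.commute del: of_real_power)
    finally show ?thesis using inner_cnj[OF f f] by (simp del: of_real_power)
  qed
  define N where "N = sqrt (Re (inner_prod H (f n) (f n)) - (\<Sum>k<n. (cmod (inner_prod H (f n) (e k)))\<^sup>2))"
  have Re_uu: "Re (inner_prod H u u) = Re (inner_prod H (f n) (f n)) - (\<Sum>k<n. (cmod (inner_prod H (f n) (e k)))\<^sup>2)"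
    unfolding uu by (simp add: Re_sum)
  have N: "N = hnorm H u" unfolding N_def hnorm_def Re_uu ..
  have gsn: "gs_coeff H f n v = inner_prod H v u / complex_of_real N" if "v \<in> carrier H" for v
    unfolding vu[OF that] N_def using gs that f
    by (subst gs_coeff.simps) simp
  \<comment> \<open>For \<open>N = 0\<close> the inverse is \<open>0\<close> and \<open>w\<close> is
    the zero vector, in agreement with the division by zero in \<open>gs_coeff\<close>;
    \<open>u\<close> is then zero as well, that is, \<open>f n\<close> already lies in the earlier
    span.\<close>
  define w where "w = complex_of_real (inverse N) \<odot>\<^bsub>H\<^esub> u"
  have w: "w \<in> carrier H" using u by (simp add: w_def)
  have vw: "inner_prod H v w = inner_prod H v u / complex_of_real N" if "v \<in> carrier H" for v
    using that u by (simp add: w_def inner_scale_right divide_inverse mult.commute)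
  have u0: "u = \<zero>\<^bsub>H\<^esub>" if "N = 0" using that inner_self[OF u] u N by (intro inner_definite) auto
  show ?thesis
  proof (intro exI[of _ w] conjI ballI allI impI w)
    show "gs_coeff H f n v = inner_prod H v w" if "v \<in> carrier H" for v using gsn vw that by simp
    show "inner_prod H w w = 1 \<or> w = \<zero>\<^bsub>H\<^esub>"
    proof (cases "N = 0")
      case True
      then show ?thesis using u0 w by (auto intro!: disjI2 inner_eqI simp: vw)
    next
      case False
      have "inner_prod H w w = inner_prod H u u / (complex_of_real N * complex_of_real N)"
        unfolding vw[OF w] using u by (simp add: w_def inner_scale divide_inverse)
      then show ?thesis using inner_self[OF u] N False by (simp add: power2_eq_square)
    qed
    show "inner_prod H (e k) w = 0" if "k < n" for k using vw[OF ec[OF that]] eu[OF that] by simp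
    show "inner_prod H v (f n) = 0"
      if v: "v \<in> carrier H" and "inner_prod H v w = 0" "\<forall>k<n. inner_prod H v (e k) = 0" for v
      using that vu[OF v] vw[OF v] u0 v by (cases "N = 0") auto
  qed
qed

lemma gram_schmidt:
  assumes f: "\<And>n. f n \<in> carrier H"
  obtains e where "\<And>n. e n \<in> carrier H" "\<And>n. inner_prod H (e n) (e n) = 1 \<or> e n = \<zero>\<^bsub>H\<^esub>"
    "\<And>j k. j \<noteq> k \<Longrightarrow> inner_prod H (e j) (e k) = 0"
    "\<And>n v. v \<in> carrier H \<Longrightarrow> gs_coeff H f n v = inner_prod H v (e n)"
    "\<And>v n. v \<in> carrier H \<Longrightarrow> (\<And>k. inner_prod H v (e k) = 0) \<Longrightarrow> inner_prod H v (f n) = 0"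
proof -
  \<comment> \<open>Describing \<open>e n\<close> through the functional that it represents avoids a
    recursive choice: the representing vector is unique, so the \<open>w\<close> found at stage
    \<open>n\<close> must be \<open>e n\<close>.\<close>
  define e where "e n = (SOME w. w \<in> carrier H \<and> (\<forall>v\<in>carrier H. gs_coeff H f n v = inner_prod H v w))" for n
  define P where "P n w \<longleftrightarrow> w \<in> carrier H \<and> (\<forall>v\<in>carrier H. gs_coeff H f n v = inner_prod H v w) \<and>
     (inner_prod H w w = 1 \<or> w = \<zero>\<^bsub>H\<^esub>) \<and> (\<forall>k<n. inner_prod H (e k) w = 0) \<and>
     (\<forall>v\<in>carrier H. inner_prod H v w = 0 \<longrightarrow> (\<forall>k<n. inner_prod H v (e k) = 0) \<longrightarrow> inner_prod H v (f n) = 0)" for n w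
  have P: "P n (e n)" for n
  proof (induction n rule: less_induct)
    case (less n)
    have "orthonormal_or_zero e n"
      unfolding orthonormal_or_zero_def
    proof (intro conjI allI impI)
      show "inner_prod H (e j) (e k) = 0" if "j < n" "k < n" "j \<noteq> k" for j k
      proof (cases "j < k")
        case True
        then show ?thesis using less[OF \<open>k < n\<close>] by (simp add: P_def)
      next
        case False
        then have "inner_prod H (e k) (e j) = 0" using that less[OF \<open>j < n\<close>] by (simp add: P_def)
        then show ?thesis using inner_cnj[of "e k" "e j"] less[OF \<open>j < n\<close>] less[OF \<open>k < n\<close>] by (simp add: P_def)
      qed
    qed (use less in \<open>auto simp: P_def\<close>)
    then have "\<exists>w. P n w"
      unfolding P_def
    proof (rule gram_schmidt_step[OF f])
      show "gs_coeff H f k v = inner_prod H v (e k)" if "k < n" "v \<in> carrier H" for k v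
        using less[OF \<open>k < n\<close>] \<open>v \<in> carrier H\<close> by (simp add: P_def)
    qed
    then obtain w where w: "P n w" by blast
    have ex: "e n \<in> carrier H \<and> (\<forall>v\<in>carrier H. gs_coeff H f n v = inner_prod H v (e n))"
      unfolding e_def by (rule someI[of _ w]) (use w in \<open>simp add: P_def\<close>)
    then have "e n = w" using w by (intro inner_eqI) (auto simp: P_def)
    then show ?case using w by simp
  qed
  show thesis
  proof
    show "inner_prod H (e j) (e k) = 0" if "j \<noteq> k" for j k
    proof (cases "j < k")
      case True
      then show ?thesis using P[of k] by (simp add: P_def)
    next
      case False
      then have "inner_prod H (e k) (e j) = 0" using that P[of j] by (simp add: P_def)
      then show ?thesis using inner_cnj[of "e k" "e j"] P[of j] P[of k] by (simp add: P_def)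
    qed
  qed (use P in \<open>auto simp: P_def\<close>)
qed

end

section \<open>The isometric embedding of a fibre into \<open>ell2\<close>\<close>

definition gs_embed :: "'h hilbert \<Rightarrow> (nat \<Rightarrow> 'h) \<Rightarrow> 'h \<Rightarrow> ell2" where
  "gs_embed H f v = Abs_ell2 (\<lambda>n. gs_coeff H f n v)"

text \<open>These are the axioms of the fundamental sections at one point. Separation says that the
  \<open>f n\<close> span a dense subspace.\<close>

locale separating_sequence = hilbert_space H for H :: "'h hilbert" +
  fixes f :: "nat \<Rightarrow> 'h"
  assumes seq_closed: "f n \<in> carrier H"
    and separating: "\<lbrakk>v \<in> carrier H; w \<in> carrier H; \<And>n. inner_prod H (f n) v = inner_prod H (f n) w\<rbrakk> \<Longrightarrow> v = w"
begin

text \<open>The partial expansions \<open>p n\<close> of \<open>v\<close> form a Cauchy sequence,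
  because their squared norms \<open>S n\<close> increase and stay below that of \<open>v\<close>.
  Their limit has the same coefficients as \<open>v\<close>, hence the same inner products with all
  \<open>f n\<close>, and separation identifies the two.\<close>

lemma parseval:
  assumes v: "v \<in> carrier H"
  shows "(\<lambda>n. (cmod (gs_coeff H f n v))\<^sup>2) sums (hnorm H v)\<^sup>2"
proof -
  obtain e where e: "\<And>n. e n \<in> carrier H" "\<And>n. inner_prod H (e n) (e n) = 1 \<or> e n = \<zero>\<^bsub>H\<^esub>"
    "\<And>j k. j \<noteq> k \<Longrightarrow> inner_prod H (e j) (e k) = 0"
    "\<And>n v. v \<in> carrier H \<Longrightarrow> gs_coeff H f n v = inner_prod H v (e n)"
    "\<And>v n. v \<in> carrier H \<Longrightarrow> (\<And>k. inner_prod H v (e k) = 0) \<Longrightarrow> inner_prod H v (f n) = 0"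
    using gram_schmidt[of f] seq_closed by blast
  define c where "c k = inner_prod H v (e k)" for k
  define S where "S n = (\<Sum>k<n. (cmod (c k))\<^sup>2)" for n
  have "\<forall>n. \<exists>p. p \<in> carrier H \<and> (\<forall>w\<in>carrier H. inner_prod H w p = (\<Sum>k<n. cnj (c k) * inner_prod H w (e k)))"
    using linear_combination[of e, where c = c] e(1) by blast
  then obtain p where p: "\<And>n. p n \<in> carrier H"
    "\<And>n w. w \<in> carrier H \<Longrightarrow> inner_prod H w (p n) = (\<Sum>k<n. cnj (c k) * inner_prod H w (e k))" by metis
  have pe: "inner_prod H (p n) (e j) = (if j < n then c j else 0)" for n j
  proof -
    have "inner_prod H (e j) (p n) = (\<Sum>k<n. if k = j then cnj (c j) * inner_prod H (e j) (e j) else 0)"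
      unfolding p(2)[OF e(1)] using e(3) by (intro sum.cong) auto
    also have "\<dots> = (if j < n then cnj (c j) * inner_prod H (e j) (e j) else 0)" by (simp add: sum.delta)
    also have "\<dots> = (if j < n then cnj (c j) else 0)" using e(2)[of j] v by (auto simp: c_def)
    finally show ?thesis using inner_cnj[OF e(1)[of j] p(1)[of n]] by simp
  qed
  have pp: "inner_prod H (p m) (p n) = complex_of_real (S (min m n))" for m n
  proof -
    have "inner_prod H (p m) (p n) = (\<Sum>k<n. if k < m then cnj (c k) * c k else 0)"
      unfolding p(2)[OF p(1)] pe by (intro sum.cong) auto
    also have "\<dots> = (\<Sum>k<min m n. cnj (c k) * c k)"
      by (rule sum.mono_neutral_cong_right) auto
    finally show ?thesis by (simp add: S_def complex_norm_square mult.commute del: of_real_power)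
  qed
  have vp: "inner_prod H v (p n) = complex_of_real (S n)" "inner_prod H (p n) v = complex_of_real (S n)" for n
  proof -
    show 1: "inner_prod H v (p n) = complex_of_real (S n)"
      unfolding p(2)[OF v] c_def[symmetric] by (simp add: S_def complex_norm_square mult.commute del: of_real_power)
    show "inner_prod H (p n) v = complex_of_real (S n)" using inner_cnj[OF v p(1)[of n]] 1 by simp
  qed
  have dist_p: "(hnorm H (p m \<ominus>\<^bsub>H\<^esub> p n))\<^sup>2 = \<bar>S m - S n\<bar>" for m n
  proof -
    have "S i \<le> S j" if "i \<le> j" for i j unfolding S_def using that by (intro sum_mono2) auto
    then show ?thesis using p(1) by (cases "m \<le> n") (auto simp: hnorm_sq inner_diff inner_diff_right pp min_def)
  qed
  \<comment> \<open>Pythagoras: nonnegativity of the left side is Bessel's inequality, and its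
    convergence to \<open>0\<close> is the claim.\<close>
  have dist_v: "(hnorm H (v \<ominus>\<^bsub>H\<^esub> p n))\<^sup>2 = (hnorm H v)\<^sup>2 - S n" for n
    using p(1) v by (simp add: hnorm_sq inner_diff inner_diff_right vp pp)
  have "S n \<le> (hnorm H v)\<^sup>2" for n using dist_v[of n] zero_le_power2[of "hnorm H (v \<ominus>\<^bsub>H\<^esub> p n)"] by linarith
  moreover have "incseq S" unfolding S_def by (intro incseq_SucI) simp
  ultimately have "convergent S" by (intro Bseq_mono_convergent[OF Bseq_eq_bounded[THEN iffD2, rotated]] boundedI[where B = "(hnorm H v)\<^sup>2"])
     (auto simp: incseq_def S_def sum_nonneg)
  then have "Cauchy S" by (rule convergent_Cauchy)
  have "\<exists>l\<in>carrier H. (\<lambda>n. hnorm H (p n \<ominus>\<^bsub>H\<^esub> l)) \<longlonglongrightarrow> 0"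
  proof (rule complete)
    fix r :: real assume "r > 0"
    then obtain N where N: "\<forall>m\<ge>N. \<forall>n\<ge>N. norm (S m - S n) < r\<^sup>2" using CauchyD[OF \<open>Cauchy S\<close>, of "r\<^sup>2"] by auto
    have "hnorm H (p m \<ominus>\<^bsub>H\<^esub> p n) < r" if "N \<le> m" "N \<le> n" for m n
    proof -
      have "(hnorm H (p m \<ominus>\<^bsub>H\<^esub> p n))\<^sup>2 < r\<^sup>2" using N that by (simp add: dist_p)
      then show ?thesis using \<open>r > 0\<close> by (simp add: power_less_imp_less_base)
    qed
    then show "\<exists>N. \<forall>m\<ge>N. \<forall>n\<ge>N. hnorm H (p m \<ominus>\<^bsub>H\<^esub> p n) < r" by blast
  qed (rule p)
  then obtain l where l: "l \<in> carrier H" "(\<lambda>n. hnorm H (p n \<ominus>\<^bsub>H\<^esub> l)) \<longlonglongrightarrow> 0" by blast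
  have le: "inner_prod H l (e j) = c j" for j
  proof -
    have "(\<lambda>n. inner_prod H (p n \<ominus>\<^bsub>H\<^esub> l) (e j)) \<longlonglongrightarrow> 0"
    proof (rule tendsto_norm_zero_cancel, rule tendsto_sandwich[of "\<lambda>_. 0"])
      show "(\<lambda>n. hnorm H (p n \<ominus>\<^bsub>H\<^esub> l) * hnorm H (e j)) \<longlonglongrightarrow> 0" using tendsto_mult[OF l(2) tendsto_const] by simp
      show "\<forall>\<^sub>F n in sequentially. norm (inner_prod H (p n \<ominus>\<^bsub>H\<^esub> l) (e j)) \<le> hnorm H (p n \<ominus>\<^bsub>H\<^esub> l) * hnorm H (e j)"
        using Cauchy_Schwarz p(1) l(1) e(1) by simp
    qed auto
    moreover have "\<forall>\<^sub>F n in sequentially. inner_prod H (p n \<ominus>\<^bsub>H\<^esub> l) (e j) = c j - inner_prod H l (e j)"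
      using p(1) l(1) e(1) by (intro eventually_sequentiallyI[of "Suc j"]) (simp add: inner_diff pe)
    ultimately have "(\<lambda>n. c j - inner_prod H l (e j)) \<longlonglongrightarrow> 0" by (simp add: tendsto_cong)
    then have "c j - inner_prod H l (e j) = 0" by (simp only: LIMSEQ_const_iff)
    then show ?thesis by simp
  qed
  have "v = l"
  proof (rule separating[OF v l(1)])
    fix n
    have "inner_prod H (v \<ominus>\<^bsub>H\<^esub> l) (e k) = 0" for k using v l(1) e(1) le by (simp add: inner_diff c_def)
    then have "inner_prod H (v \<ominus>\<^bsub>H\<^esub> l) (f n) = 0" using v l(1) e(5)[of "v \<ominus>\<^bsub>H\<^esub> l"] by simp
    then have "inner_prod H v (f n) = inner_prod H l (f n)" using v l(1) seq_closed by (simp add: inner_diff)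
    then show "inner_prod H (f n) v = inner_prod H (f n) l"
      using inner_cnj[OF v seq_closed[of n]] inner_cnj[OF l(1) seq_closed[of n]] by simp
  qed
  have "(hnorm H (v \<ominus>\<^bsub>H\<^esub> p n))\<^sup>2 = (hnorm H (p n \<ominus>\<^bsub>H\<^esub> l))\<^sup>2" for n
    using v p(1) l(1) \<open>v = l\<close> by (simp add: hnorm_sq inner_diff inner_diff_right)
  then have "(hnorm H v)\<^sup>2 - (hnorm H (p n \<ominus>\<^bsub>H\<^esub> l))\<^sup>2 = S n" for n using dist_v[of n] by simp
  moreover have "(\<lambda>n. (hnorm H v)\<^sup>2 - (hnorm H (p n \<ominus>\<^bsub>H\<^esub> l))\<^sup>2) \<longlonglongrightarrow> (hnorm H v)\<^sup>2 - 0\<^sup>2"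
    by (intro tendsto_intros l)
  ultimately have "S \<longlonglongrightarrow> (hnorm H v)\<^sup>2" by simp
  moreover have "S = (\<lambda>n. \<Sum>k<n. (cmod (gs_coeff H f k v))\<^sup>2)"
    using e(4)[OF v] by (auto simp: S_def c_def)
  ultimately show ?thesis by (simp add: sums_def)
qed

lemma gs_linear:
  assumes "x \<in> carrier H" "y \<in> carrier H"
  shows "gs_coeff H f n (x \<oplus>\<^bsub>H\<^esub> y) = gs_coeff H f n x + gs_coeff H f n y"
    "gs_coeff H f n (a \<odot>\<^bsub>H\<^esub> x) = a * gs_coeff H f n x"
proof -
  obtain e where "\<And>n. e n \<in> carrier H" "\<And>n v. v \<in> carrier H \<Longrightarrow> gs_coeff H f n v = inner_prod H v (e n)"
    using gram_schmidt[of f] seq_closed by metis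
  then show "gs_coeff H f n (x \<oplus>\<^bsub>H\<^esub> y) = gs_coeff H f n x + gs_coeff H f n y"
    "gs_coeff H f n (a \<odot>\<^bsub>H\<^esub> x) = a * gs_coeff H f n x"
    using assms by (simp_all add: inner_add inner_scale)
qed

abbreviation "J \<equiv> gs_embed H f"

lemma coord_embed: "v \<in> carrier H \<Longrightarrow> coord (J v) n = gs_coeff H f n v"
  using parseval[of v] by (simp add: gs_embed_def sq_summable_def sums_iff)

lemma embed_add: "\<lbrakk>x \<in> carrier H; y \<in> carrier H\<rbrakk> \<Longrightarrow> J (x \<oplus>\<^bsub>H\<^esub> y) = J x + J y"
  by (rule ell2_eqI) (simp add: coord_embed gs_linear)

lemma embed_scale: "x \<in> carrier H \<Longrightarrow> J (a \<odot>\<^bsub>H\<^esub> x) = cscale a (J x)"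
  by (rule ell2_eqI) (simp add: coord_embed gs_linear)

lemma norm_embed: "x \<in> carrier H \<Longrightarrow> norm (J x) = hnorm H x"
proof -
  assume x: "x \<in> carrier H"
  have "(norm (J x))\<^sup>2 = (hnorm H x)\<^sup>2"
    using norm_sq_sums[of "J x"] parseval[OF x] by (intro sums_unique2) (simp_all only: coord_embed[OF x])
  then show ?thesis using x by (simp add: power2_eq_iff_nonneg)
qed

lemma embed_zero: "J \<zero>\<^bsub>H\<^esub> = 0"
  using norm_embed[of "\<zero>\<^bsub>H\<^esub>"] by (simp add: hnorm_def)

lemma embed_diff:
  assumes "x \<in> carrier H" "y \<in> carrier H"
  shows "J (x \<ominus>\<^bsub>H\<^esub> y) = J x - J y"
  using embed_add[of "x \<ominus>\<^bsub>H\<^esub> y" y] assms by (simp add: M.minus_eq M.a_assoc M.l_neg)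

lemma embed_inj:
  assumes "x \<in> carrier H" "y \<in> carrier H" "J x = J y"
  shows "x = y"
proof (rule eq_if_diff_zero[OF assms(1,2)])
  have "hnorm H (x \<ominus>\<^bsub>H\<^esub> y) = 0"
    using norm_embed[of "x \<ominus>\<^bsub>H\<^esub> y"] embed_diff[of x y] assms by simp
  then show "x \<ominus>\<^bsub>H\<^esub> y = \<zero>\<^bsub>H\<^esub>"
    using inner_self[of "x \<ominus>\<^bsub>H\<^esub> y"] assms by (intro inner_definite) simp_all
qed

text \<open>Polarisation: the norm of a sum gives the real part, and multiplying \<open>y\<close> by
  \<open>\<i>\<close> turns the imaginary part into a real part.\<close>

lemma cinner_embed:
  assumes x: "x \<in> carrier H" and y: "y \<in> carrier H"
  shows "cinner (J x) (J y) = inner_prod H x y"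
proof -
  have Re: "Re (cinner (J x) (J y)) = Re (inner_prod H x y)" if "y \<in> carrier H" for y
  proof -
    have "(norm (J x + J y))\<^sup>2 = (hnorm H (x \<oplus>\<^bsub>H\<^esub> y))\<^sup>2"
      using norm_embed[of "x \<oplus>\<^bsub>H\<^esub> y"] embed_add[OF x that] x that by simp
    moreover have "(norm (J x + J y))\<^sup>2 = (norm (J x))\<^sup>2 + (norm (J y))\<^sup>2 + 2 * Re (cinner (J x) (J y))"
      using cinner_commute[of "J x" "J y"]
      by (simp add: Re_cinner_self[symmetric] cinner_add_left cinner_add_right del: Re_cinner_self)
    moreover have "(hnorm H (x \<oplus>\<^bsub>H\<^esub> y))\<^sup>2 = (hnorm H x)\<^sup>2 + (hnorm H y)\<^sup>2 + 2 * Re (inner_prod H x y)"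
      using inner_cnj[OF x that] x that by (simp add: hnorm_sq inner_add inner_add_right)
    ultimately show ?thesis using norm_embed x that by simp
  qed
  have "Im (cinner (J x) (J y)) = Im (inner_prod H x y)"
    using Re[of "\<i> \<odot>\<^bsub>H\<^esub> y"] x y by (simp add: embed_scale cinner_scale_right inner_scale_right)
  then show ?thesis using Re[OF y] by (simp add: complex_eq_iff)
qed

text \<open>The embedding is isometric and its source complete, so the preimages of a convergent
  sequence converge. Closed fibres ensure that the limits in \<open>L2_complete\<close> are sections
  again.\<close>

lemma embed_closed_image:
  assumes X: "\<And>n. X n \<in> J ` carrier H" and lim: "X \<longlonglongrightarrow> l"
  shows "l \<in> J ` carrier H"
proof -
  have "\<forall>n. \<exists>v. v \<in> carrier H \<and> X n = J v" using X by (auto simp: image_iff)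
  from choice[OF this] obtain v where v: "\<And>n. v n \<in> carrier H" "\<And>n. X n = J (v n)" by blast
  have vv: "hnorm H (v m \<ominus>\<^bsub>H\<^esub> v n) = norm (X m - X n)" for m n
    using v norm_embed[of "v m \<ominus>\<^bsub>H\<^esub> v n"] by (simp add: embed_diff)
  have "Cauchy X" using lim by (rule LIMSEQ_imp_Cauchy)
  have "\<exists>w\<in>carrier H. (\<lambda>n. hnorm H (v n \<ominus>\<^bsub>H\<^esub> w)) \<longlonglongrightarrow> 0"
  proof (rule complete)
    fix r :: real assume "r > 0"
    then obtain N where "\<forall>m\<ge>N. \<forall>n\<ge>N. norm (X m - X n) < r" using CauchyD[OF \<open>Cauchy X\<close>] by blast
    then show "\<exists>N. \<forall>m\<ge>N. \<forall>n\<ge>N. hnorm H (v m \<ominus>\<^bsub>H\<^esub> v n) < r"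
      by (simp only: vv) blast
  qed (rule v)
  then obtain w where w: "w \<in> carrier H" "(\<lambda>n. hnorm H (v n \<ominus>\<^bsub>H\<^esub> w)) \<longlonglongrightarrow> 0" by blast
  have "norm (X n - J w) = hnorm H (v n \<ominus>\<^bsub>H\<^esub> w)" for n
    using v w norm_embed[of "v n \<ominus>\<^bsub>H\<^esub> w"] by (simp add: embed_diff)
  then have "(\<lambda>n. norm (X n - J w)) \<longlonglongrightarrow> 0" using w(2) by simp
  then have "X \<longlonglongrightarrow> J w" by (simp add: tendsto_norm_zero_iff LIM_zero_iff)
  then have "l = J w" using lim LIMSEQ_unique by blast
  then show ?thesis using w by blast
qed

end

section \<open>Bisections and fibres\<close>

locale etale_space =
  fixes G :: "'g::{second_countable_topology, t2_space} groupoid"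
  assumes locally_compact: "locally_compact_space (euclidean :: 'g topology)"
    and etale: "etale_groupoid G"
    and units_compact: "compact (units G)"
begin

abbreviation "s \<equiv> src G"
abbreviation "r \<equiv> rng G"
abbreviation "i \<equiv> ginv G"
abbreviation "m \<equiv> gmult G"

lemma arr_UNIV [simp]: "arr G = UNIV" and grp: "groupoid G"
  and mult_continuous: "continuous_on {(g, h). s g = r h} (\<lambda>(g, h). m g h)"
  and inv_continuous: "continuous_on UNIV i"
  using etale by (auto simp: etale_groupoid_def topological_groupoid_def)

lemma src_rng [simp]: "s (s g) = s g" "r (s g) = s g" "s (r g) = r g" "r (r g) = r g"
    "s (i g) = r g" "r (i g) = s g" "m (r g) g = g" "m g (s g) = g" "m (i g) g = s g" "m g (i g) = r g"
  using groupoid.src_unit[OF grp] groupoid.rng_unit[OF grp] groupoid.unit_laws[OF grp]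
    groupoid.inv_ends[OF grp] groupoid.inv_laws[OF grp] by auto

lemma mult_ends [simp]: "s g = r h \<Longrightarrow> s (m g h) = s h" "s g = r h \<Longrightarrow> r (m g h) = r g"
  using groupoid.mult_closed[OF grp] by auto

lemma mult_assoc: "\<lbrakk>s g = r h; s h = r k\<rbrakk> \<Longrightarrow> m (m g h) k = m g (m h k)"
  using groupoid.assoc[OF grp] by simp

lemma inv_mult_cancel: "s h = r k \<Longrightarrow> m (i h) (m h k) = k"
  using mult_assoc[of "i h" h k] src_rng(7)[of k] by simp

lemma mult_inv_cancel: "r h = r g \<Longrightarrow> m h (m (i h) g) = g"
  using mult_assoc[of h "i h" g] src_rng(7)[of g] by simp

lemma inv_inv [simp]: "i (i g) = g"
  using mult_inv_cancel[of "i (i g)" g] inv_mult_cancel[of "i g" g] src_rng(8)[of "i (i g)"] by simp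

lemma units_eq: "units G = {x. s x = x}" "units G = {x. r x = x}"
  unfolding units_def by (auto simp: image_iff) (metis src_rng)+

lemma ends_in_units [simp]: "s g \<in> units G" "r g \<in> units G"
  by (auto simp: units_eq(1))

lemma src_of_unit [simp]: "x \<in> units G \<Longrightarrow> s x = x" and rng_of_unit [simp]: "x \<in> units G \<Longrightarrow> r x = x"
  by (auto simp: units_eq(1)) (metis src_rng(2))

lemma src_continuous: "continuous_on UNIV s"
proof -
  have "continuous_on UNIV (\<lambda>g. (i g, g))" by (intro continuous_intros inv_continuous)
  then have "continuous_on UNIV ((\<lambda>(g, h). m g h) \<circ> (\<lambda>g. (i g, g)))"
    by (rule continuous_on_compose) (auto intro: continuous_on_subset[OF mult_continuous])
  then show ?thesis by (simp add: o_def)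
qed

lemma rng_continuous: "continuous_on UNIV r"
proof -
  have "continuous_on UNIV (s \<circ> i)"
    by (rule continuous_on_compose[OF inv_continuous]) (auto intro: continuous_on_subset[OF src_continuous])
  then show ?thesis by (simp add: o_def)
qed

lemma src_measurable [measurable]: "s \<in> borel_measurable borel"
  and rng_measurable [measurable]: "r \<in> borel_measurable borel"
  and inv_measurable [measurable]: "i \<in> borel_measurable borel"
  by (auto intro: borel_measurable_continuous_onI src_continuous rng_continuous inv_continuous)

lemma units_borel [measurable]: "units G \<in> sets borel"
  using units_compact by (auto intro: compact_imp_closed borel_closed)

lemma space_unit_borel [simp]: "space (unit_borel G) = units G"
  by (simp add: unit_borel_def space_restrict_space)

lemma src_measurable_unit [measurable]: "s \<in> measurable borel (unit_borel G)"
  and rng_measurable_unit [measurable]: "r \<in> measurable borel (unit_borel G)"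
  unfolding unit_borel_def by (auto intro!: measurable_restrict_space2)

lemma sets_unit_borel: "A \<in> sets (unit_borel G) \<longleftrightarrow> A \<in> sets borel \<and> A \<subseteq> units G"
  by (auto simp: unit_borel_def sets_restrict_space_iff)

text \<open>A locally compact Hausdorff space is completely regular. Separating \<open>g\<close>
  from the complement of \<open>U \<inter> V\<close>, with \<open>V\<close> inside a compact set,
  gives the compact support as well.\<close>

lemma bump:
  assumes "open U" "g \<in> U"
  obtains \<phi> :: "'g \<Rightarrow> real" where "continuous_on UNIV \<phi>" "\<And>h. 0 \<le> \<phi> h" "\<And>h. \<phi> h \<le> 1" "\<phi> g = 1"
    "\<And>h. h \<notin> U \<Longrightarrow> \<phi> h = 0" "compact (closure {h. \<phi> h \<noteq> 0})"
proof -
  obtain V K where VK: "open V" "compact K" "g \<in> V" "V \<subseteq> K"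
    using locally_compact unfolding locally_compact_space_def by (simp add: compactin_euclidean_iff) metis
  have "Hausdorff_space (euclidean :: 'g topology)" unfolding Hausdorff_space_def disjnt_def by simp (metis hausdorff)
  then have "regular_space (euclidean :: 'g topology)"
    using locally_compact locally_compact_Hausdorff_imp_regular_space by blast
  then have "completely_regular_space (euclidean :: 'g topology)"
    using locally_compact locally_compact_regular_imp_completely_regular_space by blast
  moreover have "closedin euclidean (- (U \<inter> V))" "g \<in> topspace euclidean - (- (U \<inter> V))"
    using assms VK by (auto simp: open_Int)
  ultimately obtain f where f: "continuous_map euclidean (top_of_set {0..1::real}) f" "f g = 0" "f ` (- (U \<inter> V)) \<subseteq> {1}"
    unfolding completely_regular_space_def by meson
  have f01: "f h \<in> {0..1}" for h using f(1) by (auto simp: continuous_map_in_subtopology)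
  have cf: "continuous_on UNIV f" using f(1) by (simp add: continuous_map_in_subtopology)
  define \<phi> where "\<phi> h = 1 - f h" for h
  have zero: "\<phi> h = 0" if "h \<notin> U \<inter> V" for h using f(3) that by (auto simp: \<phi>_def)
  show thesis
  proof
    show "continuous_on UNIV \<phi>" unfolding \<phi>_def by (intro continuous_intros cf)
    show "0 \<le> \<phi> h" "\<phi> h \<le> 1" for h using f01[of h] by (auto simp: \<phi>_def)
    show "\<phi> g = 1" using f(2) by (simp add: \<phi>_def)
    show "\<phi> h = 0" if "h \<notin> U" for h using zero that by auto
    have "{h. \<phi> h \<noteq> 0} \<subseteq> K" using zero VK by auto
    then have "closure {h. \<phi> h \<noteq> 0} \<subseteq> K" using VK by (intro closure_minimal compact_imp_closed)
    then have "closure {h. \<phi> h \<noteq> 0} = K \<inter> closure {h. \<phi> h \<noteq> 0}" by blast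
    then show "compact (closure {h. \<phi> h \<noteq> 0})" using VK compact_Int_closed closed_closure by metis
  qed
qed

lemma bisection_cover:
  obtains U :: "nat \<Rightarrow> 'g set" where "\<And>n. open_bisection G (U n)" "(\<Union>n. U n) = UNIV"
proof -
  obtain \<B> where \<B>: "topological_basis \<B>" "\<And>U. U \<in> \<B> \<Longrightarrow> open_bisection G U"
    using etale by (auto simp: etale_groupoid_def)
  have "\<Union>\<B> = UNIV" using \<B>(1) topological_basisE[OF \<B>(1) open_UNIV] by blast
  moreover have "\<And>S. S \<in> \<B> \<Longrightarrow> open S" using \<B>(1) by (rule topological_basis_open)
  ultimately obtain \<F> where F: "\<F> \<subseteq> \<B>" "countable \<F>" "\<Union>\<F> = UNIV" using Lindelof[of \<B>] by metis
  then have "\<F> \<noteq> {}" by auto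
  then have "range (from_nat_into \<F>) = \<F>" using F(2) by simp
  then show thesis using that[of "from_nat_into \<F>"] \<B>(2) F by (metis UNIV_I image_eqI subsetD)
qed

lemma open_bisection_inj:
  assumes "open_bisection G U"
  shows "inj_on r U"
proof -
  obtain t where "homeomorphism U (r ` U) r t" using assms by (auto simp: open_bisection_def)
  then show ?thesis by (intro inj_on_inverseI[of _ t]) (simp add: homeomorphism_def)
qed

text \<open>Finitely many bisections cover \<open>K\<close>, and each meets a range fibre in at most
  one arrow; \<open>N\<close> is the number of these bisections.\<close>

lemma compact_fibre_bound:
  assumes "compact K"
  obtains N where "\<And>x. finite {g \<in> K. r g = x}" "\<And>x. card {g \<in> K. r g = x} \<le> N"
proof -
  obtain U where U: "\<And>n::nat. open_bisection G (U n)" "(\<Union>n. U n) = UNIV" using bisection_cover by metis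
  obtain I where I: "finite I" "K \<subseteq> (\<Union>n\<in>I. U n)"
  proof (rule compactE_image[OF assms, of UNIV U])
    show "open (U n)" for n using U(1) by (simp add: open_bisection_def)
  qed (use U(2) in auto)
  define F where "F x = (\<Union>n\<in>I. {g \<in> U n. r g = x})" for x
  have sub: "finite {g \<in> U n. r g = x} \<and> card {g \<in> U n. r g = x} \<le> 1" for n x
  proof -
    obtain h where h: "{g \<in> U n. r g = x} \<subseteq> {h}"
      using open_bisection_inj[OF U(1)[of n]] unfolding inj_on_def by blast
    show ?thesis using finite_subset[OF h] card_mono[OF _ h] by simp
  qed
  have F: "finite (F x)" "card (F x) \<le> card I" for x
  proof -
    show "finite (F x)" using I sub by (auto simp: F_def)
    have "card (F x) \<le> (\<Sum>n\<in>I. card {g \<in> U n. r g = x})" unfolding F_def by (rule card_UN_le[OF I(1)])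
    also have "\<dots> \<le> (\<Sum>n\<in>I. 1)" using sub by (intro sum_mono) auto
    finally show "card (F x) \<le> card I" by simp
  qed
  have KF: "{g \<in> K. r g = x} \<subseteq> F x" for x using I by (auto simp: F_def)
  show thesis
  proof
    show "finite {g \<in> K. r g = x}" for x using finite_subset[OF KF F(1)] .
    show "card {g \<in> K. r g = x} \<le> card I" for x using card_mono[OF F(1) KF] F(2) by (rule le_trans)
  qed
qed

text \<open>Made disjoint, the members of a countable cover by bisections still meet every range
  fibre at most once. The inverse of \<open>r\<close> on the \<open>n\<close>-th piece, defined over
  \<open>D n\<close>, lists each arrow of a fibre for exactly one \<open>n\<close>, so a sum over a
  fibre becomes a series with Borel terms.\<close>

lemma fibre_enumeration:
  obtains D :: "nat \<Rightarrow> 'g set" and t :: "nat \<Rightarrow> 'g \<Rightarrow> 'g" where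
    "\<And>n. D n \<in> sets borel" "\<And>n. D n \<subseteq> units G" "\<And>n. t n \<in> borel_measurable borel"
    "\<And>x. bij_betw (\<lambda>n. t n x) {n. x \<in> D n} {g. r g = x}"
proof -
  obtain U where U: "\<And>n::nat. open_bisection G (U n)" "(\<Union>n. U n) = UNIV" using bisection_cover by metis
  have "\<forall>n. \<exists>t. homeomorphism (U n) (r ` U n) r t" using U(1) by (simp add: open_bisection_def)
  then obtain t where t: "\<And>n. homeomorphism (U n) (r ` U n) r (t n)" by metis
  define B where "B = disjointed U"
  have B_sub: "B n \<subseteq> U n" for n by (simp add: B_def disjointed_subset)
  have B_disj: "k \<noteq> n \<Longrightarrow> B k \<inter> B n = {}" for k n
    using disjoint_family_disjointed[of U] by (auto simp: B_def disjoint_family_on_def)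
  have B_UN: "(\<Union>n. B n) = UNIV" using UN_disjointed_eq[of U] U(2) by (simp add: B_def)
  have B_borel: "B n \<in> sets borel" for n
  proof -
    have "range U \<subseteq> sets borel" using U(1) by (auto simp: open_bisection_def)
    from sets.range_disjointed_sets[OF this] show ?thesis by (auto simp: B_def)
  qed
  define D where "D n = r ` B n" for n
  \<comment> \<open>Images of Borel sets need not be Borel; since \<open>r\<close> is a
    homeomorphism on \<open>U n\<close>, this image is a preimage under the continuous
    inverse.\<close>
  have D_eq: "D n = (t n -` B n) \<inter> (r ` U n)" for n
    using B_sub[of n] t[of n] by (auto simp: D_def homeomorphism_def image_iff)
  have rU: "r ` U n \<in> sets borel" for n
  proof -
    obtain V where "open V" "r ` U n = units G \<inter> V" using U(1)[of n] by (auto simp: open_bisection_def openin_open)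
    then show ?thesis by (simp add: sets.Int)
  qed
  have t_meas: "t n \<in> borel_measurable (restrict_space borel (r ` U n))" for n
    using t[of n] by (intro borel_measurable_continuous_on_restrict) (simp add: homeomorphism_def)
  have D_borel: "D n \<in> sets borel" for n
    using measurable_sets[OF t_meas B_borel, of n n] rU[of n]
    by (auto simp: D_eq space_restrict_space sets_restrict_space_iff)
  \<comment> \<open>The inverse is controlled only on the image of \<open>U n\<close>; the identity
    elsewhere makes the map Borel on the whole type.\<close>
  define t' where "t' n x = (if x \<in> r ` U n then t n x else x)" for n x
  have t'_meas: "t' n \<in> borel_measurable borel" for n
    unfolding t'_def by (subst measurable_If_restrict_space_iff) (use rU t_meas in \<open>auto simp: measurable_restrict_space1\<close>)
  show thesis
  proof
    show "D n \<subseteq> units G" for n by (auto simp: D_def)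
    show "bij_betw (\<lambda>n. t' n x) {n. x \<in> D n} {g. r g = x}" for x
    proof (rule bij_betwI')
      have *: "t' n x \<in> B n \<and> r (t' n x) = x" if "x \<in> D n" for n
        using that t[of n] by (auto simp: D_eq t'_def homeomorphism_def)
      show "t' n x \<in> {g. r g = x}" if "n \<in> {n. x \<in> D n}" for n using * that by simp
      show "(t' k x = t' n x) = (k = n)" if "k \<in> {n. x \<in> D n}" "n \<in> {n. x \<in> D n}" for k n
        using *[of k] *[of n] that B_disj[of k n] by (auto simp: disjoint_iff) metis
      show "\<exists>n\<in>{n. x \<in> D n}. g = t' n x" if "g \<in> {g. r g = x}" for g
      proof -
        obtain n where n: "g \<in> B n" using B_UN by blast
        then have "x \<in> D n" "g \<in> U n" using that B_sub by (auto simp: D_def)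
        moreover have "t n x = g" using that t[of n] \<open>g \<in> U n\<close> by (auto simp: homeomorphism_def)
        ultimately show ?thesis using that by (intro bexI[of _ n]) (auto simp: t'_def image_iff)
      qed
    qed
  qed (use D_borel t'_meas in auto)
qed

end

section \<open>The measure on the arrows\<close>

locale invariant_space = etale_space G
  for G :: "'g::{second_countable_topology, t2_space} groupoid" +
  fixes \<mu> :: "'g measure"
  assumes radon: "radon_probability G \<mu>" and invariant: "invariant_measure G \<mu>"
begin

lemma space_mu [simp]: "space \<mu> = units G" and sets_mu: "sets \<mu> = sets (unit_borel G)"
  using radon by (auto simp: radon_probability_def)

lemma emeasure_units [simp]: "emeasure \<mu> (units G) = 1"
  using radon by (simp add: radon_probability_def)

sublocale finite_measure \<mu>
  by (rule finite_measureI) simp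

lemma measurable_mu_cong: "measurable \<mu> N = measurable (unit_borel G) N" "measurable N \<mu> = measurable N (unit_borel G)"
  by (intro measurable_cong_sets sets_mu refl)+

lemma ends_measurable_mu [measurable]: "s \<in> measurable borel \<mu>" "r \<in> measurable borel \<mu>"
  by (simp_all add: measurable_mu_cong)

lemma measurable_mu_if_borel: "f \<in> measurable borel N \<Longrightarrow> f \<in> measurable \<mu> N"
  unfolding measurable_mu_cong unit_borel_def by (rule measurable_restrict_space1)

lemma mu_setsI: "A \<in> sets borel \<Longrightarrow> A \<subseteq> units G \<Longrightarrow> A \<in> sets \<mu>"
  by (simp add: sets_mu sets_unit_borel)

lemma mu_setsD: "A \<in> sets \<mu> \<Longrightarrow> A \<in> sets borel" "A \<in> sets \<mu> \<Longrightarrow> A \<subseteq> units G"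
  by (simp_all add: sets_mu sets_unit_borel)

abbreviation "\<nu> \<equiv> rng_pullback G \<mu>"

lemma nn_fibre_enumerated:
  fixes F :: "'g \<Rightarrow> ennreal"
  assumes bij: "\<And>x. bij_betw (\<lambda>n::nat. t n x) {n. x \<in> D n} {g. r g = x}"
  shows "(\<integral>\<^sup>+g. F g \<partial>count_space {g. r g = x}) = (\<integral>\<^sup>+n. indicator (D n) x * F (t n x) \<partial>count_space UNIV)"
proof -
  have "(\<integral>\<^sup>+g. F g \<partial>count_space {g. r g = x}) = (\<integral>\<^sup>+n. F (t n x) \<partial>count_space {n. x \<in> D n})"
    by (rule nn_integral_bij_count_space[OF bij, symmetric])
  also have "\<dots> = (\<integral>\<^sup>+n. F (t n x) * indicator {n. x \<in> D n} n \<partial>count_space UNIV)"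
    by (rule nn_integral_count_space_indicator) simp
  finally show ?thesis by (simp add: indicator_def mult.commute)
qed

text \<open>\<open>rng_pullback\<close> is given by a formula inside \<open>measure_of\<close>,
  which yields the zero measure unless the formula is countably additive. Exhibiting it as an image
  of the product of \<mu> with counting measure on the indices proves additivity and opens the way
  to Fubini's theorem.\<close>

lemma pullback_enumerated:
  obtains D :: "nat \<Rightarrow> 'g set" and t :: "nat \<Rightarrow> 'g \<Rightarrow> 'g" where
    "\<And>n. D n \<in> sets borel" "\<And>n. D n \<subseteq> units G" "\<And>n. t n \<in> borel_measurable borel"
    "\<And>x. bij_betw (\<lambda>n. t n x) {n. x \<in> D n} {g. r g = x}"
    "{(x, n). x \<in> D n} \<in> sets (\<mu> \<Otimes>\<^sub>M count_space UNIV)"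
    "(\<lambda>(x, n). t n x) \<in> borel_measurable (\<mu> \<Otimes>\<^sub>M count_space UNIV)"
    "\<nu> = distr (restrict_space (\<mu> \<Otimes>\<^sub>M count_space UNIV) {(x, n). x \<in> D n}) borel (\<lambda>(x, n). t n x)"
proof -
  obtain D :: "nat \<Rightarrow> 'g set" and t :: "nat \<Rightarrow> 'g \<Rightarrow> 'g" where
    D: "\<And>n. D n \<in> sets borel" "\<And>n. D n \<subseteq> units G" and t: "\<And>n. t n \<in> borel_measurable borel"
    and bij: "\<And>x. bij_betw (\<lambda>n. t n x) {n. x \<in> D n} {g. r g = x}"
    using fibre_enumeration by metis
  let ?P = "\<mu> \<Otimes>\<^sub>M count_space UNIV" let ?O = "{(x, n). x \<in> D n}"
  have O: "?O \<in> sets ?P"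
  proof -
    have "?O = (\<Union>n. D n \<times> {n})" by auto
    moreover have "D n \<times> {n} \<in> sets ?P" for n by (intro pair_measureI mu_setsI D) simp
    ultimately show ?thesis by simp
  qed
  have t': "(\<lambda>(x, n). t n x) \<in> borel_measurable ?P"
    unfolding case_prod_beta
    by (rule measurable_compose_countable'[where I = UNIV]) (auto intro: measurable_mu_if_borel[OF t] measurable_compose[OF measurable_fst])
  define N where "N = distr (restrict_space ?P ?O) borel (\<lambda>(x, n). t n x)"
  have "emeasure N A = (\<integral>\<^sup>+x. (\<integral>\<^sup>+g. indicator A g \<partial>count_space {g. r g = x}) \<partial>\<mu>)" if A: "A \<in> sets borel" for A
  proof -
    have "emeasure N A = (\<integral>\<^sup>+y. indicator A y \<partial>N)" using A by (simp add: N_def)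
    also have "\<dots> = (\<integral>\<^sup>+p. indicator A (case p of (x, n) \<Rightarrow> t n x) \<partial>restrict_space ?P ?O)"
      unfolding N_def using A measurable_restrict_space1[OF t'] by (intro nn_integral_distr) auto
    also have "\<dots> = (\<integral>\<^sup>+p. indicator A (case p of (x, n) \<Rightarrow> t n x) * indicator ?O p \<partial>?P)"
      using O by (subst nn_integral_restrict_space) (auto simp: sets.Int_space_eq2)
    also have "\<dots> = (\<integral>\<^sup>+x. \<integral>\<^sup>+n. indicator A (t n x) * indicator ?O (x, n) \<partial>count_space UNIV \<partial>\<mu>)"
      using A O t' measurable_compose[OF t', of "indicator A" "borel :: ennreal measure"]
      by (subst sigma_finite_measure.nn_integral_fst[OF sigma_finite_measure_count_space, symmetric]) (auto simp: case_prod_beta)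
    also have "\<dots> = (\<integral>\<^sup>+x. \<integral>\<^sup>+n. indicator (D n) x * indicator A (t n x) \<partial>count_space UNIV \<partial>\<mu>)"
      by (intro nn_integral_cong) (auto simp: indicator_def)
    finally show ?thesis by (simp add: nn_fibre_enumerated[OF bij])
  qed
  then have "\<nu> = measure_of UNIV (sets borel) (emeasure N)"
    unfolding rng_pullback_def using sets.sigma_sets_eq[of "borel :: 'g measure"] by (intro measure_of_eq) simp_all
  also have "\<dots> = N" using measure_of_of_measure[of N] by (simp add: N_def)
  finally show thesis using that[OF D t bij O t'] by (simp add: N_def)
qed

lemma space_nu [simp]: "space \<nu> = UNIV" and sets_nu [simp, measurable_cong]: "sets \<nu> = sets borel"
  by (rule pullback_enumerated, simp)+

lemma measurable_fibre_nn [measurable]: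
  assumes [measurable]: "F \<in> borel_measurable borel"
  shows "(\<lambda>x. \<integral>\<^sup>+g. F g \<partial>count_space {g. r g = x}) \<in> borel_measurable \<mu>"
proof -
  obtain D :: "nat \<Rightarrow> 'g set" and t :: "nat \<Rightarrow> 'g \<Rightarrow> 'g" where
    D: "\<And>n. D n \<in> sets borel" and t [measurable]: "\<And>n. t n \<in> borel_measurable borel"
    and bij: "\<And>x. bij_betw (\<lambda>n. t n x) {n. x \<in> D n} {g. r g = x}"
    using fibre_enumeration by metis
  note [measurable] = D
  show ?thesis unfolding nn_fibre_enumerated[OF bij] nn_integral_count_space_nat
    by (rule measurable_mu_if_borel) measurable
qed

lemma nn_integral_nu:
  assumes [measurable]: "F \<in> borel_measurable borel"
  shows "(\<integral>\<^sup>+g. F g \<partial>\<nu>) = (\<integral>\<^sup>+x. (\<integral>\<^sup>+g. F g \<partial>count_space {g. r g = x}) \<partial>\<mu>)"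
proof -
  obtain D :: "nat \<Rightarrow> 'g set" and t :: "nat \<Rightarrow> 'g \<Rightarrow> 'g" where
    bij: "\<And>x. bij_betw (\<lambda>n. t n x) {n. x \<in> D n} {g. r g = x}"
    and O: "{(x, n). x \<in> D n} \<in> sets (\<mu> \<Otimes>\<^sub>M count_space UNIV)"
    and t': "(\<lambda>(x, n). t n x) \<in> borel_measurable (\<mu> \<Otimes>\<^sub>M count_space UNIV)"
    and nu: "\<nu> = distr (restrict_space (\<mu> \<Otimes>\<^sub>M count_space UNIV) {(x, n). x \<in> D n}) borel (\<lambda>(x, n). t n x)"
    using pullback_enumerated by metis
  let ?P = "\<mu> \<Otimes>\<^sub>M count_space UNIV" let ?O = "{(x, n). x \<in> D n}"
  have "(\<integral>\<^sup>+g. F g \<partial>\<nu>) = (\<integral>\<^sup>+p. F (case p of (x, n) \<Rightarrow> t n x) \<partial>restrict_space ?P ?O)"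
    unfolding nu using measurable_restrict_space1[OF t'] by (intro nn_integral_distr) auto
  also have "\<dots> = (\<integral>\<^sup>+p. F (case p of (x, n) \<Rightarrow> t n x) * indicator ?O p \<partial>?P)"
    using O by (subst nn_integral_restrict_space) (auto simp: sets.Int_space_eq2)
  also have "\<dots> = (\<integral>\<^sup>+x. \<integral>\<^sup>+n. F (t n x) * indicator ?O (x, n) \<partial>count_space UNIV \<partial>\<mu>)"
    using O t' measurable_compose[OF t' assms]
    by (subst sigma_finite_measure.nn_integral_fst[OF sigma_finite_measure_count_space, symmetric]) (auto simp: case_prod_beta)
  also have "\<dots> = (\<integral>\<^sup>+x. \<integral>\<^sup>+n. indicator (D n) x * F (t n x) \<partial>count_space UNIV \<partial>\<mu>)"
    by (intro nn_integral_cong) (auto simp: indicator_def)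
  finally show ?thesis by (simp add: nn_fibre_enumerated[OF bij])
qed

text \<open>Meaningful only for functions with finitely many nonzero values on each fibre.\<close>

definition fibre_sum :: "('g \<Rightarrow> 'b::real_normed_vector) \<Rightarrow> 'g \<Rightarrow> 'b" where
  "fibre_sum F x = (\<Sum>g | r g = x \<and> F g \<noteq> 0. F g)"

lemma fibre_sum_enumerated:
  assumes bij: "\<And>x. bij_betw (\<lambda>n::nat. t n x) {n. x \<in> D n} {g. r g = x}"
    and fin: "finite {g. r g = x \<and> F g \<noteq> 0}"
  shows "finite {n. indicat_real (D n) x *\<^sub>R F (t n x) \<noteq> 0}"
    "(\<Sum>n | indicat_real (D n) x *\<^sub>R F (t n x) \<noteq> 0. indicat_real (D n) x *\<^sub>R F (t n x)) = fibre_sum F x"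
proof -
  let ?A = "{n. indicat_real (D n) x *\<^sub>R F (t n x) \<noteq> 0}"
  have A: "?A = {n \<in> {n. x \<in> D n}. F (t n x) \<noteq> 0}" by (auto simp: indicator_def)
  have b: "bij_betw (\<lambda>n. t n x) ?A {g. r g = x \<and> F g \<noteq> 0}"
  proof (rule bij_betwI')
    show "(t j x = t k x) = (j = k)" if "j \<in> ?A" "k \<in> ?A" for j k
      using that bij[of x] unfolding A bij_betw_def inj_on_def by blast
    show "t n x \<in> {g. r g = x \<and> F g \<noteq> 0}" if "n \<in> ?A" for n
      using that bij[of x] unfolding A bij_betw_def by blast
    show "\<exists>n\<in>?A. g = t n x" if "g \<in> {g. r g = x \<and> F g \<noteq> 0}" for g
    proof -
      have "g \<in> (\<lambda>n. t n x) ` {n. x \<in> D n}" using that bij_betw_imp_surj_on[OF bij[of x]] by simp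
      then show ?thesis using that unfolding A by auto
    qed
  qed
  show "finite ?A" using bij_betw_finite[OF b] fin by simp
  show "(\<Sum>n\<in>?A. indicat_real (D n) x *\<^sub>R F (t n x)) = fibre_sum F x"
    unfolding fibre_sum_def
    by (rule sum.reindex_bij_betw[OF b, THEN trans[rotated]]) (rule sum.cong, auto simp: indicator_def split: if_splits)
qed

lemma measurable_fibre_sum:
  fixes F :: "'g \<Rightarrow> 'b::{banach, second_countable_topology}"
  assumes F [measurable]: "F \<in> borel_measurable borel"
    and fin: "\<And>x. finite {g. r g = x \<and> F g \<noteq> 0}"
  shows "fibre_sum F \<in> borel_measurable \<mu>"
proof -
  obtain D :: "nat \<Rightarrow> 'g set" and t :: "nat \<Rightarrow> 'g \<Rightarrow> 'g" where
    D [measurable]: "\<And>n. D n \<in> sets borel" and t [measurable]: "\<And>n. t n \<in> borel_measurable borel"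
    and bij: "\<And>x. bij_betw (\<lambda>n. t n x) {n. x \<in> D n} {g. r g = x}"
    using fibre_enumeration by metis
  have "fibre_sum F = (\<lambda>x. \<Sum>n. indicat_real (D n) x *\<^sub>R F (t n x))"
  proof
    show "fibre_sum F x = (\<Sum>n. indicat_real (D n) x *\<^sub>R F (t n x))" for x
      unfolding fibre_sum_enumerated(2)[OF bij fin, symmetric]
      by (rule suminf_finite[symmetric, OF fibre_sum_enumerated(1)[OF bij fin]]) simp
  qed
  then show ?thesis by (simp add: measurable_mu_if_borel)
qed

lemma integral_nu:
  fixes F :: "'g \<Rightarrow> 'b::{banach, second_countable_topology}"
  assumes int: "integrable \<nu> F" and fin: "\<And>x. finite {g. r g = x \<and> F g \<noteq> 0}"
  shows "(\<integral>g. F g \<partial>\<nu>) = (\<integral>x. fibre_sum F x \<partial>\<mu>)"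
proof -
  obtain D :: "nat \<Rightarrow> 'g set" and t :: "nat \<Rightarrow> 'g \<Rightarrow> 'g" where
    bij: "\<And>x. bij_betw (\<lambda>n. t n x) {n. x \<in> D n} {g. r g = x}"
    and O: "{(x, n). x \<in> D n} \<in> sets (\<mu> \<Otimes>\<^sub>M count_space UNIV)"
    and t': "(\<lambda>(x, n). t n x) \<in> borel_measurable (\<mu> \<Otimes>\<^sub>M count_space UNIV)"
    and nu: "\<nu> = distr (restrict_space (\<mu> \<Otimes>\<^sub>M count_space UNIV) {(x, n). x \<in> D n}) borel (\<lambda>(x, n). t n x)"
    using pullback_enumerated by metis
  let ?P = "\<mu> \<Otimes>\<^sub>M count_space UNIV" let ?O = "{(x, n). x \<in> D n}"
  let ?f = "\<lambda>(x, n). indicat_real (D n) x *\<^sub>R F (t n x)"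
  have F: "F \<in> borel_measurable borel" using int by (simp cong: measurable_cong_sets)
  have tr: "(\<lambda>(x, n). t n x) \<in> measurable (restrict_space ?P ?O) borel"
    by (rule measurable_restrict_space1[OF t'])
  have O': "?O \<inter> space ?P \<in> sets ?P" using O by (simp add: sets.Int_space_eq2)
  have f_eq: "(\<lambda>p. indicat_real ?O p *\<^sub>R F (case p of (x, n) \<Rightarrow> t n x)) = ?f"
    by (auto simp: indicator_def fun_eq_iff)
  have "integrable (restrict_space ?P ?O) (\<lambda>p. F (case p of (x, n) \<Rightarrow> t n x))"
    using int unfolding nu by (simp add: integrable_distr_eq[OF tr F])
  then have int_f: "integrable ?P ?f"
    unfolding f_eq[symmetric] by (simp add: integrable_restrict_space[OF O'])
  have "(\<integral>g. F g \<partial>\<nu>) = (\<integral>p. F (case p of (x, n) \<Rightarrow> t n x) \<partial>restrict_space ?P ?O)"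
    unfolding nu by (rule integral_distr[OF tr F])
  also have "\<dots> = (\<integral>p. ?f p \<partial>?P)"
    unfolding f_eq[symmetric] by (rule integral_restrict_space[OF O'])
  also have "\<dots> = (\<integral>x. \<integral>n. ?f (x, n) \<partial>count_space UNIV \<partial>\<mu>)"
  proof -
    interpret P: pair_sigma_finite \<mu> "count_space UNIV :: nat measure"
      by (intro pair_sigma_finite.intro sigma_finite_measure_count_space sigma_finite_measure_axioms)
    show ?thesis using P.integral_fst'[OF int_f] by simp
  qed
  also have "\<dots> = (\<integral>x. fibre_sum F x \<partial>\<mu>)"
    using fibre_sum_enumerated[OF bij fin]
    by (intro Bochner_Integration.integral_cong refl) (simp add: lebesgue_integral_count_space_finite_support)
  finally show ?thesis .
qed

text \<open>Counting measure on a fibre has no nonempty null set, so a \<nu>-null set misses almost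
  every range fibre altogether. Statements about almost all arrows thereby become statements about
  all arrows over almost every unit.\<close>

lemma AE_nu_iff_fibres:
  "(AE g in \<nu>. P g) \<longleftrightarrow> (AE x in \<mu>. \<forall>g. r g = x \<longrightarrow> P g)"
proof
  assume "AE g in \<nu>. P g"
  then obtain N where N: "{g. \<not> P g} \<subseteq> N" "N \<in> sets borel" "emeasure \<nu> N = 0"
    by (auto elim!: AE_E)
  have "(\<integral>\<^sup>+x. (\<integral>\<^sup>+g. indicator N g \<partial>count_space {g. r g = x}) \<partial>\<mu>) = 0"
    using N nn_integral_nu[of "indicator N"] by simp
  then have "AE x in \<mu>. (\<integral>\<^sup>+g. indicator N g \<partial>count_space {g. r g = x}) = 0"
    using N(2) by (subst (asm) nn_integral_0_iff_AE) auto
  then show "AE x in \<mu>. \<forall>g. r g = x \<longrightarrow> P g"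
  proof eventually_elim
    fix x assume "(\<integral>\<^sup>+g. indicator N g \<partial>count_space {g. r g = x}) = (0::ennreal)"
    then have "AE g in count_space {g. r g = x}. indicator N g = (0::ennreal)"
      by (subst (asm) nn_integral_0_iff_AE) auto
    then show "\<forall>g. r g = x \<longrightarrow> P g" using N(1) by (auto simp: AE_count_space indicator_def split: if_splits)
  qed
next
  assume "AE x in \<mu>. \<forall>g. r g = x \<longrightarrow> P g"
  then obtain N where N: "{x \<in> units G. \<not> (\<forall>g. r g = x \<longrightarrow> P g)} \<subseteq> N" "N \<in> sets \<mu>" "emeasure \<mu> N = 0"
    by (auto elim!: AE_E)
  have Nb: "N \<in> sets borel" using N(2) by (rule mu_setsD)
  then have rN: "r -` N \<in> sets borel" using measurable_sets[OF rng_measurable Nb] by simp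
  have "AE x in \<mu>. x \<notin> N" using N by (intro AE_not_in) auto
  then have "(\<integral>\<^sup>+x. (\<integral>\<^sup>+g. indicator (r -` N) g \<partial>count_space {g. r g = x}) \<partial>\<mu>) = (\<integral>\<^sup>+x. 0 \<partial>\<mu>)"
    by (intro nn_integral_cong_AE) (auto elim!: eventually_mono simp: nn_integral_0_iff_AE AE_count_space indicator_def)
  then have "emeasure \<nu> (r -` N) = 0" using rN nn_integral_nu[of "indicator (r -` N)"] by simp
  moreover have "{g \<in> space \<nu>. \<not> P g} \<subseteq> r -` N" using N(1) ends_in_units by blast
  ultimately show "AE g in \<nu>. P g" using rN by (intro AE_I) simp_all
qed

lemma AE_rng: "AE x in \<mu>. P x \<Longrightarrow> AE g in \<nu>. P (r g)"
  unfolding AE_nu_iff_fibres by (auto elim!: eventually_mono)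

lemma emeasure_nu_compact: "compact K \<Longrightarrow> emeasure \<nu> K < \<infinity>"
proof -
  assume K: "compact K"
  then have Kb: "K \<in> sets borel" by (auto intro: compact_imp_closed borel_closed)
  obtain N where N: "\<And>x. finite {g \<in> K. r g = x}" "\<And>x. card {g \<in> K. r g = x} \<le> N"
    using compact_fibre_bound[OF K] by metis
  have "(\<integral>\<^sup>+g. indicator K g \<partial>count_space {g. r g = x}) \<le> ennreal N" for x
  proof -
    have "(\<integral>\<^sup>+g. indicator K g \<partial>count_space {g. r g = x}) = emeasure (count_space {g. r g = x}) (K \<inter> {g. r g = x})"
    proof -
      have "(\<integral>\<^sup>+g. indicator K g \<partial>count_space {g. r g = x}) = (\<integral>\<^sup>+g. indicator (K \<inter> {g. r g = x}) g \<partial>count_space {g. r g = x})"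
        by (intro nn_integral_cong) (auto simp: indicator_def)
      then show ?thesis by simp
    qed
    also have "\<dots> = of_nat (card {g \<in> K. r g = x})"
      using N(1)[of x] by (subst emeasure_count_space) (auto simp: Int_def conj_commute)
    also have "\<dots> \<le> ennreal N" using N(2)[of x] by (simp add: ennreal_of_nat_eq_real_of_nat)
    finally show ?thesis .
  qed
  then have "emeasure \<nu> K \<le> (\<integral>\<^sup>+x. ennreal N \<partial>\<mu>)"
    using nn_integral_nu[of "indicator K"] Kb nn_integral_mono[of \<mu> _ "\<lambda>_. ennreal N"] by simp
  also have "\<dots> < \<infinity>" by simp
  finally show ?thesis .
qed

end

section \<open>Inversion preserves the measure on the arrows\<close>

context invariant_space
begin

lemma compact_borel: "compact (K :: 'g set) \<Longrightarrow> K \<in> sets borel"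
  by (auto intro: compact_imp_closed borel_closed)

lemma compact_closure_subset:
  assumes "compact K" "B \<subseteq> (K :: 'g set)"
  shows "compact (closure B)"
proof -
  have "closure B \<subseteq> K" using assms by (intro closure_minimal compact_imp_closed)
  then have "K \<inter> closure B = closure B" by (rule Int_absorb1)
  then show ?thesis using compact_Int_closed[OF assms(1) closed_closure, of B] by (simp only:)
qed

lemma integrable_nu_bounded:
  fixes F :: "'g \<Rightarrow> 'b::{banach, second_countable_topology}"
  assumes "F \<in> borel_measurable borel" "compact K" "\<And>g. g \<in> K \<Longrightarrow> norm (F g) \<le> B" "\<And>g. g \<notin> K \<Longrightarrow> F g = 0"
  shows "integrable \<nu> F"
proof (rule integrableI_bounded_set[where A = K and B = B])
  show "K \<in> sets \<nu>" "F \<in> borel_measurable \<nu>" "emeasure \<nu> K < \<infinity>"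
    using assms compact_borel emeasure_nu_compact by (auto cong: measurable_cong_sets)
qed (use assms in auto)

lemma continuous_compact_support:
  fixes F :: "'g \<Rightarrow> 'b::{banach, second_countable_topology}"
  assumes cont: "continuous_on UNIV F" and supp: "compact (closure {g. F g \<noteq> 0})"
  shows "integrable \<nu> F" "finite {g. r g = x \<and> F g \<noteq> 0}" "F \<in> borel_measurable borel"
    "\<exists>B. \<forall>g. norm (F g) \<le> B"
proof -
  let ?K = "closure {g. F g \<noteq> 0}"
  have out: "F g = 0" if "g \<notin> ?K" for g using that closure_subset[of "{g. F g \<noteq> 0}"] by auto
  have "compact (F ` ?K)" by (rule compact_continuous_image[OF continuous_on_subset[OF cont] supp]) simp
  then obtain B where B: "\<And>g. g \<in> ?K \<Longrightarrow> norm (F g) \<le> B"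
    by (meson bounded_iff compact_imp_bounded image_eqI)
  show meas: "F \<in> borel_measurable borel" by (rule borel_measurable_continuous_onI[OF cont])
  show "integrable \<nu> F" by (rule integrable_nu_bounded[OF meas supp B out])
  have "norm (F g) \<le> max B 0" for g using B[of g] out[of g] by (cases "g \<in> ?K") auto
  then show "\<exists>B. \<forall>g. norm (F g) \<le> B" by blast
  obtain N :: nat where N: "\<And>x. finite {g \<in> ?K. r g = x}" using compact_fibre_bound[OF supp] by metis
  show "finite {g. r g = x \<and> F g \<noteq> 0}" by (rule finite_subset[OF _ N[of x]]) (use out in blast)
qed

lemma support_inv:
  fixes F :: "'g \<Rightarrow> 'b::real_normed_vector"
  assumes "continuous_on UNIV F" and supp: "compact (closure {g. F g \<noteq> 0})"
  shows "continuous_on UNIV (\<lambda>g. F (i g))" "compact (closure {g. F (i g) \<noteq> 0})"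
proof -
  show "continuous_on UNIV (\<lambda>g. F (i g))"
    using continuous_on_compose2[OF assms(1) inv_continuous] by simp
  have K: "compact (i ` closure {g. F g \<noteq> 0})"
    by (rule compact_continuous_image[OF continuous_on_subset[OF inv_continuous] supp]) simp
  have "{g. F (i g) \<noteq> 0} \<subseteq> i ` closure {g. F g \<noteq> 0}"
  proof
    fix g assume "g \<in> {g. F (i g) \<noteq> 0}"
    then have "i g \<in> closure {g. F g \<noteq> 0}" using closure_subset[of "{g. F g \<noteq> 0}"] by blast
    then show "g \<in> i ` closure {g. F g \<noteq> 0}" by (metis image_eqI inv_inv)
  qed
  then show "compact (closure {g. F (i g) \<noteq> 0})" by (rule compact_closure_subset[OF K])
qed

lemma infsum_fibre:
  fixes F :: "'g \<Rightarrow> 'b::real_normed_vector"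
  assumes "finite {g. r g = x \<and> F g \<noteq> 0}"
  shows "(\<Sum>\<^sub>\<infinity>g\<in>{g. r g = x}. F g) = fibre_sum F x"
proof -
  have "(\<Sum>\<^sub>\<infinity>g\<in>{g. r g = x}. F g) = (\<Sum>\<^sub>\<infinity>g\<in>{g. r g = x \<and> F g \<noteq> 0}. F g)"
    by (rule infsum_cong_neutral) auto
  then show ?thesis using assms by (simp add: fibre_sum_def)
qed

lemma infsum_src_fibre:
  "(\<Sum>\<^sub>\<infinity>g\<in>{g. s g = x}. F g) = (\<Sum>\<^sub>\<infinity>g\<in>{g. r g = x}. F (i g))"
proof -
  have "bij_betw i {g. r g = x} {g. s g = x}"
    by (rule bij_betw_byWitness[where f' = i]) auto
  then show ?thesis by (rule infsum_reindex_bij_betw[symmetric])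
qed

text \<open>Inversion exchanges source and range fibres, so the two sides of
  \<open>invariant_measure\<close> are the integrals against \<nu> of a function and of its
  composition with \<open>i\<close>.\<close>

lemma integral_inv_continuous:
  fixes \<phi> :: "'g \<Rightarrow> real"
  assumes c: "continuous_on UNIV \<phi>" and supp: "compact (closure {g. \<phi> g \<noteq> 0})"
  shows "(\<integral>g. \<phi> g \<partial>\<nu>) = (\<integral>g. \<phi> (i g) \<partial>\<nu>)"
proof -
  define f where "f g = complex_of_real (\<phi> g)" for g
  have f: "continuous_on UNIV f" "compact (closure {g. f g \<noteq> 0})"
    using supp by (auto simp: f_def intro!: continuous_intros c)
  then have "f \<in> Cc" by (simp add: Cc_def supp_def)
  note fi = support_inv[OF f]
  have "(\<integral>g. f g \<partial>\<nu>) = (\<integral>x. (\<Sum>\<^sub>\<infinity>g\<in>{g. r g = x}. f g) \<partial>\<mu>)"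
    unfolding infsum_fibre[OF continuous_compact_support(2)[OF f]]
    by (rule integral_nu[OF continuous_compact_support(1,2)[OF f]])
  also have "\<dots> = (\<integral>x. (\<Sum>\<^sub>\<infinity>g\<in>{g. s g = x}. f g) \<partial>\<mu>)"
    using invariant \<open>f \<in> Cc\<close> by (simp add: invariant_measure_def)
  also have "\<dots> = (\<integral>g. f (i g) \<partial>\<nu>)"
    unfolding infsum_src_fibre infsum_fibre[OF continuous_compact_support(2)[OF fi]]
    by (rule integral_nu[OF continuous_compact_support(1,2)[OF fi], symmetric])
  finally show ?thesis by (simp add: f_def)
qed

lemma nn_integral_inv_continuous:
  fixes \<phi> :: "'g \<Rightarrow> real"
  assumes c: "continuous_on UNIV \<phi>" and supp: "compact (closure {g. \<phi> g \<noteq> 0})" and "\<And>g. 0 \<le> \<phi> g"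
  shows "(\<integral>\<^sup>+g. ennreal (\<phi> g) \<partial>\<nu>) = (\<integral>\<^sup>+g. ennreal (\<phi> (i g)) \<partial>\<nu>)"
proof -
  have "(\<integral>\<^sup>+g. ennreal (\<phi> g) \<partial>\<nu>) = ennreal (\<integral>g. \<phi> g \<partial>\<nu>)"
    by (rule nn_integral_eq_integral[OF continuous_compact_support(1)[OF c supp]]) (simp add: assms(3))
  also have "\<dots> = ennreal (\<integral>g. \<phi> (i g) \<partial>\<nu>)" by (simp only: integral_inv_continuous[OF c supp])
  also have "\<dots> = (\<integral>\<^sup>+g. ennreal (\<phi> (i g)) \<partial>\<nu>)"
    by (rule nn_integral_eq_integral[symmetric, OF continuous_compact_support(1)[OF support_inv[OF c supp]]])
       (simp add: assms(3))
  finally show ?thesis .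
qed

text \<open>The sets \<open>{\<phi> > 0}\<close> for \<open>\<phi>\<close> in \<open>C\<^sub>c(G)\<close> form a generator closed under intersections, and
  \<open>min(1, n \<phi>)\<close> increases to the indicator function of such a set.\<close>

lemma nu_inv_invariant: "distr \<nu> borel i = \<nu>"
proof -
  define \<E> :: "'g set set" where "\<E> = {{g. 0 < \<phi> g} | \<phi>. continuous_on UNIV (\<phi> :: 'g \<Rightarrow> real) \<and>
     compact (closure {g. \<phi> g \<noteq> 0}) \<and> (\<forall>g. 0 \<le> \<phi> g)}"
  have open_E: "open A" if "A \<in> \<E>" for A
    using that by (auto simp: \<E>_def intro!: open_Collect_less continuous_intros)
  have basis: "\<exists>A\<in>\<E>. g \<in> A \<and> A \<subseteq> U" if "open U" "g \<in> U" for U g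
  proof -
    obtain \<phi> :: "'g \<Rightarrow> real" where \<phi>: "continuous_on UNIV \<phi>" "\<And>h. 0 \<le> \<phi> h" "\<phi> g = 1"
      "\<And>h. h \<notin> U \<Longrightarrow> \<phi> h = 0" "compact (closure {h. \<phi> h \<noteq> 0})"
      using bump[OF \<open>open U\<close> \<open>g \<in> U\<close>] by metis
    then show ?thesis by (intro bexI[of _ "{g. 0 < \<phi> g}"]) (force simp: \<E>_def)+
  qed
  have cover: "\<exists>\<F>. countable \<F> \<and> \<F> \<subseteq> \<E> \<and> \<Union>\<F> = U" if "open U" for U
  proof -
    have "\<Union>{A \<in> \<E>. A \<subseteq> U} = U" using basis[OF that] by blast
    moreover have "open A" if "A \<in> {A \<in> \<E>. A \<subseteq> U}" for A using that open_E by simp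
    then obtain \<F> where "\<F> \<subseteq> {A \<in> \<E>. A \<subseteq> U}" "countable \<F>" "\<Union>\<F> = \<Union>{A \<in> \<E>. A \<subseteq> U}"
      by (rule Lindelof)
    ultimately have "countable \<F>" "\<F> \<subseteq> \<E>" "\<Union>\<F> = U" by simp_all blast+
    then show ?thesis by (intro exI[of _ \<F>] conjI)
  qed
  have sigma: "sets (borel :: 'g measure) = sigma_sets UNIV \<E>"
  proof
    have "U \<in> sigma_sets UNIV \<E>" if "open U" for U
    proof -
      obtain \<F> where F: "countable \<F>" "\<F> \<subseteq> \<E>" "\<Union>\<F> = U" using cover[OF \<open>open U\<close>] by blast
      have "\<Union>\<F> \<in> sigma_sets UNIV \<E>"
        by (rule sigma_sets_UNION[OF F(1)]) (use F(2) in \<open>auto intro: sigma_sets.Basic\<close>)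
      then show ?thesis using F by simp
    qed
    then have "sigma_sets UNIV {U. open U} \<subseteq> sigma_sets UNIV \<E>" by (intro sigma_sets_mono) blast
    then show "sets borel \<subseteq> sigma_sets UNIV \<E>" by (simp add: borel_def)
    show "sigma_sets UNIV \<E> \<subseteq> sets borel"
    proof -
      have "\<E> \<subseteq> sets borel" using open_E by (simp add: subset_iff)
      from sets.sigma_sets_subset[OF this] show ?thesis by simp
    qed
  qed
  obtain \<F> where F: "countable \<F>" "\<F> \<subseteq> \<E>" "\<Union>\<F> = UNIV" using cover[of UNIV] by auto
  have "\<F> \<noteq> {}" using F(3) by auto
  then have rangeF: "range (from_nat_into \<F>) = \<F>" using F(1) by simp
  show ?thesis
  proof (rule measure_eqI_generator_eq[where E = \<E> and \<Omega> = UNIV and A = "from_nat_into \<F>", symmetric])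
    show "Int_stable \<E>"
    proof (rule Int_stableI)
      fix A B assume "A \<in> \<E>" "B \<in> \<E>"
      then obtain \<phi> \<psi> :: "'g \<Rightarrow> real" where
        A: "A = {g. 0 < \<phi> g}" "continuous_on UNIV \<phi>" "compact (closure {g. \<phi> g \<noteq> 0})" "\<forall>g. 0 \<le> \<phi> g" and
        B: "B = {g. 0 < \<psi> g}" "continuous_on UNIV \<psi>" "compact (closure {g. \<psi> g \<noteq> 0})" "\<forall>g. 0 \<le> \<psi> g"
        unfolding \<E>_def by blast
      have "{g. \<phi> g * \<psi> g \<noteq> 0} \<subseteq> closure {g. \<phi> g \<noteq> 0}"
        using closure_subset[of "{g. \<phi> g \<noteq> 0}"] by auto
      then have "compact (closure {g. \<phi> g * \<psi> g \<noteq> 0})" by (rule compact_closure_subset[OF A(3)])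
      moreover have "A \<inter> B = {g. 0 < \<phi> g * \<psi> g}"
      proof -
        have "(0 < \<phi> g * \<psi> g) = (0 < \<phi> g \<and> 0 < \<psi> g)" for g
          using spec[OF A(4), of g] spec[OF B(4), of g] by (auto simp: zero_less_mult_iff)
        then show ?thesis by (auto simp: A(1) B(1))
      qed
      moreover have "continuous_on UNIV (\<lambda>g. \<phi> g * \<psi> g)" by (intro continuous_intros A B)
      moreover have "\<forall>g. 0 \<le> \<phi> g * \<psi> g" using A(4) B(4) by simp
      ultimately show "A \<inter> B \<in> \<E>"
        by (simp only: \<E>_def mem_Collect_eq) (rule exI[of _ "\<lambda>g. \<phi> g * \<psi> g"], simp)
    qed
    show "\<And>X. X \<in> \<E> \<Longrightarrow> emeasure \<nu> X = emeasure (distr \<nu> borel i) X"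
    proof -
      fix X assume "X \<in> \<E>"
      then obtain \<phi> :: "'g \<Rightarrow> real" where
        X: "X = {g. 0 < \<phi> g}" "continuous_on UNIV \<phi>" "compact (closure {g. \<phi> g \<noteq> 0})" "\<forall>g. 0 \<le> \<phi> g"
        unfolding \<E>_def by blast
      define \<phi>' where "\<phi>' n g = min 1 (real n * \<phi> g)" for n g
      have c: "continuous_on UNIV (\<phi>' n)" for n unfolding \<phi>'_def by (intro continuous_intros X)
      have k: "compact (closure {g. \<phi>' n g \<noteq> 0})" for n
      proof -
        have "{g. \<phi>' n g \<noteq> 0} \<subseteq> closure {g. \<phi> g \<noteq> 0}"
          using closure_subset[of "{g. \<phi> g \<noteq> 0}"] by (auto simp: \<phi>'_def)
        then show ?thesis by (rule compact_closure_subset[OF X(3)])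
      qed
      have pos: "0 \<le> \<phi>' n g" for n g using X(4) by (simp add: \<phi>'_def)
      have inc: "incseq (\<lambda>n g. ennreal (\<phi>' n g))"
      proof -
        have "\<phi>' j g \<le> \<phi>' n g" if "j \<le> n" for j n g
          unfolding \<phi>'_def using that X(4) by (intro min.mono mult_right_mono) simp_all
        then show ?thesis by (auto simp: incseq_def le_fun_def intro: ennreal_leI)
      qed
      have sup: "(SUP n. ennreal (\<phi>' n g)) = indicator X g" for g
      proof (cases "g \<in> X")
        case True
        then obtain n where "1 \<le> real n * \<phi> g" using reals_Archimedean3[of "\<phi> g"] X(1) by (metis less_imp_le mem_Collect_eq)
        then have "\<phi>' n g = 1" by (simp add: \<phi>'_def)
        then have "1 \<le> (SUP n. ennreal (\<phi>' n g))" by (intro SUP_upper2[of n]) auto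
        moreover have "(SUP n. ennreal (\<phi>' n g)) \<le> 1" by (intro SUP_least) (simp add: \<phi>'_def)
        ultimately show ?thesis using True by simp
      next
        case False
        then have "\<phi> g = 0" using X(1,4) by (auto simp: not_less intro: antisym)
        then show ?thesis using False by (simp add: \<phi>'_def)
      qed
      have [measurable]: "\<phi>' n \<in> borel_measurable borel" for n by (rule borel_measurable_continuous_onI[OF c])
      have Xb: "X \<in> sets borel" using open_E[OF \<open>X \<in> \<E>\<close>] by simp
      have "emeasure \<nu> X = (\<integral>\<^sup>+g. (SUP n. ennreal (\<phi>' n g)) \<partial>\<nu>)" unfolding sup using Xb by simp
      also have "\<dots> = (SUP n. \<integral>\<^sup>+g. ennreal (\<phi>' n g) \<partial>\<nu>)"
        by (rule nn_integral_monotone_convergence_SUP[OF inc]) measurable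
      also have "\<dots> = (SUP n. \<integral>\<^sup>+g. ennreal (\<phi>' n (i g)) \<partial>\<nu>)"
        by (simp add: nn_integral_inv_continuous[OF c k pos])
      also have "\<dots> = (SUP n. \<integral>\<^sup>+g. ennreal (\<phi>' n g) \<partial>distr \<nu> borel i)"
        by (subst nn_integral_distr) (auto cong: measurable_cong_sets)
      also have "\<dots> = (\<integral>\<^sup>+g. (SUP n. ennreal (\<phi>' n g)) \<partial>distr \<nu> borel i)"
        by (rule nn_integral_monotone_convergence_SUP[OF inc, symmetric]) measurable
      finally show "emeasure \<nu> X = emeasure (distr \<nu> borel i) X" unfolding sup using Xb by simp
    qed
    \<comment> \<open>The measure \<nu> may be infinite, so uniqueness needs a countable cover by
      members of the generator that have finite measure; these lie in compact supports.\<close>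
    show "emeasure \<nu> (from_nat_into \<F> n) \<noteq> \<infinity>" for n
    proof -
      have "from_nat_into \<F> n \<in> \<E>" using rangeF F(2) by auto
      then obtain \<phi> :: "'g \<Rightarrow> real" where
        X: "from_nat_into \<F> n = {g. 0 < \<phi> g}" "compact (closure {g. \<phi> g \<noteq> 0})"
        unfolding \<E>_def by blast
      have "from_nat_into \<F> n \<subseteq> closure {g. \<phi> g \<noteq> 0}" unfolding X(1) using closure_subset by force
      then have "emeasure \<nu> (from_nat_into \<F> n) \<le> emeasure \<nu> (closure {g. \<phi> g \<noteq> 0})"
        using compact_borel[OF X(2)] by (intro emeasure_mono) simp_all
      then show ?thesis using emeasure_nu_compact[OF X(2)] by auto
    qed
  qed (use sigma rangeF F in auto)
qed

lemma inv_measurable_nu: "i \<in> measurable \<nu> borel"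
  by (simp cong: measurable_cong_sets)

lemma nn_integral_nu_inv:
  assumes "F \<in> borel_measurable borel"
  shows "(\<integral>\<^sup>+g. F (i g) \<partial>\<nu>) = (\<integral>\<^sup>+g. F g \<partial>\<nu>)"
proof -
  have "F \<in> borel_measurable (distr \<nu> borel i)" using assms by (simp cong: measurable_cong_sets)
  from nn_integral_distr[OF inv_measurable_nu this] show ?thesis unfolding nu_inv_invariant by (rule sym)
qed

lemma integral_nu_inv:
  fixes F :: "'g \<Rightarrow> 'b::{banach, second_countable_topology}"
  assumes "F \<in> borel_measurable borel"
  shows "(\<integral>g. F (i g) \<partial>\<nu>) = (\<integral>g. F g \<partial>\<nu>)"
  using integral_distr[OF inv_measurable_nu assms] unfolding nu_inv_invariant by (rule sym)

text \<open>For \<open>r\<close> in place of \<open>s\<close> this holds by construction of \<nu>;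
  inversion transfers it. Changing a section on a null set therefore changes its values at the
  sources of almost no arrows.\<close>

lemma AE_src:
  assumes "AE x in \<mu>. P x"
  shows "AE g in \<nu>. P (s g)"
proof -
  have "AE g in distr \<nu> borel i. P (r g)" unfolding nu_inv_invariant by (rule AE_rng[OF assms])
  then have "AE g in \<nu>. P (r (i g))" by (rule AE_distrD[OF inv_measurable_nu])
  then show ?thesis by simp
qed

end

section \<open>Encoding functions modulo null sets\<close>

lemma measurable_norm_ell2:
  assumes [measurable]: "\<And>n. (\<lambda>x. coord (F x) n) \<in> borel_measurable M"
  shows "(\<lambda>x. norm (F x)) \<in> borel_measurable M"
proof -
  have "(norm (F x))\<^sup>2 = (\<Sum>n. (cmod (coord (F x) n))\<^sup>2)" for x
    using norm_sq_sums[of "F x"] by (simp add: sums_iff)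
  then have "norm (F x) = sqrt (\<Sum>n. (cmod (coord (F x) n))\<^sup>2)" for x
    by (metis norm_ge_zero real_sqrt_abs abs_of_nonneg)
  then show ?thesis by simp
qed

lemma measurable_cnj [measurable]: "cnj \<in> borel_measurable borel"
  by (intro borel_measurable_continuous_onI continuous_intros)

lemma measurable_cinner:
  assumes [measurable]: "\<And>n. (\<lambda>x. coord (F x) n) \<in> borel_measurable M"
    "\<And>n. (\<lambda>x. coord (F' x) n) \<in> borel_measurable M"
  shows "(\<lambda>x. cinner (F x) (F' x)) \<in> borel_measurable M"
  unfolding cinner_def by measurable

text \<open>Finite intersections of a countable base; the empty intersection supplies
  \<open>UNIV\<close>, so finite measures that agree on the generator also have equal total
  mass.\<close>

lemma countable_Int_stable_generator:
  obtains B :: "nat \<Rightarrow> 'g::second_countable_topology set" where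
    "Int_stable (range B)" "sets borel = sigma_sets UNIV (range B)" "UNIV \<in> range B"
proof -
  obtain \<B> :: "'g set set" where \<B>: "countable \<B>" "topological_basis \<B>" using ex_countable_basis by blast
  define \<J> where "\<J> = {\<Inter>F | F. finite F \<and> F \<subseteq> \<B>}"
  have "\<J> = Inter ` {F. finite F \<and> F \<subseteq> \<B>}" by (auto simp: \<J>_def)
  then have c: "countable \<J>" using countable_Collect_finite_subset[OF \<B>(1)] by simp
  have ne: "\<J> \<noteq> {}" by (auto simp: \<J>_def intro: exI[of _ "{}"])
  have "range (from_nat_into \<J>) = \<J>" using c ne by simp
  moreover have "Int_stable \<J>"
  proof (rule Int_stableI)
    fix a b assume "a \<in> \<J>" "b \<in> \<J>"
    then obtain F F' where "a = \<Inter>F" "finite F" "F \<subseteq> \<B>" "b = \<Inter>F'" "finite F'" "F' \<subseteq> \<B>" by (auto simp: \<J>_def)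
    then have "a \<inter> b = \<Inter>(F \<union> F')" "finite (F \<union> F')" "F \<union> F' \<subseteq> \<B>" by auto
    then show "a \<inter> b \<in> \<J>" unfolding \<J>_def by blast
  qed
  moreover have "sets borel = sigma_sets UNIV \<J>"
  proof
    have "\<B> \<subseteq> \<J>"
    proof
      fix b assume "b \<in> \<B>"
      then show "b \<in> \<J>" unfolding \<J>_def by (intro CollectI exI[of _ "{b}"]) simp
    qed
    have "sets borel = sets (sigma UNIV \<B>)" by (simp only: borel_eq_countable_basis[OF \<B>])
    then have "sets borel = sigma_sets UNIV \<B>" by simp
    then show "sets borel \<subseteq> sigma_sets UNIV \<J>" using sigma_sets_mono'[OF \<open>\<B> \<subseteq> \<J>\<close>] by simp
    have "\<J> \<subseteq> sets borel"
    proof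
      fix a assume "a \<in> \<J>"
      then obtain F where F: "a = \<Inter>F" "finite F" "F \<subseteq> \<B>" by (auto simp: \<J>_def)
      have "open a" unfolding F(1) using F(2,3) topological_basis_open[OF \<B>(2)] by (intro open_Inter) auto
      then show "a \<in> sets borel" by simp
    qed
    then show "sigma_sets UNIV \<J> \<subseteq> sets borel" using sets.sigma_sets_subset[of \<J> borel] by simp
  qed
  moreover have "UNIV \<in> \<J>" unfolding \<J>_def by (intro CollectI exI[of _ "{}"]) simp
  ultimately show thesis using that[of "from_nat_into \<J>"] by (simp only:)
qed

context invariant_space
begin

lemma mu_Int:
  assumes "A \<in> sets \<mu>" "X \<in> sets borel"
  shows "A \<inter> X \<in> sets \<mu>"
  using mu_setsD[OF assms(1)] assms(2) by (intro mu_setsI) auto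

text \<open>A function is determined almost everywhere by the measures of the intersections of its
  superlevel sets with a countable generator, which makes for an encoding by a real number.\<close>

lemma AE_class_code:
  "\<exists>c :: ('g \<Rightarrow> ell2) \<Rightarrow> 'i \<Rightarrow> complex. \<forall>F F'.
     (\<forall>n. (\<lambda>x. coord (F x) n) \<in> borel_measurable \<mu>) \<longrightarrow> (\<forall>n. (\<lambda>x. coord (F' x) n) \<in> borel_measurable \<mu>) \<longrightarrow>
     (c F = c F' \<longleftrightarrow> (AE x in \<mu>. F x = F' x))"
proof -
  obtain B :: "nat \<Rightarrow> 'g set" where
    B: "Int_stable (range B)" "sets borel = sigma_sets UNIV (range B)" "UNIV \<in> range B"
    using countable_Int_stable_generator by metis
  have Bb: "B j \<in> sets borel" for j unfolding B(2) by auto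
  define part where "part b z = (if b then Re z else Im z)" for b z
  define S where "S F = (\<lambda>(n, b, q). {x \<in> units G. real_of_rat q < part b (coord (F x) n)})" for F :: "'g \<Rightarrow> ell2"
  \<comment> \<open>The rationals below a measure determine it, so this subset of a countable set
    records the measures of all the intersections.\<close>
  define C where "C F = {k :: (nat \<times> bool \<times> rat) \<times> nat \<times> rat. real_of_rat (snd (snd k)) < measure \<mu> (S F (fst k) \<inter> B (fst (snd k)))}" for F
  define d where "d F = to_nat ` C F" for F
  obtain e :: "nat set \<Rightarrow> real" where e: "inj e"
    using nat_sets_lepoll_reals01 unfolding lepoll_def by (auto simp: inj_on_def)
  \<comment> \<open>Subsets of the naturals inject into the reals, and a constant function carries
    the real into \<open>'i \<Rightarrow> complex\<close> whatever \<open>'i\<close> is.\<close>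
  define c :: "('g \<Rightarrow> ell2) \<Rightarrow> 'i \<Rightarrow> complex" where "c F = (\<lambda>_. complex_of_real (e (d F)))" for F
  have c_eq: "c F = c F' \<longleftrightarrow> C F = C F'" for F F'
    using e by (auto simp: c_def d_def fun_eq_iff inj_eq inj_image_eq_iff)
  have meas_S: "S F k \<in> sets \<mu>" if F: "\<And>n. (\<lambda>x. coord (F x) n) \<in> borel_measurable \<mu>" for F k
  proof -
    obtain n b q where k: "k = (n, b, q)" by (cases k) auto
    have "(\<lambda>x. part b (coord (F x) n)) \<in> borel_measurable \<mu>"
      using measurable_compose[OF F[of n] borel_measurable_Re] measurable_compose[OF F[of n] borel_measurable_Im]
      by (cases b) (simp_all add: part_def)
    from borel_measurable_less[OF borel_measurable_const this] show ?thesis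
      unfolding k S_def by simp
  qed
  have C_eq: "C F = C F' \<longleftrightarrow> (AE x in \<mu>. F x = F' x)"
    if F: "\<And>n. (\<lambda>x. coord (F x) n) \<in> borel_measurable \<mu>" and F': "\<And>n. (\<lambda>x. coord (F' x) n) \<in> borel_measurable \<mu>"
    for F F'
  proof
    assume AE: "AE x in \<mu>. F x = F' x"
    have "measure \<mu> (S F k \<inter> B j) = measure \<mu> (S F' k \<inter> B j)" for k j
    proof (rule measure_eq_AE)
      show "AE x in \<mu>. (x \<in> S F k \<inter> B j) = (x \<in> S F' k \<inter> B j)"
        using AE by eventually_elim (simp add: S_def split: prod.splits)
      show "S F k \<inter> B j \<in> sets \<mu>" "S F' k \<inter> B j \<in> sets \<mu>"
        by (intro mu_Int meas_S F F' Bb)+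
    qed
    then show "C F = C F'" by (simp add: C_def)
  next
    assume CC: "C F = C F'"
    have eq: "measure \<mu> (S F k \<inter> B j) = measure \<mu> (S F' k \<inter> B j)" for k j
    proof (rule ccontr)
      assume "measure \<mu> (S F k \<inter> B j) \<noteq> measure \<mu> (S F' k \<inter> B j)"
      then have "\<exists>q. (real_of_rat q < measure \<mu> (S F k \<inter> B j)) \<noteq> (real_of_rat q < measure \<mu> (S F' k \<inter> B j))"
        by (metis linorder_neqE_linordered_idom not_less_iff_gr_or_eq of_rat_dense)
      then obtain q where "((k, j, q) \<in> C F) \<noteq> ((k, j, q) \<in> C F')" by (auto simp: C_def)
      then show False using CC by simp
    qed
    have AE_S: "AE x in \<mu>. x \<in> S F k \<longleftrightarrow> x \<in> S F' k" for k
    proof -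
      \<comment> \<open>The restriction of \<mu> to \<open>A\<close>, transported to the Borel sets
        of the whole type, where the generator lives; two such measures that agree on the generator
        are equal.\<close>
      define N where "N A = distr (density \<mu> (indicator A)) borel (\<lambda>x. x)" for A
      have id_meas: "(\<lambda>x. x) \<in> measurable (density \<mu> f) borel" for f
        using measurable_mu_if_borel[OF measurable_ident] by (simp add: id_def)
      have N: "emeasure (N A) X = emeasure \<mu> (A \<inter> X)" if A: "A \<in> sets \<mu>" and X: "X \<in> sets borel" for A X
      proof -
        have "X \<inter> units G \<in> sets \<mu>" using X by (intro mu_setsI) auto
        then have "emeasure (N A) X = (\<integral>\<^sup>+x. indicator A x * indicator (X \<inter> units G) x \<partial>\<mu>)"
          unfolding N_def using X A id_meas by (subst emeasure_distr) (auto simp: emeasure_density)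
        also have "\<dots> = (\<integral>\<^sup>+x. indicator (A \<inter> X) x \<partial>\<mu>)"
          by (intro nn_integral_cong) (auto simp: indicator_def)
        also have "\<dots> = emeasure \<mu> (A \<inter> X)"
          by (intro nn_integral_indicator mu_Int A X)
        finally show ?thesis .
      qed
      define A where "A = S F k"
      define A' where "A' = S F' k"
      have AA: "A \<in> sets \<mu>" "A' \<in> sets \<mu>" using meas_S F F' by (auto simp: A_def A'_def)
      have "N A = N A'"
      proof (rule measure_eqI_generator_eq[where E = "range B" and \<Omega> = UNIV and A = "\<lambda>_. UNIV"])
        show "Int_stable (range B)" by (rule B)
        show "emeasure (N A) X = emeasure (N A') X" if "X \<in> range B" for X
        proof -
          obtain j where X: "X = B j" using \<open>X \<in> range B\<close> by blast
          show ?thesis unfolding X N[OF AA(1) Bb] N[OF AA(2) Bb] emeasure_eq_measure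
            using eq[of k j] by (simp add: A_def A'_def)
        qed
        show "range (\<lambda>_::nat. UNIV) \<subseteq> range B" using B(3) by auto
        show "sets (N A) = sigma_sets UNIV (range B)" "sets (N A') = sigma_sets UNIV (range B)"
          unfolding B(2)[symmetric] by (simp_all add: N_def)
        show "emeasure (N A) UNIV \<noteq> \<infinity>" using N[OF AA(1), of UNIV] by simp
      qed auto
      then have NN: "emeasure \<mu> (A \<inter> X) = emeasure \<mu> (A' \<inter> X)" if "X \<in> sets borel" for X
        using N[OF AA(1) that] N[OF AA(2) that] by simp
      \<comment> \<open>Testing the equality of the two measures on both differences shows that
        \<open>A\<close> and \<open>A'\<close> agree up to a null set.\<close>
      have b: "A - A' \<in> sets borel" "A' - A \<in> sets borel" using mu_setsD(1)[OF AA(1)] mu_setsD(1)[OF AA(2)] by auto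
      have "A \<inter> (A - A') = A - A'" "A' \<inter> (A - A') = {}" "A \<inter> (A' - A) = {}" "A' \<inter> (A' - A) = A' - A" by auto
      then have "emeasure \<mu> (A - A') = 0" "emeasure \<mu> (A' - A) = 0"
        using NN[OF b(1)] NN[OF b(2)] by simp_all
      then have "A - A' \<in> null_sets \<mu>" "A' - A \<in> null_sets \<mu>" using AA by (auto intro!: null_setsI)
      then have "AE x in \<mu>. x \<notin> A - A'" "AE x in \<mu>. x \<notin> A' - A" by (auto dest: AE_not_in)
      then show ?thesis unfolding A_def A'_def by eventually_elim blast
    qed
    have "AE x in \<mu>. \<forall>k. x \<in> S F k \<longleftrightarrow> x \<in> S F' k" using AE_S by (subst AE_all_countable) blast
    moreover have "AE x in \<mu>. x \<in> units G" using AE_space[of \<mu>] by simp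
    ultimately show "AE x in \<mu>. F x = F' x"
    proof eventually_elim
      case (elim x)
      have p: "part b (coord (F x) n) = part b (coord (F' x) n)" for b n
      proof (rule ccontr)
        assume "part b (coord (F x) n) \<noteq> part b (coord (F' x) n)"
        then obtain q where "(real_of_rat q < part b (coord (F x) n)) \<noteq> (real_of_rat q < part b (coord (F' x) n))"
          by (metis linorder_neqE_linordered_idom not_less_iff_gr_or_eq of_rat_dense)
        then show False using elim(1)[rule_format, of "(n, b, q)"] elim(2) by (simp add: S_def)
      qed
      show ?case using p[of True] p[of False] by (intro ell2_eqI) (simp add: part_def complex_eq_iff)
    qed
  qed
  show ?thesis by (intro exI[of _ c] allI impI) (simp add: c_eq C_eq)
qed

end

section \<open>Square-integrable sections\<close>

text \<open>\<open>K x\<close> stands for the fibre over \<open>x\<close> and \<open>U g\<close> for the unitary from \<open>K (s g)\<close> to \<open>K (r g)\<close>;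
  nothing is assumed about \<open>U g\<close> off \<open>K (s g)\<close>.\<close>

locale ell2_representation = invariant_space G \<mu>
  for G :: "'g::{second_countable_topology, t2_space} groupoid" and \<mu> :: "'g measure" +
  fixes K :: "'g \<Rightarrow> ell2 set" and U :: "'g \<Rightarrow> ell2 \<Rightarrow> ell2"
  assumes K_zero: "x \<in> units G \<Longrightarrow> 0 \<in> K x"
    and K_add: "\<lbrakk>x \<in> units G; v \<in> K x; w \<in> K x\<rbrakk> \<Longrightarrow> v + w \<in> K x"
    and K_scale: "\<lbrakk>x \<in> units G; v \<in> K x\<rbrakk> \<Longrightarrow> cscale a v \<in> K x"
    and K_closed: "\<lbrakk>x \<in> units G; \<And>n. X n \<in> K x; X \<longlonglongrightarrow> v\<rbrakk> \<Longrightarrow> v \<in> K x"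
    and U_closed: "v \<in> K (src G g) \<Longrightarrow> U g v \<in> K (rng G g)"
    and U_add: "\<lbrakk>v \<in> K (src G g); w \<in> K (src G g)\<rbrakk> \<Longrightarrow> U g (v + w) = U g v + U g w"
    and U_scale: "v \<in> K (src G g) \<Longrightarrow> U g (cscale a v) = cscale a (U g v)"
    and U_inner: "\<lbrakk>v \<in> K (src G g); w \<in> K (src G g)\<rbrakk> \<Longrightarrow> cinner (U g v) (U g w) = cinner v w"
    and U_mult: "\<lbrakk>src G g = rng G h; v \<in> K (src G h)\<rbrakk> \<Longrightarrow> U (gmult G g h) v = U g (U h v)"
    and U_unit: "\<lbrakk>x \<in> units G; v \<in> K x\<rbrakk> \<Longrightarrow> U x v = v"
    and U_measurable: "\<lbrakk>\<And>x. x \<in> units G \<Longrightarrow> F x \<in> K x; \<And>n. (\<lambda>x. coord (F x) n) \<in> borel_measurable \<mu>\<rbrakk> \<Longrightarrow>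
      (\<lambda>g. coord (U g (F (src G g))) n) \<in> borel_measurable borel"
begin

lemma K_minus: "\<lbrakk>x \<in> units G; v \<in> K x\<rbrakk> \<Longrightarrow> - v \<in> K x"
  using K_scale[of x v "-1"] scaleR_eq_cscale[of "-1" v] by simp

lemma K_diff: "\<lbrakk>x \<in> units G; v \<in> K x; w \<in> K x\<rbrakk> \<Longrightarrow> v - w \<in> K x"
  using K_add[of x v "- w"] K_minus[of x w] by simp

lemma K_sum: "x \<in> units G \<Longrightarrow> (\<And>a. a \<in> A \<Longrightarrow> f a \<in> K x) \<Longrightarrow> sum f A \<in> K x"
  by (induction A rule: infinite_finite_induct) (auto intro: K_zero K_add)

lemma U_zero: "U g 0 = 0"
  using U_scale[of 0 g 0] K_zero[of "s g"] by (simp add: cscale_algebra)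

lemma U_sum: "(\<And>a. a \<in> A \<Longrightarrow> f a \<in> K (s g)) \<Longrightarrow> U g (sum f A) = (\<Sum>a\<in>A. U g (f a))"
  by (induction A rule: infinite_finite_induct) (auto simp: U_zero U_add K_sum)

lemma U_norm: "v \<in> K (s g) \<Longrightarrow> norm (U g v) = norm v"
  using U_inner[of v g v] by (metis Re_cinner_self norm_ge_zero power2_eq_iff_nonneg)

lemma U_inv: "v \<in> K (s g) \<Longrightarrow> U (i g) (U g v) = v"
  using U_mult[of "i g" g v] U_unit[of "s g" v] by simp

definition sec :: "('g \<Rightarrow> ell2) set" where
  "sec = {F. (\<forall>x\<in>units G. F x \<in> K x) \<and> (\<forall>n. (\<lambda>x. coord (F x) n) \<in> borel_measurable \<mu>)}"

lemma secD: "F \<in> sec \<Longrightarrow> x \<in> units G \<Longrightarrow> F x \<in> K x"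
  "F \<in> sec \<Longrightarrow> (\<lambda>x. coord (F x) n) \<in> borel_measurable \<mu>"
  by (auto simp: sec_def)

lemma sec_zero: "(\<lambda>_. 0) \<in> sec"
  by (auto simp: sec_def K_zero)

lemma sec_add: "F \<in> sec \<Longrightarrow> F' \<in> sec \<Longrightarrow> (\<lambda>x. F x + F' x) \<in> sec"
  by (auto simp: sec_def K_add intro!: borel_measurable_add)

lemma sec_diff: "F \<in> sec \<Longrightarrow> F' \<in> sec \<Longrightarrow> (\<lambda>x. F x - F' x) \<in> sec"
  by (auto simp: sec_def K_diff intro!: borel_measurable_diff)

lemma sec_scale: "F \<in> sec \<Longrightarrow> a \<in> borel_measurable \<mu> \<Longrightarrow> (\<lambda>x. cscale (a x) (F x)) \<in> sec"
  by (auto simp: sec_def K_scale intro!: borel_measurable_times)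

lemma sec_norm: "F \<in> sec \<Longrightarrow> (\<lambda>x. norm (F x)) \<in> borel_measurable \<mu>"
  by (rule measurable_norm_ell2) (rule secD)

lemma sec_cinner: "F \<in> sec \<Longrightarrow> F' \<in> sec \<Longrightarrow> (\<lambda>x. cinner (F x) (F' x)) \<in> borel_measurable \<mu>"
  by (rule measurable_cinner) (rule secD, assumption)+

lemma sec_U: "F \<in> sec \<Longrightarrow> (\<lambda>g. coord (U g (F (s g))) n) \<in> borel_measurable borel"
  by (rule U_measurable) (auto simp: secD)

lemma sec_ends: "F \<in> sec \<Longrightarrow> (\<lambda>g. coord (F (s g)) n) \<in> borel_measurable borel"
  "F \<in> sec \<Longrightarrow> (\<lambda>g. coord (F (r g)) n) \<in> borel_measurable borel"
  using measurable_compose[OF ends_measurable_mu(1) secD(2)] measurable_compose[OF ends_measurable_mu(2) secD(2)] by auto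

definition L2 :: "('g \<Rightarrow> ell2) set" where
  "L2 = {F \<in> sec. integrable \<mu> (\<lambda>x. (norm (F x))\<^sup>2)}"

lemma L2D: "F \<in> L2 \<Longrightarrow> F \<in> sec" "F \<in> L2 \<Longrightarrow> integrable \<mu> (\<lambda>x. (norm (F x))\<^sup>2)"
  by (auto simp: L2_def)

lemma L2I_nn:
  assumes "F \<in> sec" "(\<integral>\<^sup>+x. ennreal ((norm (F x))\<^sup>2) \<partial>\<mu>) < \<infinity>"
  shows "F \<in> L2"
  unfolding L2_def using assms sec_norm[OF assms(1)] by (auto intro!: integrableI_bounded)

lemma L2_nn: "F \<in> L2 \<Longrightarrow> (\<integral>\<^sup>+x. ennreal ((norm (F x))\<^sup>2) \<partial>\<mu>) = ennreal (\<integral>x. (norm (F x))\<^sup>2 \<partial>\<mu>)"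
  by (rule nn_integral_eq_integral) (auto dest: L2D)

lemma L2_dominated:
  assumes "F \<in> sec" "integrable \<mu> h" "\<And>x. (norm (F x))\<^sup>2 \<le> h x"
  shows "F \<in> L2"
proof -
  have "integrable \<mu> (\<lambda>x. (norm (F x))\<^sup>2)"
  proof (rule Bochner_Integration.integrable_bound[OF assms(2)])
    show "(\<lambda>x. (norm (F x))\<^sup>2) \<in> borel_measurable \<mu>" using sec_norm[OF assms(1)] by simp
    show "AE x in \<mu>. norm ((norm (F x))\<^sup>2) \<le> norm (h x)"
    proof (rule AE_I2)
      fix x show "norm ((norm (F x))\<^sup>2) \<le> norm (h x)" using assms(3)[of x] zero_le_power2[of "norm (F x)"] by simp
    qed
  qed
  then show ?thesis using assms(1) by (simp add: L2_def)
qed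

lemma L2_integrable_sum:
  assumes "F \<in> L2" "F' \<in> L2"
  shows "integrable \<mu> (\<lambda>x. 2 * (norm (F x))\<^sup>2 + 2 * (norm (F' x))\<^sup>2)"
  using L2D(2)[OF assms(1)] L2D(2)[OF assms(2)] by simp

lemma L2_zero: "(\<lambda>_. 0) \<in> L2"
  by (simp add: L2_def sec_zero)

lemma L2_add: "F \<in> L2 \<Longrightarrow> F' \<in> L2 \<Longrightarrow> (\<lambda>x. F x + F' x) \<in> L2"
  by (rule L2_dominated[where h = "\<lambda>x. 2 * (norm (F x))\<^sup>2 + 2 * (norm (F' x))\<^sup>2"])
     (auto intro: sec_add norm_add_sq_le L2_integrable_sum dest: L2D)

lemma L2_diff: "F \<in> L2 \<Longrightarrow> F' \<in> L2 \<Longrightarrow> (\<lambda>x. F x - F' x) \<in> L2"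
  by (rule L2_dominated[where h = "\<lambda>x. 2 * (norm (F x))\<^sup>2 + 2 * (norm (F' x))\<^sup>2"])
     (auto intro: sec_diff norm_diff_sq_le L2_integrable_sum dest: L2D)

lemma L2_scale_bounded:
  assumes "F \<in> L2" "a \<in> borel_measurable \<mu>" "\<And>x. cmod (a x) \<le> C"
  shows "(\<lambda>x. cscale (a x) (F x)) \<in> L2"
proof (rule L2_dominated[where h = "\<lambda>x. C\<^sup>2 * (norm (F x))\<^sup>2"])
  show "(norm (cscale (a x) (F x)))\<^sup>2 \<le> C\<^sup>2 * (norm (F x))\<^sup>2" for x
    using assms(3)[of x] by (auto simp: power_mult_distrib intro!: mult_right_mono power_mono)
qed (use assms in \<open>auto intro: sec_scale dest: L2D\<close>)

lemma L2_scale: "F \<in> L2 \<Longrightarrow> (\<lambda>x. cscale a (F x)) \<in> L2"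
  using L2_scale_bounded[of F "\<lambda>_. a" "cmod a"] by simp

lemma L2_cinner: "F \<in> L2 \<Longrightarrow> F' \<in> L2 \<Longrightarrow> integrable \<mu> (\<lambda>x. cinner (F x) (F' x))"
proof (rule Bochner_Integration.integrable_bound[where f = "\<lambda>x. (norm (F x))\<^sup>2 + (norm (F' x))\<^sup>2"])
  assume F: "F \<in> L2" "F' \<in> L2"
  show "integrable \<mu> (\<lambda>x. (norm (F x))\<^sup>2 + (norm (F' x))\<^sup>2)" using F by (auto dest: L2D)
  show "(\<lambda>x. cinner (F x) (F' x)) \<in> borel_measurable \<mu>" using F by (auto intro: sec_cinner dest: L2D)
  show "AE x in \<mu>. norm (cinner (F x) (F' x)) \<le> norm ((norm (F x))\<^sup>2 + (norm (F' x))\<^sup>2)"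
  proof (rule AE_I2)
    fix x
    have "norm (cinner (F x) (F' x)) \<le> norm (F x) * norm (F' x)" by (rule cinner_bound)
    also have "\<dots> \<le> (norm (F x))\<^sup>2 + (norm (F' x))\<^sup>2"
    proof -
      have "0 \<le> norm (F x) * norm (F' x)" by simp
      then show ?thesis using sum_squares_bound[of "norm (F x)" "norm (F' x)"] by linarith
    qed
    finally show "norm (cinner (F x) (F' x)) \<le> norm ((norm (F x))\<^sup>2 + (norm (F' x))\<^sup>2)" by simp
  qed
qed

text \<open>Riesz-Fischer: a rapidly Cauchy subsequence converges almost everywhere, and Fatou's
  lemma carries the Cauchy estimate over to the limit.\<close>

lemma L2_complete:
  fixes X :: "nat \<Rightarrow> 'g \<Rightarrow> ell2"
  assumes X: "\<And>n. X n \<in> L2"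
    and Cauchy: "\<And>e. e > 0 \<Longrightarrow> \<exists>N. \<forall>m\<ge>N. \<forall>n\<ge>N. (\<integral>\<^sup>+x. ennreal ((norm (X m x - X n x))\<^sup>2) \<partial>\<mu>) \<le> ennreal e"
  shows "\<exists>L\<in>L2. \<forall>e>0. \<exists>N. \<forall>n\<ge>N. (\<integral>\<^sup>+x. ennreal ((norm (X n x - L x))\<^sup>2) \<partial>\<mu>) \<le> ennreal e"
proof -
  have Xs: "X n \<in> sec" for n using X by (rule L2D)
  obtain N where N: "\<And>e m n. \<lbrakk>e > 0; N e \<le> m; N e \<le> n\<rbrakk> \<Longrightarrow> (\<integral>\<^sup>+x. ennreal ((norm (X m x - X n x))\<^sup>2) \<partial>\<mu>) \<le> ennreal e"
    proof -
    have "\<forall>e. \<exists>N. e > 0 \<longrightarrow> (\<forall>m\<ge>N. \<forall>n\<ge>N. (\<integral>\<^sup>+x. ennreal ((norm (X m x - X n x))\<^sup>2) \<partial>\<mu>) \<le> ennreal e)"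
      using Cauchy by blast
    from choice[OF this] show ?thesis using that by blast
  qed
  \<comment> \<open>The sum makes \<open>k l\<close> at least \<open>N ((1/4)^j)\<close> for every
    \<open>j \<le> l\<close>, so consecutive terms can be compared; the summand \<open>j\<close>
    makes \<open>k\<close> unbounded, as the use of Fatou's lemma below requires.\<close>
  define k where "k j = (\<Sum>l\<le>j. N ((1/4)^l)) + j" for j
  have kN: "N ((1/4)^j) \<le> k l" if "j \<le> l" for j l
  proof -
    have "N ((1/4)^j) \<le> (\<Sum>l\<le>l. N ((1/4)^l))" using that by (intro member_le_sum) auto
    then show ?thesis by (simp add: k_def)
  qed
  have k_ge: "j \<le> k j" for j by (simp add: k_def)
  define a where "a j x = norm (X (k (Suc j)) x - X (k j) x)" for j x
  have a_meas [measurable]: "a j \<in> borel_measurable \<mu>" for j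
    unfolding a_def by (rule sec_norm[OF sec_diff[OF Xs Xs]])
  have a_int: "(\<integral>\<^sup>+x. ennreal (a j x) \<partial>\<mu>) \<le> ennreal (2 * (1/2)^j)" for j
  proof -
    \<comment> \<open>replaces the Cauchy-Schwarz inequality, \<open>\<mu>\<close> being a probability measure\<close>
    have "a j x \<le> 2^j * (a j x)\<^sup>2 + (1/2)^j" for x
    proof (cases "a j x \<le> (1/2)^j")
      case False
      then have "(1/2)^j * a j x \<le> a j x * a j x" by (intro mult_right_mono) (auto simp: a_def)
      then have "2^j * ((1/2)^j * a j x) \<le> 2^j * (a j x * a j x)" by (intro mult_left_mono) auto
      moreover have "2^j * ((1/2)^j * a j x) = a j x"
      proof -
        have "2^j * ((1/2)^j * a j x) = (2 * (1/2))^j * a j x" by (simp only: power_mult_distrib mult.assoc)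
        then show ?thesis by simp
      qed
      moreover have "0 \<le> (1/2::real)^j" by simp
      ultimately show ?thesis unfolding power2_eq_square by linarith
    qed (simp add: add_increasing)
    then have "(\<integral>\<^sup>+x. ennreal (a j x) \<partial>\<mu>) \<le> (\<integral>\<^sup>+x. ennreal (2^j * (a j x)\<^sup>2 + (1/2)^j) \<partial>\<mu>)"
      by (intro nn_integral_mono ennreal_leI)
    also have "\<dots> = (\<integral>\<^sup>+x. ennreal (2^j) * ennreal ((a j x)\<^sup>2) + ennreal ((1/2)^j) \<partial>\<mu>)"
      by (intro nn_integral_cong) (simp add: ennreal_plus ennreal_mult del: ennreal_power)
    also have "\<dots> = ennreal (2^j) * (\<integral>\<^sup>+x. ennreal ((a j x)\<^sup>2) \<partial>\<mu>) + ennreal ((1/2)^j)"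
      by (subst nn_integral_add) (auto simp: nn_integral_cmult)
    also have "\<dots> \<le> ennreal (2^j) * ennreal ((1/4)^j) + ennreal ((1/2)^j)"
      unfolding a_def using kN[of j j] kN[of j "Suc j"] N[of "(1/4)^j" "k (Suc j)" "k j"]
      by (intro add_right_mono mult_left_mono) auto
    also have "\<dots> = ennreal (2 * (1/2)^j)"
      by (simp add: ennreal_mult[symmetric] ennreal_plus[symmetric] power_mult_distrib[symmetric] del: ennreal_plus ennreal_power)
    finally show ?thesis .
  qed
  have "(\<integral>\<^sup>+x. (\<Sum>j. ennreal (a j x)) \<partial>\<mu>) = (\<Sum>j. \<integral>\<^sup>+x. ennreal (a j x) \<partial>\<mu>)"
    by (rule nn_integral_suminf) simp
  also have "\<dots> \<le> (\<Sum>j. ennreal (2 * (1/2)^j))" by (intro suminf_le a_int) auto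
  also have "\<dots> < \<infinity>"
    by (subst suminf_ennreal2) (auto intro!: summable_mult summable_geometric)
  finally have "AE x in \<mu>. (\<Sum>j. ennreal (a j x)) \<noteq> \<infinity>"
    by (intro nn_integral_PInf_AE) auto
  define S where "S = {x \<in> units G. (\<Sum>j. ennreal (a j x)) \<noteq> \<infinity>}"
  have S_meas [measurable]: "S \<in> sets \<mu>"
  proof -
    have "{x \<in> space \<mu>. (\<Sum>j. ennreal (a j x)) \<noteq> \<infinity>} \<in> sets \<mu>" by measurable
    then show ?thesis by (simp add: S_def)
  qed
  have AE_S: "AE x in \<mu>. x \<in> S"
    using \<open>AE x in \<mu>. (\<Sum>j. ennreal (a j x)) \<noteq> \<infinity>\<close> AE_space[of \<mu>] by eventually_elim (simp add: S_def)
  have "convergent (\<lambda>j. X (k j) x)" if "x \<in> S" for x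
  proof -
    have "summable (\<lambda>j. a j x)"
      using that by (intro summable_suminf_not_top) (auto simp: S_def a_def)
    then have "summable (\<lambda>j. X (k (Suc j)) x - X (k j) x)"
      unfolding a_def by (rule summable_norm_cancel)
    then have "convergent (\<lambda>n. \<Sum>j<n. X (k (Suc j)) x - X (k j) x)" by (simp add: summable_iff_convergent)
    then have "convergent (\<lambda>n. X (k n) x - X (k 0) x)" by (simp only: sum_lessThan_telescope[of "\<lambda>j. X (k j) x"])
    then have "convergent (\<lambda>n. (X (k n) x - X (k 0) x) + X (k 0) x)" by (intro convergent_add convergent_const)
    then show ?thesis by simp
  qed
  \<comment> \<open>The value \<open>0\<close> off \<open>S\<close> lies in every fibre, so
    \<open>L\<close> is a section at every unit and not merely at almost every one.\<close>
  define L where "L x = (if x \<in> S then lim (\<lambda>j. X (k j) x) else 0)" for x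
  have lim: "(\<lambda>j. X (k j) x) \<longlonglongrightarrow> L x" if "x \<in> S" for x
    using that \<open>x \<in> S \<Longrightarrow> convergent (\<lambda>j. X (k j) x)\<close> by (simp add: L_def convergent_LIMSEQ_iff)
  have Ls: "L \<in> sec"
    unfolding sec_def
  proof (intro CollectI conjI ballI allI)
    fix x assume "x \<in> units G"
    then show "L x \<in> K x"
      using K_closed[OF _ secD(1)[OF Xs] lim] by (cases "x \<in> S") (auto simp: L_def K_zero)
  next
    fix n
    show "(\<lambda>x. coord (L x) n) \<in> borel_measurable \<mu>"
    proof (rule borel_measurable_LIMSEQ_metric)
      show "(\<lambda>x. if x \<in> S then coord (X (k j) x) n else 0) \<in> borel_measurable \<mu>" for j
        using secD(2)[OF Xs] sets.Int[OF S_meas sets.top] by (intro measurable_If_set) auto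
      fix x assume "x \<in> space \<mu>"
      show "(\<lambda>j. if x \<in> S then coord (X (k j) x) n else 0) \<longlonglongrightarrow> coord (L x) n"
      proof (cases "x \<in> S")
        case True
        have "(\<lambda>j. coord (X (k j) x) n - coord (L x) n) \<longlonglongrightarrow> 0"
        proof (rule Lim_null_comparison)
          show "\<forall>\<^sub>F j in sequentially. norm (coord (X (k j) x) n - coord (L x) n) \<le> norm (X (k j) x - L x)"
            using coord_bound[of "X (k _) x - L x" n] by simp
          show "(\<lambda>j. norm (X (k j) x - L x)) \<longlonglongrightarrow> 0" using lim[OF True] by (simp add: tendsto_norm_zero_iff LIM_zero_iff)
        qed
        then show ?thesis using True by (simp add: LIM_zero_iff)
      qed (simp add: L_def)
    qed
  qed
  have conv: "(\<integral>\<^sup>+x. ennreal ((norm (X n x - L x))\<^sup>2) \<partial>\<mu>) \<le> ennreal e" if "e > 0" "N e \<le> n" for e n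
  proof -
    have "(\<integral>\<^sup>+x. ennreal ((norm (X n x - L x))\<^sup>2) \<partial>\<mu>) = (\<integral>\<^sup>+x. liminf (\<lambda>j. ennreal ((norm (X n x - X (k j) x))\<^sup>2)) \<partial>\<mu>)"
    proof (rule nn_integral_cong_AE)
      show "AE x in \<mu>. ennreal ((norm (X n x - L x))\<^sup>2) = liminf (\<lambda>j. ennreal ((norm (X n x - X (k j) x))\<^sup>2))"
        using AE_S
      proof eventually_elim
        case (elim x)
        have "(\<lambda>j. ennreal ((norm (X n x - X (k j) x))\<^sup>2)) \<longlonglongrightarrow> ennreal ((norm (X n x - L x))\<^sup>2)"
          by (intro tendsto_ennrealI tendsto_intros lim elim)
        then show ?case by (intro lim_imp_Liminf[symmetric]) simp_all
      qed
    qed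
    also have "\<dots> \<le> liminf (\<lambda>j. \<integral>\<^sup>+x. ennreal ((norm (X n x - X (k j) x))\<^sup>2) \<partial>\<mu>)"
      using sec_norm[OF sec_diff[OF Xs Xs]] by (intro nn_integral_liminf) simp
    also have "\<dots> \<le> liminf (\<lambda>j. ennreal e)"
    proof (rule Liminf_mono)
      show "\<forall>\<^sub>F j in sequentially. (\<integral>\<^sup>+x. ennreal ((norm (X n x - X (k j) x))\<^sup>2) \<partial>\<mu>) \<le> ennreal e"
        by (rule eventually_sequentiallyI[of "N e"]) (use N[OF that] k_ge le_trans in blast)
    qed
    also have "\<dots> = ennreal e" by (simp add: Liminf_const)
    finally show ?thesis .
  qed
  have "(\<integral>\<^sup>+x. ennreal ((norm (X (N 1) x - L x))\<^sup>2) \<partial>\<mu>) \<le> ennreal 1" by (rule conv) simp_all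
  also have "\<dots> < \<infinity>" by simp
  finally have "(\<lambda>x. X (N 1) x - L x) \<in> L2" by (intro L2I_nn sec_diff Xs Ls)
  from L2_diff[OF X[of "N 1"] this] have "L \<in> L2" by simp
  then show ?thesis using conv by (intro bexI[of _ L] allI impI) (auto intro!: exI[of _ "N _"])
qed

end

section \<open>Convolution operators on sections\<close>

context ell2_representation
begin

lemma nu_fibre_bound:
  assumes "compact A"
  obtains N :: nat where "\<And>h. h \<in> borel_measurable \<mu> \<Longrightarrow>
      (\<integral>\<^sup>+g. indicator A g * (h (r g) :: ennreal) \<partial>\<nu>) \<le> of_nat N * (\<integral>\<^sup>+x. h x \<partial>\<mu>)"
proof -
  obtain N where N: "\<And>x. finite {g \<in> A. r g = x}" "\<And>x. card {g \<in> A. r g = x} \<le> N"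
    using compact_fibre_bound[OF assms] by metis
  have "(\<integral>\<^sup>+g. indicator A g * h (r g) \<partial>\<nu>) \<le> of_nat N * (\<integral>\<^sup>+x. h x \<partial>\<mu>)"
    if h: "h \<in> borel_measurable \<mu>" for h :: "'g \<Rightarrow> ennreal"
  proof -
    have [measurable]: "A \<in> sets borel" "(\<lambda>g. h (r g)) \<in> borel_measurable borel"
      using compact_borel[OF assms] measurable_compose[OF ends_measurable_mu(2) h] by auto
    have "(\<integral>\<^sup>+g. indicator A g * h (r g) \<partial>count_space {g. r g = x}) \<le> of_nat N * h x" for x
    proof -
      have "(\<integral>\<^sup>+g. indicator A g * h (r g) \<partial>count_space {g. r g = x}) = (\<Sum>g\<in>{g \<in> A. r g = x}. indicator A g * h (r g))"
        using N(1) by (intro nn_integral_count_space') auto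
      also have "\<dots> = (\<Sum>g\<in>{g \<in> A. r g = x}. h x)" by (intro sum.cong) auto
      also have "\<dots> = of_nat (card {g \<in> A. r g = x}) * h x" by simp
      also have "\<dots> \<le> of_nat N * h x" using N(2)[of x] by (intro mult_right_mono) simp_all
      finally show ?thesis .
    qed
    then have "(\<integral>\<^sup>+g. indicator A g * h (r g) \<partial>\<nu>) \<le> (\<integral>\<^sup>+x. of_nat N * h x \<partial>\<mu>)"
      by (subst nn_integral_nu) (auto intro: nn_integral_mono)
    then show ?thesis using h by (simp add: nn_integral_cmult)
  qed
  then show thesis by (rule that)
qed

text \<open>Inversion carries source fibres to range fibres and preserves \<nu>, so the bound along
  \<open>r\<close> applies to the compact set of inverses.\<close>

lemma nu_fibre_bound_src:
  assumes "compact A"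
  obtains N :: nat where "\<And>h. h \<in> borel_measurable \<mu> \<Longrightarrow>
      (\<integral>\<^sup>+g. indicator A g * (h (s g) :: ennreal) \<partial>\<nu>) \<le> of_nat N * (\<integral>\<^sup>+x. h x \<partial>\<mu>)"
proof -
  have K: "compact (i ` A)"
    by (rule compact_continuous_image[OF continuous_on_subset[OF inv_continuous] assms]) simp
  obtain N :: nat where N: "\<And>h. h \<in> borel_measurable \<mu> \<Longrightarrow>
      (\<integral>\<^sup>+g. indicator (i ` A) g * (h (r g) :: ennreal) \<partial>\<nu>) \<le> of_nat N * (\<integral>\<^sup>+x. h x \<partial>\<mu>)"
    using nu_fibre_bound[OF K] by blast
  have "(\<integral>\<^sup>+g. indicator A g * h (s g) \<partial>\<nu>) \<le> of_nat N * (\<integral>\<^sup>+x. h x \<partial>\<mu>)"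
    if h: "h \<in> borel_measurable \<mu>" for h :: "'g \<Rightarrow> ennreal"
  proof -
    have [measurable]: "i ` A \<in> sets borel" "(\<lambda>g. h (r g)) \<in> borel_measurable borel"
      using compact_borel[OF K] measurable_compose[OF ends_measurable_mu(2) h] by auto
    have "i g \<in> i ` A \<longleftrightarrow> g \<in> A" for g by (metis image_eqI imageE inv_inv)
    then have "indicator A g * h (s g) = indicator (i ` A) (i g) * h (r (i g))" for g
      by (simp add: indicator_def)
    then have "(\<integral>\<^sup>+g. indicator A g * h (s g) \<partial>\<nu>) = (\<integral>\<^sup>+g. indicator (i ` A) g * h (r g) \<partial>\<nu>)"
      using nn_integral_nu_inv[of "\<lambda>g. indicator (i ` A) g * h (r g)"] by simp
    then show ?thesis using N[OF h] by simp
  qed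
  then show thesis by (rule that)
qed

text \<open>Cauchy-Schwarz on one fibre, with at most \<open>N\<close> terms and coefficients at
  most \<open>B\<close>. It serves for the boundedness of the operators and, with the defects of
  invariance as \<open>v\<close>, for the estimate on almost invariant sections.\<close>

lemma fibre_norm_bound:
  fixes f :: "'g \<Rightarrow> complex" and v :: "'g \<Rightarrow> ell2"
  assumes N: "\<And>x. finite {g \<in> A. r g = x}" "\<And>x. card {g \<in> A. r g = x} \<le> N"
    and f: "\<And>g. f g \<noteq> 0 \<Longrightarrow> g \<in> A" "\<And>g. cmod (f g) \<le> B"
  shows "ennreal ((norm (\<Sum>g | r g = x \<and> f g \<noteq> 0. cscale (f g) (v g)))\<^sup>2) \<le>
    ennreal (N * B\<^sup>2) * (\<integral>\<^sup>+g. indicator A g * ennreal ((norm (v g))\<^sup>2) \<partial>count_space {g. r g = x})"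
proof -
  let ?A = "{g \<in> A. r g = x}" let ?F = "{g. r g = x \<and> f g \<noteq> 0}"
  have FA: "?F \<subseteq> ?A" using f(1) by auto
  have finF: "finite ?F" using finite_subset[OF FA N(1)] .
  have B: "0 \<le> B" using f(2) norm_ge_zero order_trans by blast
  have "(norm (\<Sum>g\<in>?F. cscale (f g) (v g)))\<^sup>2 \<le> card ?F * (\<Sum>g\<in>?F. (norm (cscale (f g) (v g)))\<^sup>2)"
    by (rule norm_sum_sq_le[OF finF])
  also have "\<dots> \<le> N * (\<Sum>g\<in>?F. B\<^sup>2 * (norm (v g))\<^sup>2)"
  proof (rule mult_mono)
    show "real (card ?F) \<le> real N" using card_mono[OF N(1) FA] N(2)[of x] by simp
    show "(\<Sum>g\<in>?F. (norm (cscale (f g) (v g)))\<^sup>2) \<le> (\<Sum>g\<in>?F. B\<^sup>2 * (norm (v g))\<^sup>2)"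
      using f(2) by (intro sum_mono) (auto simp: power_mult_distrib intro!: mult_right_mono power_mono)
  qed (auto intro: sum_nonneg)
  also have "\<dots> \<le> N * (\<Sum>g\<in>?A. B\<^sup>2 * (norm (v g))\<^sup>2)"
    by (intro mult_left_mono sum_mono2[OF N(1) FA]) auto
  also have "\<dots> = (N * B\<^sup>2) * (\<Sum>g\<in>?A. (norm (v g))\<^sup>2)" by (simp add: sum_distrib_left mult.assoc)
  finally have "ennreal ((norm (\<Sum>g\<in>?F. cscale (f g) (v g)))\<^sup>2) \<le> ennreal ((N * B\<^sup>2) * (\<Sum>g\<in>?A. (norm (v g))\<^sup>2))"
    by (rule ennreal_leI)
  also have "\<dots> = ennreal (N * B\<^sup>2) * (\<Sum>g\<in>?A. ennreal ((norm (v g))\<^sup>2))"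
    by (subst ennreal_mult) (auto intro: sum_nonneg simp: sum_ennreal)
  also have "(\<Sum>g\<in>?A. ennreal ((norm (v g))\<^sup>2)) = (\<Sum>g\<in>?A. indicator A g * ennreal ((norm (v g))\<^sup>2))"
    by (intro sum.cong) auto
  also have "\<dots> = (\<integral>\<^sup>+g. indicator A g * ennreal ((norm (v g))\<^sup>2) \<partial>count_space {g. r g = x})"
    using N(1) by (intro nn_integral_count_space'[symmetric]) auto
  finally show ?thesis .
qed

text \<open>A fibre may be infinite, and a finite-set sum over an infinite set is \<open>0\<close>;
  hence the restriction to arrows with \<open>f g \<noteq> 0\<close>.\<close>

definition T :: "('g \<Rightarrow> complex) \<Rightarrow> ('g \<Rightarrow> ell2) \<Rightarrow> 'g \<Rightarrow> ell2" where
  "T f F x = (\<Sum>g | r g = x \<and> f g \<noteq> 0. cscale (f g) (U g (F (s g))))"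

lemma Cc_support: "f \<in> Cc \<Longrightarrow> continuous_on UNIV f" "f \<in> Cc \<Longrightarrow> compact (closure {g. f g \<noteq> 0})"
  by (auto simp: Cc_def supp_def)

lemmas Cc_finite = continuous_compact_support(2)[OF Cc_support]
lemmas Cc_borel = continuous_compact_support(3)[OF Cc_support]

lemma Cc_bound:
  fixes f :: "'g \<Rightarrow> complex"
  assumes "f \<in> Cc"
  obtains B where "\<And>g. cmod (f g) \<le> B"
  using continuous_compact_support(4)[OF Cc_support(1)[OF assms] Cc_support(2)[OF assms]] by blast

lemma Cc_adj: "f \<in> Cc \<Longrightarrow> adj G f \<in> Cc"
  unfolding Cc_def supp_def adj_def
  using support_inv[of f] by (auto intro!: continuous_intros)

lemma T_superset:
  assumes "finite S" "{g. r g = x \<and> f g \<noteq> 0} \<subseteq> S" "S \<subseteq> {g. r g = x}"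
  shows "T f F x = (\<Sum>g\<in>S. cscale (f g) (U g (F (s g))))"
  unfolding T_def using assms by (intro sum.mono_neutral_left) (auto simp: cscale_algebra)

lemma T_K: "F \<in> sec \<Longrightarrow> x \<in> units G \<Longrightarrow> T f F x \<in> K x"
  unfolding T_def by (intro K_sum) (auto intro!: K_scale U_closed simp: secD)

lemma T_sec:
  assumes F: "F \<in> sec" and f: "f \<in> borel_measurable borel" "\<And>x. finite {g. r g = x \<and> f g \<noteq> 0}"
  shows "T f F \<in> sec"
proof -
  have "(\<lambda>x. coord (T f F x) n) \<in> borel_measurable \<mu>" for n
  proof -
    let ?h = "\<lambda>g. f g * coord (U g (F (s g))) n"
    have "{g. r g = x \<and> ?h g \<noteq> 0} \<subseteq> {g. r g = x \<and> f g \<noteq> 0}" for x by auto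
    then have fin: "finite {g. r g = x \<and> ?h g \<noteq> 0}" for x using f(2) finite_subset by blast
    have "coord (T f F x) n = fibre_sum ?h x" for x
      unfolding T_def coord_sum fibre_sum_def using f(2) by (intro sum.mono_neutral_cong_right) auto
    moreover have "fibre_sum ?h \<in> borel_measurable \<mu>"
      by (intro measurable_fibre_sum fin borel_measurable_times f sec_U F)
    ultimately show ?thesis by simp
  qed
  then show ?thesis using T_K[OF F] by (auto simp: sec_def)
qed

lemma T_Cc_sec: "f \<in> Cc \<Longrightarrow> F \<in> sec \<Longrightarrow> T f F \<in> sec"
  by (intro T_sec Cc_borel Cc_finite)

text \<open>Two counts combine: \<open>N\<close> bounds the arrows of the support in a range fibre,
  \<open>N'\<close> those in a source fibre, while \<open>U\<close> is isometric. Nonnegative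
  integrals make the estimate available for all measurable sections, so that it can prove membership
  in \<open>L2\<close>.\<close>

lemma T_bounded:
  assumes f: "f \<in> Cc"
  obtains C where "0 \<le> C" "\<And>F. F \<in> sec \<Longrightarrow>
    (\<integral>\<^sup>+x. ennreal ((norm (T f F x))\<^sup>2) \<partial>\<mu>) \<le> ennreal C * (\<integral>\<^sup>+x. ennreal ((norm (F x))\<^sup>2) \<partial>\<mu>)"
proof -
  let ?A = "closure {g. f g \<noteq> 0}"
  have A: "compact ?A" using f by (rule Cc_support)
  obtain B where B: "\<And>g. cmod (f g) \<le> B" using Cc_bound[OF f] by blast
  obtain N where N: "\<And>x. finite {g \<in> ?A. r g = x}" "\<And>x. card {g \<in> ?A. r g = x} \<le> N"
    using compact_fibre_bound[OF A] by metis
  obtain N' :: nat where N': "\<And>h. h \<in> borel_measurable \<mu> \<Longrightarrow>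
      (\<integral>\<^sup>+g. indicator ?A g * (h (s g) :: ennreal) \<partial>\<nu>) \<le> of_nat N' * (\<integral>\<^sup>+x. h x \<partial>\<mu>)"
    using nu_fibre_bound_src[OF A] by blast
  have supp: "g \<in> ?A" if "f g \<noteq> 0" for g using that closure_subset[of "{g. f g \<noteq> 0}"] by blast
  show thesis
  proof (rule that[of "real N * B\<^sup>2 * real N'"])
    fix F assume F: "F \<in> sec"
    have [measurable]: "?A \<in> sets borel" using compact_borel[OF A] .
    have [measurable]: "(\<lambda>g. norm (U g (F (s g)))) \<in> borel_measurable borel"
      by (rule measurable_norm_ell2) (rule sec_U[OF F])
    have "(\<integral>\<^sup>+x. ennreal ((norm (T f F x))\<^sup>2) \<partial>\<mu>) \<le>
       (\<integral>\<^sup>+x. ennreal (N * B\<^sup>2) * (\<integral>\<^sup>+g. indicator ?A g * ennreal ((norm (U g (F (s g))))\<^sup>2) \<partial>count_space {g. r g = x}) \<partial>\<mu>)"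
      unfolding T_def by (intro nn_integral_mono fibre_norm_bound N B supp)
    also have "\<dots> = ennreal (N * B\<^sup>2) * (\<integral>\<^sup>+g. indicator ?A g * ennreal ((norm (U g (F (s g))))\<^sup>2) \<partial>\<nu>)"
      by (subst nn_integral_nu) (auto simp: nn_integral_cmult)
    also have "\<dots> = ennreal (N * B\<^sup>2) * (\<integral>\<^sup>+g. indicator ?A g * ennreal ((norm (F (s g)))\<^sup>2) \<partial>\<nu>)"
      using F by (simp add: U_norm secD)
    also have "\<dots> \<le> ennreal (N * B\<^sup>2) * (of_nat N' * (\<integral>\<^sup>+x. ennreal ((norm (F x))\<^sup>2) \<partial>\<mu>))"
      using sec_norm[OF F] by (intro mult_left_mono N') auto
    also have "\<dots> = ennreal (real N * B\<^sup>2 * real N') * (\<integral>\<^sup>+x. ennreal ((norm (F x))\<^sup>2) \<partial>\<mu>)"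
      by (simp add: ennreal_mult' ennreal_of_nat_eq_real_of_nat mult.assoc)
    finally show "(\<integral>\<^sup>+x. ennreal ((norm (T f F x))\<^sup>2) \<partial>\<mu>) \<le>
      ennreal (real N * B\<^sup>2 * real N') * (\<integral>\<^sup>+x. ennreal ((norm (F x))\<^sup>2) \<partial>\<mu>)" .
  qed simp
qed

lemma T_L2:
  assumes "f \<in> Cc" "F \<in> L2"
  shows "T f F \<in> L2"
proof -
  obtain C where "0 \<le> C" "\<And>F. F \<in> sec \<Longrightarrow>
    (\<integral>\<^sup>+x. ennreal ((norm (T f F x))\<^sup>2) \<partial>\<mu>) \<le> ennreal C * (\<integral>\<^sup>+x. ennreal ((norm (F x))\<^sup>2) \<partial>\<mu>)"
    using T_bounded[OF assms(1)] by blast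
  then have "(\<integral>\<^sup>+x. ennreal ((norm (T f F x))\<^sup>2) \<partial>\<mu>) \<le> ennreal C * (\<integral>\<^sup>+x. ennreal ((norm (F x))\<^sup>2) \<partial>\<mu>)"
    using assms(2) L2D(1) by blast
  also have "\<dots> < \<infinity>" unfolding L2_nn[OF assms(2)] by (simp add: ennreal_mult_less_top)
  finally show ?thesis using T_Cc_sec[OF assms(1)] assms(2) by (intro L2I_nn) (auto dest: L2D)
qed

text \<open>The value at \<open>x\<close> involves \<open>F\<close> at the sources of the arrows
  over \<open>x\<close>, and for almost every \<open>x\<close> all of these avoid a given null
  set.\<close>

lemma T_cong_AE:
  assumes "AE x in \<mu>. F x = F' x"
  shows "AE x in \<mu>. T f F x = T f F' x"
proof -
  have "AE x in \<mu>. \<forall>g. r g = x \<longrightarrow> F (s g) = F' (s g)"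
    using AE_src[OF assms] unfolding AE_nu_iff_fibres .
  then show ?thesis by eventually_elim (auto simp: T_def intro: sum.cong)
qed

lemma T_add_section:
  "F \<in> sec \<Longrightarrow> F' \<in> sec \<Longrightarrow> T f (\<lambda>x. F x + F' x) x = T f F x + T f F' x"
  by (simp add: T_def U_add secD cscale_algebra sum.distrib)

lemma T_scale_section: "F \<in> sec \<Longrightarrow> T f (\<lambda>x. cscale a (F x)) x = cscale a (T f F x)"
  by (simp add: T_def U_scale secD cscale_algebra cscale_sum mult.commute)

lemma T_add_function:
  assumes "finite {g. r g = x \<and> f g \<noteq> 0}" "finite {g. r g = x \<and> f' g \<noteq> 0}"
  shows "T (\<lambda>g. f g + f' g) F x = T f F x + T f' F x"
proof -
  let ?S = "{g. r g = x \<and> f g \<noteq> 0} \<union> {g. r g = x \<and> f' g \<noteq> 0}"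
  have "T h F x = (\<Sum>g\<in>?S. cscale (h g) (U g (F (s g))))" if "\<And>g. h g \<noteq> 0 \<Longrightarrow> f g \<noteq> 0 \<or> f' g \<noteq> 0" for h
    using assms that by (intro T_superset) auto
  note S = this
  have "T (\<lambda>g. f g + f' g) F x = (\<Sum>g\<in>?S. cscale (f g + f' g) (U g (F (s g))))" by (rule S) auto
  also have "\<dots> = (\<Sum>g\<in>?S. cscale (f g) (U g (F (s g)))) + (\<Sum>g\<in>?S. cscale (f' g) (U g (F (s g))))"
    by (simp add: cscale_algebra sum.distrib)
  also have "(\<Sum>g\<in>?S. cscale (f g) (U g (F (s g)))) = T f F x" by (rule S[symmetric]) simp
  also have "(\<Sum>g\<in>?S. cscale (f' g) (U g (F (s g)))) = T f' F x" by (rule S[symmetric]) simp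
  finally show ?thesis .
qed

lemma T_scale_function: "T (\<lambda>g. a * f g) F x = cscale a (T f F x)"
  by (cases "a = 0") (simp_all add: T_def cscale_algebra cscale_sum)

lemma T_conv_one: "F \<in> sec \<Longrightarrow> x \<in> units G \<Longrightarrow> T (conv_one G) F x = F x"
proof -
  assume "F \<in> sec" "x \<in> units G"
  moreover from this have "T (conv_one G) F x = (\<Sum>g\<in>{x}. cscale (conv_one G g) (U g (F (s g))))"
    by (intro T_superset) (auto simp: conv_one_def split: if_splits)
  ultimately show ?thesis by (simp add: conv_one_def cscale_algebra U_unit secD)
qed

lemma T_Psi:
  assumes "finite {g. r g = x \<and> f g \<noteq> 0}" "F \<in> sec" "x \<in> units G"
  shows "T (Psi G f) F x = cscale (fibre_sum f x) (F x)"
proof -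
  have "T (Psi G f) F x = (\<Sum>g\<in>{x}. cscale (Psi G f g) (U g (F (s g))))"
    using assms(3) by (intro T_superset) (auto simp: Psi_def split: if_splits)
  then show ?thesis using assms infsum_fibre[OF assms(1)] by (simp add: Psi_def U_unit secD)
qed

text \<open>Both sides are one finite double sum over composable pairs \<open>(h, k)\<close> with
  range \<open>x\<close>, grouped by \<open>h\<close> on the right and by the product on the
  left.\<close>

lemma T_conv:
  assumes f1: "\<And>x. finite {g. r g = x \<and> f1 g \<noteq> 0}" and f2: "\<And>x. finite {g. r g = x \<and> f2 g \<noteq> 0}"
    and F: "F \<in> sec"
  shows "T (conv G f1 f2) F x = T f1 (T f2 F) x"
proof -
  let ?A1 = "{h. r h = x \<and> f1 h \<noteq> 0}" let ?A2 = "\<lambda>h. {k. r k = s h \<and> f2 k \<noteq> 0}"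
  define A where "A = Sigma ?A1 ?A2"
  define \<phi> where "\<phi> = (\<lambda>(h, k). cscale (f1 h * f2 k) (U (m h k) (F (s (m h k)))))"
  define p where "p = (\<lambda>(h, k). m h k)"
  have finA: "finite A" unfolding A_def using f1 f2 by auto
  have conv_eq: "conv G f1 f2 g = (\<Sum>(h, k)\<in>{q \<in> A. p q = g}. f1 h * f2 k)" if "r g = x" for g
  proof -
    have "conv G f1 f2 g = (\<Sum>\<^sub>\<infinity>(h, k)\<in>{q \<in> A. p q = g}. f1 h * f2 k)"
      unfolding conv_def
    proof (rule infsum_cong_neutral)
      let ?S = "{(h, k). h \<in> arr G \<and> k \<in> arr G \<and> s h = r k \<and> m h k = g}"
      show "(case q of (h, k) \<Rightarrow> f1 h * f2 k) = 0" if "q \<in> {q \<in> A. p q = g} - ?S" for q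
        using that by (cases q) (auto simp: A_def p_def)
      show "(case q of (h, k) \<Rightarrow> f1 h * f2 k) = 0" if "q \<in> ?S - {q \<in> A. p q = g}" for q
      proof -
        obtain h k where q: "q = (h, k)" by (cases q)
        have hk: "s h = r k" "m h k = g" using that by (simp_all add: q)
        then have "r h = x" using \<open>r g = x\<close> mult_ends(2)[of h k] by simp
        then show ?thesis using that hk unfolding q A_def p_def by auto
      qed
    qed simp
    then show ?thesis using finA by simp
  qed
  have "T f1 (T f2 F) x = (\<Sum>h\<in>?A1. \<Sum>k\<in>?A2 h. \<phi> (h, k))"
    unfolding T_def
  proof (rule sum.cong)
    fix h assume "h \<in> ?A1"
    have "U h (\<Sum>k\<in>?A2 h. cscale (f2 k) (U k (F (s k)))) = (\<Sum>k\<in>?A2 h. cscale (f2 k) (U h (U k (F (s k)))))"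
    proof -
      have c: "U k (F (s k)) \<in> K (s h)" if "k \<in> ?A2 h" for k
        using U_closed[of "F (s k)" k] that F by (simp add: secD)
      then have "U h (\<Sum>k\<in>?A2 h. cscale (f2 k) (U k (F (s k)))) = (\<Sum>k\<in>?A2 h. U h (cscale (f2 k) (U k (F (s k)))))"
        by (intro U_sum K_scale) auto
      also have "\<dots> = (\<Sum>k\<in>?A2 h. cscale (f2 k) (U h (U k (F (s k)))))"
        using c by (intro sum.cong U_scale) auto
      finally show ?thesis .
    qed
    then show "cscale (f1 h) (U h (\<Sum>k | r k = s h \<and> f2 k \<noteq> 0. cscale (f2 k) (U k (F (s k))))) = (\<Sum>k\<in>?A2 h. \<phi> (h, k))"
      using F by (simp add: cscale_sum cscale_algebra \<phi>_def U_mult secD)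
  qed simp
  also have "\<dots> = sum \<phi> A" unfolding A_def using f1 f2 by (subst sum.Sigma) auto
  also have "\<dots> = (\<Sum>g\<in>p ` A. \<Sum>q\<in>{q \<in> A. p q = g}. \<phi> q)" by (rule sum.image_gen[OF finA])
  also have "\<dots> = (\<Sum>g\<in>p ` A. cscale (conv G f1 f2 g) (U g (F (s g))))"
  proof (rule sum.cong)
    fix g assume "g \<in> p ` A"
    then have "r g = x" by (auto simp: A_def p_def)
    then show "(\<Sum>q\<in>{q \<in> A. p q = g}. \<phi> q) = cscale (conv G f1 f2 g) (U g (F (s g)))"
      unfolding conv_eq[OF \<open>r g = x\<close>] cscale_sum_left by (intro sum.cong) (auto simp: \<phi>_def p_def)
  qed simp
  also have "\<dots> = T (conv G f1 f2) F x"
  proof (rule T_superset[symmetric])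
    show "{g. r g = x \<and> conv G f1 f2 g \<noteq> 0} \<subseteq> p ` A"
    proof
      fix g assume "g \<in> {g. r g = x \<and> conv G f1 f2 g \<noteq> 0}"
      then have "{q \<in> A. p q = g} \<noteq> {}" using conv_eq[of g] by (auto simp del: Collect_empty_eq)
      then show "g \<in> p ` A" by blast
    qed
  qed (use finA in \<open>auto simp: A_def p_def\<close>)
  finally show ?thesis by simp
qed

text \<open>Written over the arrows, the pairing can be transformed by inversion. The change of
  integral needs integrability over \<nu>, which comes from bounding a product of norms by the sum
  of their squares and from the fibre bounds along \<open>s\<close> and \<open>r\<close>.\<close>

lemma T_pairing:
  assumes f: "f \<in> Cc" and F: "F \<in> L2" and F': "F' \<in> L2"
  shows "(\<integral>x. cinner (T f F x) (F' x) \<partial>\<mu>) = (\<integral>g. f g * cinner (U g (F (s g))) (F' (r g)) \<partial>\<nu>)"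
    "(\<lambda>g. f g * cinner (U g (F (s g))) (F' (r g))) \<in> borel_measurable borel"
proof -
  let ?\<Phi> = "\<lambda>g. f g * cinner (U g (F (s g))) (F' (r g))"
  let ?A = "closure {g. f g \<noteq> 0}"
  have A: "compact ?A" using f by (rule Cc_support)
  note Fs = L2D(1)[OF F] and Fs' = L2D(1)[OF F']
  have [measurable]: "?A \<in> sets borel" using compact_borel[OF A] .
  have [measurable]: "(\<lambda>g. norm (F (s g))) \<in> borel_measurable borel" "(\<lambda>g. norm (F' (r g))) \<in> borel_measurable borel"
    by (rule measurable_norm_ell2, rule sec_ends, rule Fs Fs')+
  show meas [measurable]: "?\<Phi> \<in> borel_measurable borel"
    by (intro borel_measurable_times Cc_borel[OF f f] measurable_cinner sec_U sec_ends Fs Fs')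
  have supp: "g \<in> ?A" if "f g \<noteq> 0" for g using that closure_subset[of "{g. f g \<noteq> 0}"] by blast
  obtain B where B: "\<And>g. cmod (f g) \<le> B" using Cc_bound[OF f] by blast
  have B0: "0 \<le> B" using B norm_ge_zero order_trans by blast
  obtain N :: nat where N: "\<And>h. h \<in> borel_measurable \<mu> \<Longrightarrow>
      (\<integral>\<^sup>+g. indicator ?A g * (h (r g) :: ennreal) \<partial>\<nu>) \<le> of_nat N * (\<integral>\<^sup>+x. h x \<partial>\<mu>)"
    using nu_fibre_bound[OF A] by blast
  obtain N' :: nat where N': "\<And>h. h \<in> borel_measurable \<mu> \<Longrightarrow>
      (\<integral>\<^sup>+g. indicator ?A g * (h (s g) :: ennreal) \<partial>\<nu>) \<le> of_nat N' * (\<integral>\<^sup>+x. h x \<partial>\<mu>)"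
    using nu_fibre_bound_src[OF A] by blast
  have int: "integrable \<nu> ?\<Phi>"
  proof (rule integrableI_bounded)
    show "?\<Phi> \<in> borel_measurable \<nu>" using meas by (simp cong: measurable_cong_sets)
    have le: "norm (?\<Phi> g) \<le> B * (indicator ?A g * (norm (F (s g)))\<^sup>2 + indicator ?A g * (norm (F' (r g)))\<^sup>2)" for g
    proof (cases "f g = 0")
      case False
      have "norm (cinner (U g (F (s g))) (F' (r g))) \<le> norm (F (s g)) * norm (F' (r g))"
        using cinner_bound[of "U g (F (s g))" "F' (r g)"] Fs by (simp add: U_norm secD)
      also have "\<dots> \<le> (norm (F (s g)))\<^sup>2 + (norm (F' (r g)))\<^sup>2"
      proof -
        have "0 \<le> norm (F (s g)) * norm (F' (r g))" by simp
        then show ?thesis using sum_squares_bound[of "norm (F (s g))" "norm (F' (r g))"] by linarith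
      qed
      finally show ?thesis using supp[OF False] B[of g] B0 by (auto simp: norm_mult intro!: mult_mono)
    qed (use B0 in auto)
    have "(\<integral>\<^sup>+g. ennreal (norm (?\<Phi> g)) \<partial>\<nu>) \<le>
      (\<integral>\<^sup>+g. ennreal B * (indicator ?A g * ennreal ((norm (F (s g)))\<^sup>2) + indicator ?A g * ennreal ((norm (F' (r g)))\<^sup>2)) \<partial>\<nu>)"
    proof (rule nn_integral_mono)
      fix g
      have "ennreal (norm (?\<Phi> g)) \<le> ennreal (B * (indicator ?A g * (norm (F (s g)))\<^sup>2 + indicator ?A g * (norm (F' (r g)))\<^sup>2))"
        by (rule ennreal_leI[OF le])
      also have "\<dots> = ennreal B * (indicator ?A g * ennreal ((norm (F (s g)))\<^sup>2) + indicator ?A g * ennreal ((norm (F' (r g)))\<^sup>2))"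
        using B0 by (auto simp: indicator_def ennreal_mult ennreal_plus)
      finally show "ennreal (norm (?\<Phi> g)) \<le> ennreal B * (indicator ?A g * ennreal ((norm (F (s g)))\<^sup>2) + indicator ?A g * ennreal ((norm (F' (r g)))\<^sup>2))" .
    qed
    also have "\<dots> = ennreal B * ((\<integral>\<^sup>+g. indicator ?A g * ennreal ((norm (F (s g)))\<^sup>2) \<partial>\<nu>) + (\<integral>\<^sup>+g. indicator ?A g * ennreal ((norm (F' (r g)))\<^sup>2) \<partial>\<nu>))"
      by (simp add: nn_integral_cmult nn_integral_add)
    also have "\<dots> \<le> ennreal B * (of_nat N' * (\<integral>\<^sup>+x. ennreal ((norm (F x))\<^sup>2) \<partial>\<mu>) + of_nat N * (\<integral>\<^sup>+x. ennreal ((norm (F' x))\<^sup>2) \<partial>\<mu>))"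
      using sec_norm[OF Fs] sec_norm[OF Fs'] by (intro mult_left_mono add_mono N N') auto
    also have "\<dots> < \<infinity>" unfolding L2_nn[OF F] L2_nn[OF F'] by (simp add: ennreal_mult_less_top ennreal_add_less_top of_nat_less_top)
    finally show "(\<integral>\<^sup>+g. ennreal (norm (?\<Phi> g)) \<partial>\<nu>) < \<infinity>" .
  qed
  have "{g. r g = x \<and> ?\<Phi> g \<noteq> 0} \<subseteq> {g. r g = x \<and> f g \<noteq> 0}" for x by auto
  then have fin: "finite {g. r g = x \<and> ?\<Phi> g \<noteq> 0}" for x using Cc_finite[OF f f] finite_subset by blast
  have "fibre_sum ?\<Phi> x = cinner (T f F x) (F' x)" for x
    unfolding fibre_sum_def T_def cinner_sum_left
    using Cc_finite[OF f f] by (intro sum.mono_neutral_cong_left) (auto simp: cinner_scale_left)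
  then show "(\<integral>x. cinner (T f F x) (F' x) \<partial>\<mu>) = (\<integral>g. ?\<Phi> g \<partial>\<nu>)"
    using integral_nu[OF int fin] by simp
qed

text \<open>Inversion exchanges \<open>s\<close> and \<open>r\<close>, hence the places of the two
  sections, and turns \<open>U g\<close> into its adjoint; the integral over the arrows is unchanged
  because \<nu> is invariant.\<close>

lemma T_adjoint:
  assumes f: "f \<in> Cc" and F: "F \<in> L2" and F': "F' \<in> L2"
  shows "(\<integral>x. cinner (T (adj G f) F x) (F' x) \<partial>\<mu>) = (\<integral>x. cinner (F x) (T f F' x) \<partial>\<mu>)"
proof -
  let ?\<Phi> = "\<lambda>g. f g * cinner (U g (F' (s g))) (F (r g))"
  have eq: "adj G f g * cinner (U g (F (s g))) (F' (r g)) = cnj (?\<Phi> (i g))" for g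
  proof -
    have c: "F (s g) \<in> K (s g)" "F' (r g) \<in> K (r g)" using L2D(1)[OF F] L2D(1)[OF F'] by (simp_all add: secD)
    have "cinner (U g (F (s g))) (F' (r g)) = cinner (U (i g) (U g (F (s g)))) (U (i g) (F' (r g)))"
      using c U_closed[of "F (s g)" g] by (intro U_inner[symmetric]) auto
    then have "cinner (U g (F (s g))) (F' (r g)) = cinner (F (s g)) (U (i g) (F' (r g)))"
      using c by (simp add: U_inv)
    then show ?thesis using cinner_commute[of "U (i g) (F' (r g))" "F (s g)"] by (simp add: adj_def)
  qed
  have m: "(\<lambda>g. cnj (?\<Phi> g)) \<in> borel_measurable borel"
    by (rule measurable_compose[OF T_pairing(2)[OF f F' F] measurable_cnj])
  have "(\<integral>x. cinner (T (adj G f) F x) (F' x) \<partial>\<mu>) = (\<integral>g. cnj (?\<Phi> (i g)) \<partial>\<nu>)"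
    unfolding T_pairing(1)[OF Cc_adj[OF f] F F'] eq ..
  also have "\<dots> = (\<integral>g. cnj (?\<Phi> g) \<partial>\<nu>)" by (rule integral_nu_inv[OF m])
  also have "\<dots> = cnj (\<integral>g. ?\<Phi> g \<partial>\<nu>)" by (rule Bochner_Integration.integral_cnj)
  also have "\<dots> = cnj (\<integral>x. cinner (T f F' x) (F x) \<partial>\<mu>)" unfolding T_pairing(1)[OF f F' F] ..
  also have "\<dots> = (\<integral>x. cinner (F x) (T f F' x) \<partial>\<mu>)"
    unfolding Bochner_Integration.integral_cnj[symmetric] cinner_commute[symmetric] ..
  finally show ?thesis .
qed

end

section \<open>The Hilbert space of sections\<close>

lemma complex_cring: "cring complex_ring"
proof (rule cringI)
  show "abelian_group complex_ring"
  proof (rule abelian_groupI)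
    show "\<exists>y\<in>carrier complex_ring. y \<oplus>\<^bsub>complex_ring\<^esub> x = \<zero>\<^bsub>complex_ring\<^esub>" for x
      by (intro bexI[of _ "- x"]) (simp_all add: complex_ring_def)
  qed (simp_all add: complex_ring_def)
  show "comm_monoid complex_ring"
    by (rule comm_monoidI) (simp_all add: complex_ring_def)
qed (simp add: complex_ring_def algebra_simps)

text \<open>Property (T) speaks about Hilbert spaces in a fixed universe \<open>'h\<close>, hence classes of sections
  modulo null sets are represented by elements of \<open>'h\<close>.\<close>

locale coded_representation = ell2_representation G \<mu> K U
  for G :: "'g::{second_countable_topology, t2_space} groupoid" and \<mu> K U +
  fixes code :: "('g \<Rightarrow> ell2) \<Rightarrow> 'h"
  assumes code_eq: "\<lbrakk>F \<in> sec; F' \<in> sec\<rbrakk> \<Longrightarrow> code F = code F' \<longleftrightarrow> (AE x in \<mu>. F x = F' x)"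
begin

definition rep :: "'h \<Rightarrow> 'g \<Rightarrow> ell2" where
  "rep u = (SOME F. F \<in> L2 \<and> code F = u)"

text \<open>The operations act on chosen representatives; by \<open>rep_code\<close> they can be
  computed on any square integrable section with the given code.\<close>

definition Hs :: "'h hilbert" where
  "Hs = \<lparr>carrier = code ` L2, monoid.mult = (\<lambda>_ _. undefined), one = undefined, zero = code (\<lambda>_. 0),
     add = (\<lambda>u v. code (\<lambda>x. rep u x + rep v x)), smult = (\<lambda>a u. code (\<lambda>x. cscale a (rep u x))),
     inner_prod = (\<lambda>u v. \<integral>x. cinner (rep u x) (rep v x) \<partial>\<mu>)\<rparr>"

lemma carrier_Hs: "carrier Hs = code ` L2"
  by (simp add: Hs_def)

lemma rep: "u \<in> carrier Hs \<Longrightarrow> rep u \<in> L2" "u \<in> carrier Hs \<Longrightarrow> code (rep u) = u"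
proof -
  assume "u \<in> carrier Hs"
  then have "\<exists>F. F \<in> L2 \<and> code F = u" by (auto simp: carrier_Hs)
  then have "rep u \<in> L2 \<and> code (rep u) = u" unfolding rep_def by (rule someI_ex)
  then show "rep u \<in> L2" "code (rep u) = u" by auto
qed

lemma code_closed: "F \<in> L2 \<Longrightarrow> code F \<in> carrier Hs"
  by (simp add: carrier_Hs)

lemma rep_code: "F \<in> L2 \<Longrightarrow> AE x in \<mu>. rep (code F) x = F x"
  using code_eq[of "rep (code F)" F] rep[OF code_closed[of F]] by (auto dest: L2D)

lemma code_cong_AE: "\<lbrakk>F \<in> L2; F' \<in> L2; AE x in \<mu>. F x = F' x\<rbrakk> \<Longrightarrow> code F = code F'"
  using code_eq[of F F'] by (auto dest: L2D)

lemma L2_cong: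
  assumes "F \<in> L2" "\<And>x. x \<in> units G \<Longrightarrow> F' x = F x"
  shows "F' \<in> L2"
proof -
  have "(\<lambda>x. coord (F' x) n) \<in> borel_measurable \<mu>" for n
    using secD(2)[OF L2D(1)[OF assms(1)], of n] assms(2) by (subst measurable_cong[of _ _ "\<lambda>x. coord (F x) n"]) auto
  moreover have "integrable \<mu> (\<lambda>x. (norm (F' x))\<^sup>2)"
    using L2D(2)[OF assms(1)] assms(2) by (subst Bochner_Integration.integrable_cong[of _ _ _ "\<lambda>x. (norm (F x))\<^sup>2"]) auto
  ultimately show ?thesis using assms by (auto simp: L2_def sec_def)
qed

lemma code_cong: "\<lbrakk>F \<in> L2; \<And>x. x \<in> units G \<Longrightarrow> F' x = F x\<rbrakk> \<Longrightarrow> code F' = code F"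
  by (rule code_cong_AE) (auto intro: L2_cong AE_I2)

lemma Hs_add: "\<lbrakk>F \<in> L2; F' \<in> L2\<rbrakk> \<Longrightarrow> code F \<oplus>\<^bsub>Hs\<^esub> code F' = code (\<lambda>x. F x + F' x)"
proof -
  assume F: "F \<in> L2" "F' \<in> L2"
  have "AE x in \<mu>. rep (code F) x + rep (code F') x = F x + F' x"
    using rep_code[OF F(1)] rep_code[OF F(2)] by eventually_elim simp
  then show ?thesis using F by (simp add: Hs_def) (rule code_cong_AE, auto intro: L2_add rep(1) code_closed)
qed

lemma Hs_smult: "F \<in> L2 \<Longrightarrow> a \<odot>\<^bsub>Hs\<^esub> code F = code (\<lambda>x. cscale a (F x))"
proof -
  assume F: "F \<in> L2"
  have "AE x in \<mu>. cscale a (rep (code F) x) = cscale a (F x)"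
    using rep_code[OF F] by eventually_elim simp
  then show ?thesis using F by (simp add: Hs_def) (rule code_cong_AE, auto intro: L2_scale rep(1) code_closed)
qed

lemma Hs_inner: "\<lbrakk>F \<in> L2; F' \<in> L2\<rbrakk> \<Longrightarrow> inner_prod Hs (code F) (code F') = (\<integral>x. cinner (F x) (F' x) \<partial>\<mu>)"
proof -
  assume F: "F \<in> L2" "F' \<in> L2"
  have 1: "AE x in \<mu>. cinner (rep (code F) x) (rep (code F') x) = cinner (F x) (F' x)"
    using rep_code[OF F(1)] rep_code[OF F(2)] by eventually_elim simp
  have 2: "(\<lambda>x. cinner (rep (code F) x) (rep (code F') x)) \<in> borel_measurable \<mu>"
    "(\<lambda>x. cinner (F x) (F' x)) \<in> borel_measurable \<mu>"
    using F rep(1)[OF code_closed] by (auto intro!: sec_cinner dest: L2D)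
  have "inner_prod Hs (code F) (code F') = (\<integral>x. cinner (rep (code F) x) (rep (code F') x) \<partial>\<mu>)"
    by (simp add: Hs_def)
  also have "\<dots> = (\<integral>x. cinner (F x) (F' x) \<partial>\<mu>)" by (rule integral_cong_AE[OF 2 1])
  finally show ?thesis .
qed

lemma Hs_zero: "\<zero>\<^bsub>Hs\<^esub> = code (\<lambda>_. 0)"
  by (simp add: Hs_def)

lemma carrierE:
  assumes "u \<in> carrier Hs"
  obtains F where "F \<in> L2" "u = code F"
  using assms by (auto simp: carrier_Hs)

lemma Hs_module: "module complex_ring Hs"
proof (rule moduleI[OF complex_cring])
  show "abelian_group Hs"
  proof (rule abelian_groupI)
    show "\<zero>\<^bsub>Hs\<^esub> \<in> carrier Hs" by (simp add: Hs_zero code_closed L2_zero)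
    fix u assume "u \<in> carrier Hs"
    then obtain F where F: "F \<in> L2" "u = code F" by (rule carrierE)
    show "\<zero>\<^bsub>Hs\<^esub> \<oplus>\<^bsub>Hs\<^esub> u = u" using F by (simp add: Hs_zero Hs_add L2_zero)
    have "(\<lambda>x. cscale (-1) (F x)) \<in> L2" using F by (intro L2_scale)
    moreover have "cscale (-1) v + v = 0" for v by (rule ell2_eqI) simp
    ultimately show "\<exists>v\<in>carrier Hs. v \<oplus>\<^bsub>Hs\<^esub> u = \<zero>\<^bsub>Hs\<^esub>"
      using F by (intro bexI[of _ "code (\<lambda>x. cscale (-1) (F x))"]) (simp_all add: Hs_zero Hs_add code_closed)
    fix v assume "v \<in> carrier Hs"
    then obtain F' where F': "F' \<in> L2" "v = code F'" by (rule carrierE)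
    show "u \<oplus>\<^bsub>Hs\<^esub> v \<in> carrier Hs" using F F' by (simp add: Hs_add code_closed L2_add)
    show "u \<oplus>\<^bsub>Hs\<^esub> v = v \<oplus>\<^bsub>Hs\<^esub> u" using F F' by (simp add: Hs_add add.commute)
    fix w assume "w \<in> carrier Hs"
    then obtain F'' where F'': "F'' \<in> L2" "w = code F''" by (rule carrierE)
    show "u \<oplus>\<^bsub>Hs\<^esub> v \<oplus>\<^bsub>Hs\<^esub> w = u \<oplus>\<^bsub>Hs\<^esub> (v \<oplus>\<^bsub>Hs\<^esub> w)" using F F' F'' by (simp add: Hs_add L2_add add.assoc)
  qed
  fix a b u v assume "u \<in> carrier Hs" "v \<in> carrier Hs"
  then obtain F F' where F: "F \<in> L2" "u = code F" and F': "F' \<in> L2" "v = code F'" by (auto elim!: carrierE)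
  show "a \<odot>\<^bsub>Hs\<^esub> u \<in> carrier Hs" using F by (simp add: Hs_smult L2_scale code_closed)
  show "(a \<oplus>\<^bsub>complex_ring\<^esub> b) \<odot>\<^bsub>Hs\<^esub> u = a \<odot>\<^bsub>Hs\<^esub> u \<oplus>\<^bsub>Hs\<^esub> b \<odot>\<^bsub>Hs\<^esub> u"
    using F by (simp add: Hs_smult Hs_add L2_scale cscale_algebra complex_ring_def)
  show "a \<odot>\<^bsub>Hs\<^esub> (u \<oplus>\<^bsub>Hs\<^esub> v) = a \<odot>\<^bsub>Hs\<^esub> u \<oplus>\<^bsub>Hs\<^esub> a \<odot>\<^bsub>Hs\<^esub> v"
    using F F' by (simp add: Hs_smult Hs_add L2_scale L2_add cscale_algebra)
  show "(a \<otimes>\<^bsub>complex_ring\<^esub> b) \<odot>\<^bsub>Hs\<^esub> u = a \<odot>\<^bsub>Hs\<^esub> (b \<odot>\<^bsub>Hs\<^esub> u)"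
    using F by (simp add: Hs_smult L2_scale cscale_algebra complex_ring_def)
  show "\<one>\<^bsub>complex_ring\<^esub> \<odot>\<^bsub>Hs\<^esub> u = u"
    using F by (simp add: Hs_smult cscale_algebra complex_ring_def)
qed

lemma Hs_minus:
  assumes F: "F \<in> L2" "F' \<in> L2"
  shows "code F \<ominus>\<^bsub>Hs\<^esub> code F' = code (\<lambda>x. F x - F' x)"
proof -
  interpret module complex_ring Hs by (rule Hs_module)
  note c = code_closed[OF F(1)] code_closed[OF F(2)] code_closed[OF L2_diff[OF F]]
  have "code (\<lambda>x. F x - F' x) \<oplus>\<^bsub>Hs\<^esub> code F' = code F" using F by (simp add: Hs_add L2_diff)
  then have "code F \<ominus>\<^bsub>Hs\<^esub> code F' = (code (\<lambda>x. F x - F' x) \<oplus>\<^bsub>Hs\<^esub> code F') \<oplus>\<^bsub>Hs\<^esub> (\<ominus>\<^bsub>Hs\<^esub> code F')"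
    by (simp add: M.minus_eq)
  also have "\<dots> = code (\<lambda>x. F x - F' x)" using c by (simp add: M.a_assoc M.r_neg)
  finally show ?thesis .
qed

lemma Hs_inner_self: "F \<in> L2 \<Longrightarrow> inner_prod Hs (code F) (code F) = complex_of_real (\<integral>x. (norm (F x))\<^sup>2 \<partial>\<mu>)"
  by (simp add: Hs_inner cinner_norm del: of_real_power)

lemma Hs_norm: "F \<in> L2 \<Longrightarrow> hnorm Hs (code F) = sqrt (\<integral>x. (norm (F x))\<^sup>2 \<partial>\<mu>)"
  by (simp add: hnorm_def Hs_inner_self)

lemma Hs_hilbert: "hilbert_space Hs"
proof (intro hilbert_space.intro Hs_module hilbert_space_axioms.intro)
  fix u v w a assume "u \<in> carrier Hs" "v \<in> carrier Hs"
  then obtain F F' where F: "F \<in> L2" "u = code F" and F': "F' \<in> L2" "v = code F'" by (auto elim!: carrierE)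
  show "inner_prod Hs (a \<odot>\<^bsub>Hs\<^esub> u) v = a * inner_prod Hs u v"
    using F F' by (simp add: Hs_smult Hs_inner L2_scale cinner_scale_left)
  show "inner_prod Hs v u = cnj (inner_prod Hs u v)"
    unfolding F F' Hs_inner[OF F(1) F'(1)] Hs_inner[OF F'(1) F(1)] Bochner_Integration.integral_cnj[symmetric]
    unfolding cinner_commute[symmetric] ..
  assume "w \<in> carrier Hs"
  then obtain F'' where F'': "F'' \<in> L2" "w = code F''" by (rule carrierE)
  show "inner_prod Hs (u \<oplus>\<^bsub>Hs\<^esub> v) w = inner_prod Hs u w + inner_prod Hs v w"
    using F F' F'' by (simp add: Hs_add Hs_inner L2_add cinner_add_left L2_cinner)
next
  fix u assume "u \<in> carrier Hs"
  then obtain F where F: "F \<in> L2" "u = code F" by (rule carrierE)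
  show "0 \<le> Re (inner_prod Hs u u)" using F by (simp add: Hs_inner_self)
  assume "inner_prod Hs u u = 0"
  then have "complex_of_real (\<integral>x. (norm (F x))\<^sup>2 \<partial>\<mu>) = 0" using F by (simp only: Hs_inner_self)
  then have "(\<integral>x. (norm (F x))\<^sup>2 \<partial>\<mu>) = 0" by simp
  then have "AE x in \<mu>. (norm (F x))\<^sup>2 = 0"
    using integral_nonneg_eq_0_iff_AE[OF L2D(2)[OF F(1)]] by simp
  then have "AE x in \<mu>. F x = 0" by simp
  then show "u = \<zero>\<^bsub>Hs\<^esub>" unfolding F Hs_zero by (intro code_cong_AE F L2_zero)
next
  fix X :: "nat \<Rightarrow> 'h"
  assume X: "\<And>n. X n \<in> carrier Hs"
    and Cauchy: "\<And>e. e > 0 \<Longrightarrow> \<exists>N. \<forall>m\<ge>N. \<forall>n\<ge>N. hnorm Hs (X m \<ominus>\<^bsub>Hs\<^esub> X n) < e"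
  define F where "F n = rep (X n)" for n
  have F: "F n \<in> L2" "X n = code (F n)" for n using rep[OF X] by (simp_all add: F_def)
  have "\<exists>N. \<forall>m\<ge>N. \<forall>n\<ge>N. (\<integral>\<^sup>+x. ennreal ((norm (F m x - F n x))\<^sup>2) \<partial>\<mu>) \<le> ennreal e" if "e > 0" for e
  proof -
    obtain N where N: "\<forall>m\<ge>N. \<forall>n\<ge>N. hnorm Hs (X m \<ominus>\<^bsub>Hs\<^esub> X n) < sqrt e" using Cauchy[of "sqrt e"] \<open>e > 0\<close> by auto
    have "(\<integral>\<^sup>+x. ennreal ((norm (F m x - F n x))\<^sup>2) \<partial>\<mu>) \<le> ennreal e" if "N \<le> m" "N \<le> n" for m n
    proof -
      have "sqrt (\<integral>x. (norm (F m x - F n x))\<^sup>2 \<partial>\<mu>) < sqrt e"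
        using N that by (simp add: F Hs_minus Hs_norm L2_diff)
      then show ?thesis unfolding L2_nn[OF L2_diff[OF F(1) F(1)]] by (intro ennreal_leI) simp
    qed
    then show ?thesis by blast
  qed
  then obtain L where L: "L \<in> L2" "\<forall>e>0. \<exists>N. \<forall>n\<ge>N. (\<integral>\<^sup>+x. ennreal ((norm (F n x - L x))\<^sup>2) \<partial>\<mu>) \<le> ennreal e"
    using L2_complete[of F] F(1) by blast
  have "(\<lambda>n. hnorm Hs (X n \<ominus>\<^bsub>Hs\<^esub> code L)) \<longlonglongrightarrow> 0"
  proof (rule LIMSEQ_I)
    fix e :: real assume "e > 0"
    then obtain N where N: "\<forall>n\<ge>N. (\<integral>\<^sup>+x. ennreal ((norm (F n x - L x))\<^sup>2) \<partial>\<mu>) \<le> ennreal ((e/2)\<^sup>2)"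
      using L(2)[rule_format, of "(e/2)\<^sup>2"] by auto
    have "norm (hnorm Hs (X n \<ominus>\<^bsub>Hs\<^esub> code L) - 0) < e" if "N \<le> n" for n
    proof -
      have "(\<integral>x. (norm (F n x - L x))\<^sup>2 \<partial>\<mu>) \<le> (e/2)\<^sup>2"
        using N[rule_format, OF that] unfolding L2_nn[OF L2_diff[OF F(1) L(1)]] by (subst (asm) ennreal_le_iff) simp_all
      then have "sqrt (\<integral>x. (norm (F n x - L x))\<^sup>2 \<partial>\<mu>) \<le> e/2" using \<open>e > 0\<close> by (intro real_le_lsqrt) simp_all
      then show ?thesis using \<open>e > 0\<close> by (simp add: F Hs_minus Hs_norm L2_diff L)
    qed
    then show "\<exists>N. \<forall>n\<ge>N. norm (hnorm Hs (X n \<ominus>\<^bsub>Hs\<^esub> code L) - 0) < e" by blast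
  qed
  then show "\<exists>l\<in>carrier Hs. (\<lambda>n. hnorm Hs (X n \<ominus>\<^bsub>Hs\<^esub> l)) \<longlonglongrightarrow> 0" using L(1) code_closed by blast
qed

definition op :: "('g \<Rightarrow> complex) \<Rightarrow> 'h \<Rightarrow> 'h" where
  "op f u = code (T f (rep u))"

lemma op_code:
  assumes "f \<in> borel_measurable borel" "\<And>x. finite {g. r g = x \<and> f g \<noteq> 0}" "F \<in> L2"
  shows "op f (code F) = code (T f F)"
proof -
  have "rep (code F) \<in> sec" "F \<in> sec" using rep(1)[OF code_closed[OF assms(3)]] assms(3) by (auto dest: L2D)
  then have "code (T f (rep (code F))) = code (T f F) \<longleftrightarrow> (AE x in \<mu>. T f (rep (code F)) x = T f F x)"
    by (intro code_eq T_sec assms(1,2))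
  then show ?thesis unfolding op_def using T_cong_AE[OF rep_code[OF assms(3)]] by blast
qed

lemma op_Cc: "f \<in> Cc \<Longrightarrow> F \<in> L2 \<Longrightarrow> op f (code F) = code (T f F)"
  by (intro op_code Cc_borel Cc_finite)

lemma op_bounded:
  assumes f: "f \<in> Cc"
  shows "bounded_operator Hs (op f)"
  unfolding bounded_operator_def linear_map_def
proof (intro conjI ballI allI)
  show "op f \<in> carrier Hs \<rightarrow> carrier Hs"
    by (auto elim!: carrierE simp: op_Cc f T_L2 code_closed)
  fix u v a assume u: "u \<in> carrier Hs"
  then obtain F where F: "F \<in> L2" "u = code F" by (rule carrierE)
  have "T f (\<lambda>x. cscale a (F x)) = (\<lambda>x. cscale a (T f F x))" by (intro ext T_scale_section L2D(1) F)
  then show "op f (a \<odot>\<^bsub>Hs\<^esub> u) = a \<odot>\<^bsub>Hs\<^esub> op f u"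
    using F f by (simp add: Hs_smult op_Cc T_L2 L2_scale)
  assume "v \<in> carrier Hs"
  then obtain F' where F': "F' \<in> L2" "v = code F'" by (rule carrierE)
  have "T f (\<lambda>x. F x + F' x) = (\<lambda>x. T f F x + T f F' x)" by (intro ext T_add_section L2D(1) F F')
  then show "op f (u \<oplus>\<^bsub>Hs\<^esub> v) = op f u \<oplus>\<^bsub>Hs\<^esub> op f v"
    using F F' f by (simp add: Hs_add op_Cc T_L2 L2_add)
next
  obtain C where C: "0 \<le> C" "\<And>F. F \<in> sec \<Longrightarrow>
    (\<integral>\<^sup>+x. ennreal ((norm (T f F x))\<^sup>2) \<partial>\<mu>) \<le> ennreal C * (\<integral>\<^sup>+x. ennreal ((norm (F x))\<^sup>2) \<partial>\<mu>)"
    using T_bounded[OF f] by blast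
  show "\<exists>C. \<forall>u\<in>carrier Hs. hnorm Hs (op f u) \<le> C * hnorm Hs u"
  proof (intro exI[of _ "sqrt C"] ballI)
    fix u assume "u \<in> carrier Hs"
    then obtain F where F: "F \<in> L2" "u = code F" by (rule carrierE)
    have "ennreal (\<integral>x. (norm (T f F x))\<^sup>2 \<partial>\<mu>) \<le> ennreal (C * (\<integral>x. (norm (F x))\<^sup>2 \<partial>\<mu>))"
      using C(2)[OF L2D(1)[OF F(1)]] C(1) unfolding L2_nn[OF F(1)] L2_nn[OF T_L2[OF f F(1)]]
      by (simp add: ennreal_mult)
    then have "(\<integral>x. (norm (T f F x))\<^sup>2 \<partial>\<mu>) \<le> C * (\<integral>x. (norm (F x))\<^sup>2 \<partial>\<mu>)"
      using C(1) by (subst (asm) ennreal_le_iff) simp_all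
    then show "hnorm Hs (op f u) \<le> sqrt C * hnorm Hs u"
      using F f by (simp add: op_Cc Hs_norm T_L2 real_sqrt_mult[symmetric])
  qed
qed

lemma op_add:
  assumes f: "f \<in> Cc" and f': "f' \<in> Cc" and u: "u \<in> carrier Hs"
  shows "op (\<lambda>g. f g + f' g) u = op f u \<oplus>\<^bsub>Hs\<^esub> op f' u"
proof -
  have "T (\<lambda>g. f g + f' g) (rep u) = (\<lambda>x. T f (rep u) x + T f' (rep u) x)"
    by (intro ext T_add_function Cc_finite f f')
  then show ?thesis unfolding op_def by (simp only: Hs_add[OF T_L2[OF f rep(1)[OF u]] T_L2[OF f' rep(1)[OF u]]])
qed

lemma op_scale:
  assumes f: "f \<in> Cc" and u: "u \<in> carrier Hs"
  shows "op (\<lambda>g. a * f g) u = a \<odot>\<^bsub>Hs\<^esub> op f u"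
proof -
  have "T (\<lambda>g. a * f g) (rep u) = (\<lambda>x. cscale a (T f (rep u) x))"
    by (intro ext T_scale_function)
  then show ?thesis unfolding op_def by (simp only: Hs_smult[OF T_L2[OF f rep(1)[OF u]]])
qed

lemma op_conv:
  assumes f: "f \<in> Cc" and f': "f' \<in> Cc" and u: "u \<in> carrier Hs"
  shows "op (conv G f f') u = op f (op f' u)"
proof -
  have "T (conv G f f') (rep u) = T f (T f' (rep u))"
    by (intro ext T_conv Cc_finite f f' L2D(1) rep(1) u)
  then show ?thesis unfolding op_def[of "conv G f f'"] op_def[of f']
    by (simp only: op_Cc[OF f T_L2[OF f' rep(1)[OF u]]])
qed

lemma op_adj:
  assumes f: "f \<in> Cc" and u: "u \<in> carrier Hs" and v: "v \<in> carrier Hs"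
  shows "inner_prod Hs (op (adj G f) u) v = inner_prod Hs u (op f v)"
proof -
  obtain F F' where F: "F \<in> L2" "u = code F" and F': "F' \<in> L2" "v = code F'"
    using u v by (auto elim!: carrierE)
  show ?thesis
    using F F' f by (simp add: op_Cc Cc_adj Hs_inner T_L2 T_adjoint)
qed

lemma op_one:
  assumes u: "u \<in> carrier Hs"
  shows "op (conv_one G) u = u"
proof -
  obtain F where F: "F \<in> L2" "u = code F" using u by (rule carrierE)
  have "finite {g. r g = x \<and> conv_one G g \<noteq> 0}" for x
    by (rule finite_subset[of _ "{x}"]) (auto simp: conv_one_def split: if_splits)
  moreover have "conv_one G \<in> borel_measurable borel"
    unfolding conv_one_def by measurable
  ultimately have "op (conv_one G) u = code (T (conv_one G) F)" using F by (simp add: op_code)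
  also have "\<dots> = code F" using F by (intro code_cong) (simp_all add: T_conv_one L2D(1))
  finally show ?thesis using F by simp
qed

lemma op_representation: "Cc_representation G Hs op"
  unfolding Cc_representation_def
  by (intro conjI ballI allI Hs_hilbert op_bounded op_add op_scale op_conv op_adj op_one)

section \<open>The action of \<open>Psi G f\<close>\<close>

lemma fibre_sum_bounded:
  assumes f: "f \<in> Cc"
  obtains C where "\<And>x. (\<Sum>g | r g = x \<and> f g \<noteq> 0. cmod (f g)) \<le> C"
proof -
  let ?A = "closure {g. f g \<noteq> 0}"
  obtain B where B: "\<And>g. cmod (f g) \<le> B" using Cc_bound[OF f] by blast
  have B0: "0 \<le> B" using B norm_ge_zero order_trans by blast
  obtain N where N: "\<And>x. finite {g \<in> ?A. r g = x}" "\<And>x. card {g \<in> ?A. r g = x} \<le> N"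
    using compact_fibre_bound[OF Cc_support(2)[OF f]] by metis
  have "(\<Sum>g | r g = x \<and> f g \<noteq> 0. cmod (f g)) \<le> real N * B" for x
  proof -
    have sub: "{g. r g = x \<and> f g \<noteq> 0} \<subseteq> {g \<in> ?A. r g = x}" using closure_subset[of "{g. f g \<noteq> 0}"] by blast
    have "(\<Sum>g | r g = x \<and> f g \<noteq> 0. cmod (f g)) \<le> real (card {g. r g = x \<and> f g \<noteq> 0}) * B"
      using sum_bounded_above[of "{g. r g = x \<and> f g \<noteq> 0}" "\<lambda>g. cmod (f g)" B] B by simp
    also have "\<dots> \<le> real N * B"
      using card_mono[OF N(1) sub] N(2)[of x] B0 by (intro mult_right_mono) simp_all
    finally show ?thesis .
  qed
  then show thesis by (rule that)
qed

text \<open>\<open>Psi G f\<close> lives on the units, so its operator is multiplication by the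
  bounded measurable function \<open>fibre_sum f\<close>.\<close>

lemma T_Psi_L2:
  assumes f: "f \<in> Cc" and F: "F \<in> L2"
  shows "T (Psi G f) F \<in> L2" "code (T (Psi G f) F) = code (\<lambda>x. cscale (fibre_sum f x) (F x))"
    "(\<lambda>x. cscale (fibre_sum f x) (F x)) \<in> L2" "op (Psi G f) (code F) = code (T (Psi G f) F)"
proof -
  obtain C where C: "\<And>x. (\<Sum>g | r g = x \<and> f g \<noteq> 0. cmod (f g)) \<le> C" using fibre_sum_bounded[OF f] by blast
  have C': "cmod (fibre_sum f x) \<le> C" for x
    unfolding fibre_sum_def using norm_sum C[of x] by (rule order_trans)
  have meas: "fibre_sum f \<in> borel_measurable \<mu>"
    by (intro measurable_fibre_sum Cc_borel[OF f f] Cc_finite[OF f f])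
  have L: "(\<lambda>x. cscale (fibre_sum f x) (F x)) \<in> L2" if "F \<in> L2" for F
    by (rule L2_scale_bounded[OF that meas C'])
  have eq: "T (Psi G f) F x = cscale (fibre_sum f x) (F x)" if "x \<in> units G" "F \<in> L2" for x F
    using that by (intro T_Psi Cc_finite[OF f f] L2D(1))
  have TL: "T (Psi G f) F \<in> L2" if "F \<in> L2" for F by (rule L2_cong[OF L[OF that] eq[OF _ that]])
  show "T (Psi G f) F \<in> L2" "(\<lambda>x. cscale (fibre_sum f x) (F x)) \<in> L2" by (rule TL L, rule F)+
  show "code (T (Psi G f) F) = code (\<lambda>x. cscale (fibre_sum f x) (F x))"
    by (rule code_cong[OF L[OF F] eq[OF _ F]])
  show "op (Psi G f) (code F) = code (T (Psi G f) F)"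
    unfolding op_def
    by (rule code_cong_AE[OF TL TL T_cong_AE]) (auto intro: rep(1) code_closed F rep_code)
qed

end

section \<open>Invariant sections from property (T)\<close>

context coded_representation
begin

text \<open>A single term is at most its fibre sum. The suprema in \<open>I_norm\<close> are taken
  in the reals, so a uniform bound on the fibre sums must be supplied before the supremum dominates
  them.\<close>

lemma cmod_le_I_norm:
  assumes f: "f \<in> Cc"
  shows "cmod (f g) \<le> I_norm G f"
proof -
  have fin: "finite {h. r h = x \<and> cmod (f h) \<noteq> 0}" for x using Cc_finite[OF f f] by simp
  have eq: "(\<Sum>\<^sub>\<infinity>h\<in>rng_fibre G x. cmod (f h)) = (\<Sum>h | r h = x \<and> f h \<noteq> 0. cmod (f h))" for x
    using infsum_fibre[OF fin] by (simp add: fibre_sum_def)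
  obtain C where C: "\<And>x. (\<Sum>h | r h = x \<and> f h \<noteq> 0. cmod (f h)) \<le> C" using fibre_sum_bounded[OF f] by blast
  have "cmod (f g) \<le> (\<Sum>h | r h = r g \<and> f h \<noteq> 0. cmod (f h))"
  proof (cases "f g = 0")
    case False
    then show ?thesis using Cc_finite[OF f f, of "r g"] by (intro member_le_sum) auto
  qed (simp add: sum_nonneg)
  also have "\<dots> \<le> (SUP x\<in>units G. \<Sum>\<^sub>\<infinity>h\<in>rng_fibre G x. cmod (f h))"
    unfolding eq using C by (intro cSUP_upper bdd_aboveI2[where M = C]) auto
  also have "\<dots> \<le> I_norm G f" by (simp add: I_norm_def)
  finally show ?thesis .
qed

text \<open>Over \<open>x\<close> the difference is the sum of \<open>f g\<close> times the defect
  \<open>U g (F (s g)) - F (r g)\<close>. The I-norm bounds every \<open>cmod (f g)\<close> by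
  \<open>1\<close>, so the constant \<open>N\<close> depends on \<open>A\<close> and not on
  \<open>f\<close>.\<close>

lemma discrepancy_bound:
  assumes f: "f \<in> Cc" "supp f \<subseteq> A" "I_norm G f \<le> 1" and A: "compact A"
    and N: "\<And>x. finite {g \<in> A. r g = x}" "\<And>x. card {g \<in> A. r g = x} \<le> N" and F: "F \<in> sec"
  shows "(\<integral>\<^sup>+x. ennreal ((norm (T f F x - cscale (fibre_sum f x) (F x)))\<^sup>2) \<partial>\<mu>) \<le>
    of_nat N * (\<integral>\<^sup>+g. indicator A g * ennreal ((norm (U g (F (s g)) - F (r g)))\<^sup>2) \<partial>\<nu>)"
proof -
  have f1: "cmod (f g) \<le> 1" for g using cmod_le_I_norm[OF f(1), of g] f(3) by simp
  have fA: "g \<in> A" if "f g \<noteq> 0" for g using that f(2) closure_subset[of "{g. f g \<noteq> 0}"] by (auto simp: supp_def)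
  have [measurable]: "A \<in> sets borel" using compact_borel[OF A] .
  have [measurable]: "(\<lambda>g. norm (U g (F (s g)) - F (r g))) \<in> borel_measurable borel"
    by (rule measurable_norm_ell2) (simp add: borel_measurable_diff sec_U[OF F] sec_ends[OF F])
  have eq: "T f F x - cscale (fibre_sum f x) (F x) = (\<Sum>g | r g = x \<and> f g \<noteq> 0. cscale (f g) (U g (F (s g)) - F (r g)))" for x
    unfolding T_def fibre_sum_def cscale_sum_left sum_subtractf[symmetric] by (intro sum.cong) (auto simp: cscale_algebra)
  have "(\<integral>\<^sup>+x. ennreal ((norm (T f F x - cscale (fibre_sum f x) (F x)))\<^sup>2) \<partial>\<mu>) \<le>
    (\<integral>\<^sup>+x. ennreal (real N * 1\<^sup>2) * (\<integral>\<^sup>+g. indicator A g * ennreal ((norm (U g (F (s g)) - F (r g)))\<^sup>2) \<partial>count_space {g. r g = x}) \<partial>\<mu>)"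
    unfolding eq by (intro nn_integral_mono fibre_norm_bound N f1 fA)
  also have "\<dots> = of_nat N * (\<integral>\<^sup>+g. indicator A g * ennreal ((norm (U g (F (s g)) - F (r g)))\<^sup>2) \<partial>\<nu>)"
    by (subst nn_integral_nu) (auto simp: nn_integral_cmult ennreal_of_nat_eq_real_of_nat)
  finally show ?thesis .
qed

text \<open>If \<open>f\<close> is supported in a bisection, a fibre sum has at most one term, and
  constancy says that \<open>f g\<close> times the defect at \<open>g\<close> is zero. The
  exceptional null set depends on \<open>f\<close>, so countably many such \<open>f\<close> are
  selected whose nonvanishing sets cover all arrows.\<close>

lemma constant_vector_invariant:
  assumes F: "F \<in> L2" and const: "code F \<in> constant_vectors G Hs op"
  shows "AE g in \<nu>. U g (F (s g)) = F (r g)"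
proof -
  have AE_f: "AE x in \<mu>. T f F x = cscale (fibre_sum f x) (F x)" if f: "f \<in> Cc" for f
  proof -
    have "code (T f F) = code (\<lambda>x. cscale (fibre_sum f x) (F x))"
      using const f T_Psi_L2[OF f F] op_Cc[OF f F] by (simp add: constant_vectors_def)
    then show ?thesis using code_eq[OF L2D(1)[OF T_L2[OF f F]] L2D(1)[OF T_Psi_L2(3)[OF f F]]] by blast
  qed
  obtain V :: "nat \<Rightarrow> 'g set" where V: "\<And>n. open_bisection G (V n)" "(\<Union>n. V n) = UNIV"
    using bisection_cover by metis
  define Z where "Z = {{g. f g \<noteq> 0} | f. f \<in> Cc \<and> (\<exists>n. \<forall>g. f g \<noteq> 0 \<longrightarrow> g \<in> V n)}"
  have openZ: "open W" if "W \<in> Z" for W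
  proof -
    obtain f :: "'g \<Rightarrow> complex" where f: "f \<in> Cc" "W = {g. f g \<noteq> 0}"
      using \<open>W \<in> Z\<close> unfolding Z_def by blast
    have "open (f -` (- {0}))" using Cc_support(1)[OF f(1)] by (intro open_vimage) auto
    then show ?thesis by (simp add: f(2) vimage_def)
  qed
  have "\<exists>W\<in>Z. g \<in> W" for g
  proof -
    obtain n where n: "g \<in> V n" using V(2) by blast
    have "open (V n)" using V(1) by (simp add: open_bisection_def)
    then obtain \<phi> :: "'g \<Rightarrow> real" where \<phi>: "continuous_on UNIV \<phi>" "\<phi> g = 1"
      "\<And>h. h \<notin> V n \<Longrightarrow> \<phi> h = 0" "compact (closure {h. \<phi> h \<noteq> 0})" using bump[OF _ n] by metis
    have "(\<lambda>h. complex_of_real (\<phi> h)) \<in> Cc"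
      using \<phi>(1,4) by (auto simp: Cc_def supp_def intro!: continuous_intros)
    then have "{h. complex_of_real (\<phi> h) \<noteq> 0} \<in> Z"
      unfolding Z_def using \<phi>(3) by (intro CollectI exI[of _ "\<lambda>h. complex_of_real (\<phi> h)"] conjI exI[of _ n]) auto
    moreover have "g \<in> {h. complex_of_real (\<phi> h) \<noteq> 0}" using \<phi>(2) by simp
    ultimately show ?thesis by (rule bexI[rotated])
  qed
  then have "\<Union>Z = UNIV" by blast
  obtain \<F> where \<F>: "\<F> \<subseteq> Z" "countable \<F>" "\<Union>\<F> = \<Union>Z" using Lindelof[OF openZ] by blast
  have "\<forall>W\<in>\<F>. \<exists>f. f \<in> Cc \<and> W = {g. f g \<noteq> 0} \<and> (\<exists>n. \<forall>g. f g \<noteq> 0 \<longrightarrow> g \<in> V n)"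
    using \<F>(1) unfolding Z_def by blast
  from bchoice[OF this] obtain f :: "'g set \<Rightarrow> 'g \<Rightarrow> complex" where
    f: "\<And>W. W \<in> \<F> \<Longrightarrow> f W \<in> Cc" "\<And>W. W \<in> \<F> \<Longrightarrow> W = {g. f W g \<noteq> 0}"
    "\<And>W. W \<in> \<F> \<Longrightarrow> \<exists>n. \<forall>g. f W g \<noteq> 0 \<longrightarrow> g \<in> V n" by blast
  have "AE x in \<mu>. \<forall>W\<in>\<F>. T (f W) F x = cscale (fibre_sum (f W) x) (F x)"
    using AE_f f(1) by (subst AE_ball_countable[OF \<F>(2)]) blast
  then have "AE x in \<mu>. \<forall>g. r g = x \<longrightarrow> U g (F (s g)) = F (r g)"
  proof eventually_elim
    case (elim x)
    show ?case
    proof (intro allI impI)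
      fix g assume g: "r g = x"
      have "g \<in> \<Union>\<F>" using \<F>(3) \<open>\<Union>Z = UNIV\<close> by simp
      then obtain W where W: "W \<in> \<F>" "g \<in> W" by blast
      obtain n where n: "\<forall>h. f W h \<noteq> 0 \<longrightarrow> h \<in> V n" using f(3)[OF W(1)] by blast
      have ne: "f W g \<noteq> 0" using f(2)[OF W(1)] W(2) by blast
      have one: "{h. r h = x \<and> f W h \<noteq> 0} = {g}"
        using n ne g open_bisection_inj[OF V(1)[of n]] by (auto simp: inj_on_def)
      have "cscale (f W g) (U g (F (s g))) = cscale (f W g) (F x)"
        using bspec[OF elim W(1)] unfolding T_def fibre_sum_def one by simp
      then have "cscale (inverse (f W g)) (cscale (f W g) (U g (F (s g)))) = cscale (inverse (f W g)) (cscale (f W g) (F x))"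
        by simp
      then show "U g (F (s g)) = F (r g)" using ne g by (simp add: cscale_algebra)
    qed
  qed
  then show ?thesis by (simp only: AE_nu_iff_fibres)
qed

text \<open>Dominated convergence: for sections of norm at most \<open>1\<close> the squared defect
  is at most \<open>4 = 2^2\<close>, and \<nu> is finite on the compact set
  \<open>A\<close>.\<close>

lemma discrepancy_tendsto_0:
  assumes A: "compact A" and F: "\<And>n. F n \<in> sec" and F1: "\<And>n x. norm (F n x) \<le> 1"
    and lim: "AE g in \<nu>. (\<lambda>n. norm (F n (r g) - U g (F n (s g)))) \<longlonglongrightarrow> 0"
  shows "(\<lambda>n. \<integral>\<^sup>+g. indicator A g * ennreal ((norm (U g (F n (s g)) - F n (r g)))\<^sup>2) \<partial>\<nu>) \<longlonglongrightarrow> 0"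
proof -
  have [measurable]: "A \<in> sets borel" using compact_borel[OF A] .
  have [measurable]: "(\<lambda>g. norm (U g (F n (s g)) - F n (r g))) \<in> borel_measurable borel" for n
    by (rule measurable_norm_ell2) (simp add: borel_measurable_diff sec_U[OF F] sec_ends[OF F])
  have "(\<lambda>n. \<integral>\<^sup>+g. indicator A g * ennreal ((norm (U g (F n (s g)) - F n (r g)))\<^sup>2) \<partial>\<nu>) \<longlonglongrightarrow> (\<integral>\<^sup>+g. 0 \<partial>\<nu>)"
  proof (rule nn_integral_dominated_convergence[where w = "\<lambda>g. indicator A g * ennreal 4"])
    show "(\<lambda>g. indicator A g * ennreal ((norm (U g (F n (s g)) - F n (r g)))\<^sup>2)) \<in> borel_measurable \<nu>" for n
      by measurable
    show "AE g in \<nu>. indicator A g * ennreal ((norm (U g (F n (s g)) - F n (r g)))\<^sup>2) \<le> indicator A g * ennreal 4" for n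
    proof (intro AE_I2 mult_left_mono ennreal_leI)
      fix g
      have "norm (U g (F n (s g)) - F n (r g)) \<le> norm (U g (F n (s g))) + norm (F n (r g))" by (rule norm_triangle_ineq4)
      also have "\<dots> \<le> 2" using F1[of n "s g"] F1[of n "r g"] F[of n] by (simp add: U_norm secD)
      finally have "(norm (U g (F n (s g)) - F n (r g)))\<^sup>2 \<le> 2\<^sup>2" by (intro power_mono) simp_all
      then show "(norm (U g (F n (s g)) - F n (r g)))\<^sup>2 \<le> 4" by simp
    qed simp
    have "(\<integral>\<^sup>+g. indicator A g * ennreal 4 \<partial>\<nu>) = ennreal 4 * emeasure \<nu> A"
      by (subst mult.commute) (simp add: nn_integral_cmult_indicator)
    also have "\<dots> < \<infinity>" using emeasure_nu_compact[OF A] by (simp add: ennreal_mult_less_top)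
    finally show "(\<integral>\<^sup>+g. indicator A g * ennreal 4 \<partial>\<nu>) < \<infinity>" .
    show "AE g in \<nu>. (\<lambda>n. indicator A g * ennreal ((norm (U g (F n (s g)) - F n (r g)))\<^sup>2)) \<longlonglongrightarrow> 0"
      using lim
    proof eventually_elim
      case (elim g)
      have "(\<lambda>n. ennreal ((norm (F n (r g) - U g (F n (s g))))\<^sup>2)) \<longlonglongrightarrow> ennreal (0\<^sup>2)"
        by (intro tendsto_ennrealI tendsto_power elim)
      then show ?case by (cases "g \<in> A") (simp_all add: norm_minus_commute)
    qed
  qed simp_all
  then show ?thesis by simp
qed

lemma exists_invariant:
  assumes T: "topological_property_T TYPE('h) G"
    and F: "\<And>n. F n \<in> sec" and F1: "\<And>n x. norm (F n x) \<le> 1" and AE1: "\<And>n. AE x in \<mu>. norm (F n x) = 1"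
    and lim: "AE g in \<nu>. (\<lambda>n. norm (F n (r g) - U g (F n (s g)))) \<longlonglongrightarrow> 0"
  shows "\<exists>\<eta>\<in>L2. \<not> (AE x in \<mu>. \<eta> x = 0) \<and> (AE g in \<nu>. U g (\<eta> (s g)) = \<eta> (r g))"
proof (cases "constant_vectors G Hs op \<subseteq> {code (\<lambda>_. 0)}")
  case False
  then obtain u where u: "u \<in> constant_vectors G Hs op" "u \<noteq> code (\<lambda>_. 0)" by blast
  then have "u \<in> carrier Hs" by (simp add: constant_vectors_def)
  then obtain \<eta> where \<eta>: "\<eta> \<in> L2" "u = code \<eta>" by (rule carrierE)
  have "\<not> (AE x in \<mu>. \<eta> x = 0)"
    using u(2) code_eq[OF L2D(1)[OF \<eta>(1)] sec_zero] unfolding \<eta>(2) by blast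
  moreover have "AE g in \<nu>. U g (\<eta> (s g)) = \<eta> (r g)"
    using constant_vector_invariant[OF \<eta>(1)] u(1) unfolding \<eta>(2) by blast
  ultimately show ?thesis using \<eta>(1) by blast
next
  case True
  interpret Hs: hilbert_space Hs by (rule Hs_hilbert)
  have FL: "F n \<in> L2" for n
    by (rule L2_dominated[OF F, of "\<lambda>_. 1"]) (use F1 in \<open>auto simp: power_le_one\<close>)
  have norm1: "hnorm Hs (code (F n)) = 1" for n
  proof -
    have "(\<integral>x. (norm (F n x))\<^sup>2 \<partial>\<mu>) = (\<integral>x. 1 \<partial>\<mu>)"
    proof (rule integral_cong_AE)
      show "(\<lambda>x. (norm (F n x))\<^sup>2) \<in> borel_measurable \<mu>" using sec_norm[OF F] by simp
      show "AE x in \<mu>. (norm (F n x))\<^sup>2 = 1" using AE1[of n] by eventually_elim simp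
    qed simp
    then show ?thesis using FL by (simp add: Hs_norm measure_def)
  qed
  \<comment> \<open>With zero as the only constant vector, the orthogonal complement is the whole
    space.\<close>
  have H_pi: "u \<in> H_pi G Hs op" if "u \<in> carrier Hs" for u
    using that True Hs.inner_zero_right[OF that] by (auto simp: H_pi_def Hs_zero)
  \<comment> \<open>Both are chosen before the vector, and \<open>f\<close> only after it. The
    integral of the squared defects over \<open>A\<close> can therefore be made small before
    \<open>f\<close> is known.\<close>
  obtain A c where A: "compact A" and c: "c > 0" and P0: "\<And>u. u \<in> H_pi G Hs op \<Longrightarrow>
      \<exists>f\<in>Cc. supp f \<subseteq> A \<and> I_norm G f \<le> 1 \<and> hnorm Hs (op f u \<ominus>\<^bsub>Hs\<^esub> op (Psi G f) u) \<ge> c * hnorm Hs u"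
    using T op_representation unfolding topological_property_T_def by blast
  obtain N where N: "\<And>x. finite {g \<in> A. r g = x}" "\<And>x. card {g \<in> A. r g = x} \<le> N"
    using compact_fibre_bound[OF A] by metis
  define a where "a n = (\<integral>\<^sup>+g. indicator A g * ennreal ((norm (U g (F n (s g)) - F n (r g)))\<^sup>2) \<partial>\<nu>)" for n
  have "a \<longlonglongrightarrow> 0" unfolding a_def by (rule discrepancy_tendsto_0[OF A F F1 lim])
  \<comment> \<open>Using \<open>N + 1\<close> in place of \<open>N\<close> avoids a division by
    zero and makes \<open>N * (c^2 / (N + 1))\<close> strictly smaller than
    \<open>c^2\<close>.\<close>
  then have "\<forall>\<^sub>F n in sequentially. a n < ennreal (c\<^sup>2 / (real N + 1))"
    by (rule order_tendstoD) (use c in \<open>simp add: ennreal_less_zero_iff\<close>)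
  then obtain n where n: "a n < ennreal (c\<^sup>2 / (real N + 1))" by (auto simp: eventually_sequentially)
  obtain f where f: "f \<in> Cc" "supp f \<subseteq> A" "I_norm G f \<le> 1"
    "hnorm Hs (op f (code (F n)) \<ominus>\<^bsub>Hs\<^esub> op (Psi G f) (code (F n))) \<ge> c * hnorm Hs (code (F n))"
    using P0[OF H_pi[OF code_closed[OF FL[of n]]]] by blast
  let ?D = "\<lambda>x. T f (F n) x - cscale (fibre_sum f x) (F n x)"
  have DL: "?D \<in> L2" by (rule L2_diff[OF T_L2[OF f(1) FL] T_Psi_L2(3)[OF f(1) FL]])
  have "op f (code (F n)) \<ominus>\<^bsub>Hs\<^esub> op (Psi G f) (code (F n)) = code ?D"
    by (simp only: op_Cc[OF f(1) FL] T_Psi_L2(2,4)[OF f(1) FL] Hs_minus[OF T_L2[OF f(1) FL] T_Psi_L2(3)[OF f(1) FL]])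
  then have "c \<le> sqrt (\<integral>x. (norm (?D x))\<^sup>2 \<partial>\<mu>)"
    using f(4) by (simp only: norm1 Hs_norm[OF DL] mult_1_right)
  then have "c\<^sup>2 \<le> (sqrt (\<integral>x. (norm (?D x))\<^sup>2 \<partial>\<mu>))\<^sup>2" using c by (intro power_mono) simp_all
  then have "c\<^sup>2 \<le> (\<integral>x. (norm (?D x))\<^sup>2 \<partial>\<mu>)" by (simp add: integral_nonneg)
  then have "ennreal (c\<^sup>2) \<le> (\<integral>\<^sup>+x. ennreal ((norm (?D x))\<^sup>2) \<partial>\<mu>)"
    unfolding L2_nn[OF DL] by (rule ennreal_leI)
  also have "\<dots> \<le> of_nat N * a n"
    unfolding a_def by (rule discrepancy_bound[OF f(1-3) A N F])
  also have "\<dots> \<le> of_nat N * ennreal (c\<^sup>2 / (real N + 1))" using n by (intro mult_left_mono) simp_all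
  also have "\<dots> = ennreal (real N * (c\<^sup>2 / (real N + 1)))" by (subst ennreal_mult) (simp_all add: ennreal_of_nat_eq_real_of_nat)
  also have "\<dots> < ennreal (c\<^sup>2)"
  proof (rule ennreal_lessI)
    have "real N * c\<^sup>2 < c\<^sup>2 * (real N + 1)" using c by (simp add: algebra_simps)
    then show "real N * (c\<^sup>2 / (real N + 1)) < c\<^sup>2" by (simp add: pos_divide_less_eq)
  qed (use c in simp)
  finally show ?thesis by simp
qed

end

section \<open>Ergodicity\<close>

context ell2_representation
begin

text \<open>The set where \<eta> is nonzero is respected only by almost all arrows, whereas
  \<open>ergodic_measure\<close> speaks of all of them. Its saturation is invariant and not null,
  hence conull; since every \<open>U g\<close> is isometric, \<eta> is nonzero almost everywhere on
  the saturation.\<close>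

lemma ergodic_normalized:
  assumes erg: "ergodic_measure G \<mu>" and \<eta>: "\<eta> \<in> sec" and nz: "\<not> (AE x in \<mu>. \<eta> x = 0)"
    and inv: "AE g in \<nu>. U g (\<eta> (s g)) = \<eta> (r g)"
  shows "\<exists>\<zeta>\<in>sec. (AE x in \<mu>. norm (\<zeta> x) = 1) \<and> (AE g in \<nu>. U g (\<zeta> (s g)) = \<zeta> (r g))"
proof -
  define E0 where "E0 = {x \<in> units G. \<eta> x \<noteq> 0}"
  have "E0 = {x \<in> space \<mu>. norm (\<eta> x) \<noteq> 0}" by (simp add: E0_def)
  also have "\<dots> \<in> sets \<mu>" using sec_norm[OF \<eta>] by measurable
  finally have E0: "E0 \<in> sets \<mu>" .
  have sE0 [measurable]: "s -` E0 \<in> sets borel" using measurable_sets[OF ends_measurable_mu(1) E0] by simp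
  \<comment> \<open>the saturation of \<open>E0\<close>, invariant under all arrows and not merely almost all\<close>
  define S where "S = {x \<in> units G. \<exists>g. r g = x \<and> s g \<in> E0}"
  \<comment> \<open>Membership asks for the existence of an arrow; expressed as nonvanishing of the
    fibre integral of an indicator, it becomes measurable.\<close>
  have "S = {x \<in> space \<mu>. (\<integral>\<^sup>+g. indicator (s -` E0) g \<partial>count_space {g. r g = x}) \<noteq> (0::ennreal)}"
    by (auto simp: S_def nn_integral_0_iff_AE AE_count_space indicator_def)
  also have "\<dots> \<in> sets \<mu>" by measurable
  finally have S: "S \<in> sets \<mu>" .
  have "s g \<in> S \<longleftrightarrow> r g \<in> S" for g
  proof
    assume "s g \<in> S"
    then obtain h where "r h = s g" "s h \<in> E0" by (auto simp: S_def)
    then show "r g \<in> S" unfolding S_def by (intro CollectI conjI exI[of _ "m g h"]) simp_all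
  next
    assume "r g \<in> S"
    then obtain h where "r h = r g" "s h \<in> E0" by (auto simp: S_def)
    then show "s g \<in> S" unfolding S_def by (intro CollectI conjI exI[of _ "m (i g) h"]) simp_all
  qed
  then have "emeasure \<mu> S = 0 \<or> emeasure \<mu> (space \<mu> - S) = 0"
    using erg S unfolding ergodic_measure_def by simp
  moreover have "emeasure \<mu> S \<noteq> 0"
  proof
    assume "emeasure \<mu> S = 0"
    then have "AE x in \<mu>. x \<notin> S" using S by (intro AE_not_in) (simp add: null_sets_def)
    moreover have E0S: "E0 \<subseteq> S"
    proof
      fix x assume x: "x \<in> E0"
      then have "r x = x" "s x = x" by (simp_all add: E0_def)
      then show "x \<in> S" using x unfolding S_def E0_def by (intro CollectI conjI exI[of _ x]) simp_all
    qed
    ultimately have "AE x in \<mu>. \<eta> x = 0"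
      using AE_space[of \<mu>] by (elim AE_mp) (auto simp: E0_def intro!: AE_I2)
    then show False using nz by blast
  qed
  ultimately have "space \<mu> - S \<in> null_sets \<mu>" using sets.compl_sets[OF S] by (intro null_setsI) blast+
  from AE_not_in[OF this] have AE_S: "AE x in \<mu>. x \<in> S" using AE_space[of \<mu>] by eventually_elim simp
  have AE_inv: "AE x in \<mu>. \<forall>g. r g = x \<longrightarrow> U g (\<eta> (s g)) = \<eta> (r g)"
    using inv by (simp only: AE_nu_iff_fibres)
  have AE_ne: "AE x in \<mu>. \<eta> x \<noteq> 0"
    using AE_S AE_inv
  proof eventually_elim
    case (elim x)
    then obtain g where g: "r g = x" "s g \<in> E0" by (auto simp: S_def)
    then have "norm (\<eta> x) = norm (\<eta> (s g))" using elim(2) U_norm[OF secD(1)[OF \<eta>], of g] by auto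
    then show ?case using g(2) by (auto simp: E0_def)
  qed
  \<comment> \<open>With \<open>inverse 0 = 0\<close> the formula makes sense at every unit and
    gives \<open>0\<close> on the null set where \<eta> vanishes.\<close>
  define \<zeta> where "\<zeta> x = cscale (complex_of_real (inverse (norm (\<eta> x)))) (\<eta> x)" for x
  have "(\<lambda>x. complex_of_real (inverse (norm (\<eta> x)))) \<in> borel_measurable \<mu>"
    by (rule measurable_compose[OF sec_norm[OF \<eta>], of "\<lambda>t. complex_of_real (inverse t)"]) measurable
  then have "\<zeta> \<in> sec" unfolding \<zeta>_def by (intro sec_scale \<eta>)
  moreover have "AE x in \<mu>. norm (\<zeta> x) = 1" using AE_ne by eventually_elim (simp add: \<zeta>_def norm_inverse)
  moreover have "AE g in \<nu>. U g (\<zeta> (s g)) = \<zeta> (r g)"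
    using inv
  proof eventually_elim
    case (elim g)
    have c: "\<eta> (s g) \<in> K (s g)" using \<eta> by (simp add: secD)
    then have "norm (\<eta> (r g)) = norm (\<eta> (s g))" using elim U_norm[OF c] by simp
    then show ?case using elim c by (simp add: \<zeta>_def U_scale)
  qed
  ultimately show ?thesis by blast
qed

end

section \<open>Fibre coordinates of a Hilbert bundle\<close>

locale bundle_representation = invariant_space G \<mu>
  for G :: "'g::{second_countable_topology, t2_space} groupoid" and \<mu> :: "'g measure" +
  fixes E :: "('g, 'v) hbundle" and \<pi> :: "'g \<Rightarrow> 'g \<times> ('v \<Rightarrow> 'v) \<times> 'g"
  assumes representation: "groupoid_representation G E \<pi>"
begin

abbreviation "H x \<equiv> fib E x"
abbreviation "V \<equiv> rep_op \<pi>"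
definition "fd x = (\<lambda>n. fund E n x)"
definition "J x = gs_embed (H x) (fd x)"
definition "K x = J x ` carrier (H x)"
definition "J_inv x v = inv_into (carrier (H x)) (J x) v"
definition "U g v = J (r g) (V g (J_inv (s g) v))"

lemma hilb: "hilbert_bundle (unit_borel G) E" and hom: "groupoid_hom G (iso_groupoid (unit_borel G) E) \<pi>"
  and \<pi>_measurable: "\<pi> \<in> measurable borel (iso_borel (unit_borel G) E)"
  and \<pi>_unit: "x \<in> units G \<Longrightarrow> \<pi> x = (x, unitary_id (H x), x)"
  using representation by (auto simp: groupoid_representation_def)

lemma separating: "x \<in> units G \<Longrightarrow> separating_sequence (H x) (fd x)"
  using hilb unfolding hilbert_bundle_def separating_sequence_def separating_sequence_axioms_def fd_def
  by simp

text \<open>\<open>groupoid_hom\<close> speaks only of composable pairs. Applied to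
  \<open>(g, s g)\<close> and \<open>(r g, g)\<close>, and because units go to the corresponding
  unit arrows, it determines both ends of \<open>\<pi> g\<close>.\<close>

lemma \<pi>_eq: "\<pi> g = (r g, V g, s g)" and V_unitary: "V g \<in> unitaries (H (s g)) (H (r g))"
proof -
  let ?I = "iso_groupoid (unit_borel G) E"
  have "\<pi> g \<in> arr ?I" using hom by (auto simp: groupoid_hom_def)
  then obtain a W b where g: "\<pi> g = (a, W, b)" "W \<in> unitaries (H b) (H a)"
    by (auto simp: iso_groupoid_def)
  have "src ?I (\<pi> g) = rng ?I (\<pi> (s g))" using hom unfolding groupoid_hom_def by simp
  then have "b = s g" by (simp add: g \<pi>_unit iso_groupoid_def)
  moreover have "src ?I (\<pi> (r g)) = rng ?I (\<pi> g)" using hom unfolding groupoid_hom_def by simp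
  then have "a = r g" by (simp add: g \<pi>_unit iso_groupoid_def)
  ultimately show "\<pi> g = (r g, V g, s g)" "V g \<in> unitaries (H (s g)) (H (r g))"
    using g by (simp_all add: rep_op_def)
qed

lemma V_closed: "v \<in> carrier (H (s g)) \<Longrightarrow> V g v \<in> carrier (H (r g))"
  and V_add: "\<lbrakk>v \<in> carrier (H (s g)); w \<in> carrier (H (s g))\<rbrakk> \<Longrightarrow> V g (v \<oplus>\<^bsub>H (s g)\<^esub> w) = V g v \<oplus>\<^bsub>H (r g)\<^esub> V g w"
  and V_scale: "v \<in> carrier (H (s g)) \<Longrightarrow> V g (a \<odot>\<^bsub>H (s g)\<^esub> v) = a \<odot>\<^bsub>H (r g)\<^esub> V g v"
  and V_inner: "\<lbrakk>v \<in> carrier (H (s g)); w \<in> carrier (H (s g))\<rbrakk> \<Longrightarrow>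
    inner_prod (H (r g)) (V g v) (V g w) = inner_prod (H (s g)) v w"
  using V_unitary[of g] by (auto simp: unitaries_def linear_map_def)

lemma V_mult:
  assumes "s g = r h" "v \<in> carrier (H (s h))"
  shows "V (m g h) v = V g (V h v)"
proof -
  have "\<pi> (m g h) = gmult (iso_groupoid (unit_borel G) E) (\<pi> g) (\<pi> h)"
    using hom assms(1) unfolding groupoid_hom_def by simp
  then have "V (m g h) = compose (carrier (H (s h))) (V g) (V h)"
    unfolding \<pi>_eq[of g] \<pi>_eq[of h] by (simp add: iso_groupoid_def rep_op_def)
  then show ?thesis using assms(2) by (simp add: compose_eq)
qed

lemma V_unit: "x \<in> units G \<Longrightarrow> v \<in> carrier (H x) \<Longrightarrow> V x v = v"
  by (simp add: rep_op_def \<pi>_unit unitary_id_def)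

lemma V_inv: "v \<in> carrier (H (s g)) \<Longrightarrow> V (i g) (V g v) = v"
  using V_mult[of "i g" g v] V_unit[of "s g" v] by simp

lemma V_adjoint:
  assumes "v \<in> carrier (H (s g))" "w \<in> carrier (H (r g))"
  shows "inner_prod (H (r g)) w (V g v) = inner_prod (H (s g)) (V (i g) w) v"
  using V_inner[of w "i g" "V g v"] V_inv[of v g] V_closed[of v g] assms by simp

text \<open>An interpretation of \<open>separating_sequence\<close> fixes the base point, while
  later statements let it vary with the arrow; the facts are therefore collected with
  \<open>x\<close> as a parameter and cited by number.\<close>

lemma fibre_embedding:
  assumes x: "x \<in> units G"
  shows "\<lbrakk>v \<in> carrier (H x); w \<in> carrier (H x)\<rbrakk> \<Longrightarrow> J x (v \<oplus>\<^bsub>H x\<^esub> w) = J x v + J x w"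
    "v \<in> carrier (H x) \<Longrightarrow> J x (a \<odot>\<^bsub>H x\<^esub> v) = cscale a (J x v)"
    "\<lbrakk>v \<in> carrier (H x); w \<in> carrier (H x)\<rbrakk> \<Longrightarrow> cinner (J x v) (J x w) = inner_prod (H x) v w"
    "\<lbrakk>v \<in> carrier (H x); w \<in> carrier (H x); J x v = J x w\<rbrakk> \<Longrightarrow> v = w"
    "v \<in> carrier (H x) \<Longrightarrow> norm (J x v) = hnorm (H x) v"
    "v \<in> carrier (H x) \<Longrightarrow> coord (J x v) n = gs_coeff (H x) (fd x) n v"
    "\<lbrakk>v \<in> carrier (H x); w \<in> carrier (H x)\<rbrakk> \<Longrightarrow> J x (v \<ominus>\<^bsub>H x\<^esub> w) = J x v - J x w"
    "\<lbrakk>\<And>n. X n \<in> K x; X \<longlonglongrightarrow> l\<rbrakk> \<Longrightarrow> l \<in> K x"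
    "fund E n x \<in> carrier (H x)" "\<zero>\<^bsub>H x\<^esub> \<in> carrier (H x)" "J x \<zero>\<^bsub>H x\<^esub> = 0"
    "\<lbrakk>v \<in> carrier (H x); w \<in> carrier (H x)\<rbrakk> \<Longrightarrow> v \<oplus>\<^bsub>H x\<^esub> w \<in> carrier (H x)"
    "v \<in> carrier (H x) \<Longrightarrow> a \<odot>\<^bsub>H x\<^esub> v \<in> carrier (H x)"
    "\<lbrakk>v \<in> carrier (H x); w \<in> carrier (H x)\<rbrakk> \<Longrightarrow> inner_prod (H x) w v = cnj (inner_prod (H x) v w)"
proof -
  interpret S: separating_sequence "H x" "fd x" using separating[OF x] .
  show "J x (v \<oplus>\<^bsub>H x\<^esub> w) = J x v + J x w" if "v \<in> carrier (H x)" "w \<in> carrier (H x)"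
    unfolding J_def by (rule S.embed_add[OF that])
  show "J x (a \<odot>\<^bsub>H x\<^esub> v) = cscale a (J x v)" if "v \<in> carrier (H x)"
    unfolding J_def by (rule S.embed_scale[OF that])
  show "cinner (J x v) (J x w) = inner_prod (H x) v w" if "v \<in> carrier (H x)" "w \<in> carrier (H x)"
    unfolding J_def by (rule S.cinner_embed[OF that])
  show "v = w" if "v \<in> carrier (H x)" "w \<in> carrier (H x)" "J x v = J x w"
    using that unfolding J_def by (rule S.embed_inj)
  show "norm (J x v) = hnorm (H x) v" if "v \<in> carrier (H x)"
    unfolding J_def by (rule S.norm_embed[OF that])
  show "coord (J x v) n = gs_coeff (H x) (fd x) n v" if "v \<in> carrier (H x)"
    unfolding J_def by (rule S.coord_embed[OF that])
  show "J x (v \<ominus>\<^bsub>H x\<^esub> w) = J x v - J x w" if "v \<in> carrier (H x)" "w \<in> carrier (H x)"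
    unfolding J_def by (rule S.embed_diff[OF that])
  show "\<lbrakk>\<And>n. X n \<in> K x; X \<longlonglongrightarrow> l\<rbrakk> \<Longrightarrow> l \<in> K x"
    unfolding K_def J_def by (rule S.embed_closed_image)
  show "fund E n x \<in> carrier (H x)" using S.seq_closed[of n] by (simp add: fd_def)
  show "\<zero>\<^bsub>H x\<^esub> \<in> carrier (H x)" "J x \<zero>\<^bsub>H x\<^esub> = 0" by (simp_all add: J_def S.embed_zero)
  show "\<lbrakk>v \<in> carrier (H x); w \<in> carrier (H x)\<rbrakk> \<Longrightarrow> v \<oplus>\<^bsub>H x\<^esub> w \<in> carrier (H x)"
    "v \<in> carrier (H x) \<Longrightarrow> a \<odot>\<^bsub>H x\<^esub> v \<in> carrier (H x)" by simp_all
  show "\<lbrakk>v \<in> carrier (H x); w \<in> carrier (H x)\<rbrakk> \<Longrightarrow> inner_prod (H x) w v = cnj (inner_prod (H x) v w)"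
    by (rule S.inner_cnj)
qed

lemma J_inv: "v \<in> K x \<Longrightarrow> J_inv x v \<in> carrier (H x)" "v \<in> K x \<Longrightarrow> J x (J_inv x v) = v"
  by (auto simp: K_def J_inv_def inv_into_into f_inv_into_f)

lemma J_inv_J:
  assumes x: "x \<in> units G" and v: "v \<in> carrier (H x)"
  shows "J_inv x (J x v) = v"
proof -
  have k: "J x v \<in> K x" using v by (simp add: K_def)
  show ?thesis by (rule fibre_embedding(4)[OF x J_inv(1)[OF k] v J_inv(2)[OF k]])
qed

lemma U_J: "v \<in> carrier (H (s g)) \<Longrightarrow> U g (J (s g) v) = J (r g) (V g v)"
  by (simp add: U_def J_inv_J)

lemma K_E:
  assumes "v \<in> K x"
  obtains w where "w \<in> carrier (H x)" "v = J x w"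
  using assms by (auto simp: K_def)

text \<open>Induction along the recursion, for all \<zeta> at once because the recursion also
  evaluates coefficients of the fundamental sections. The base map \<open>p\<close> lets one
  statement serve for units and for both ends of an arrow.\<close>

lemma gs_coeff_measurable:
  assumes p: "p \<in> measurable M (unit_borel G)"
    and \<zeta>: "\<And>\<omega>. \<omega> \<in> space M \<Longrightarrow> \<zeta> \<omega> \<in> carrier (H (p \<omega>))"
    and meas: "\<And>n. (\<lambda>\<omega>. inner_prod (H (p \<omega>)) (fund E n (p \<omega>)) (\<zeta> \<omega>)) \<in> borel_measurable M"
  shows "(\<lambda>\<omega>. gs_coeff (H (p \<omega>)) (fd (p \<omega>)) n (\<zeta> \<omega>)) \<in> borel_measurable M"
  using \<zeta> meas
proof (induction n arbitrary: \<zeta> rule: less_induct)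
  case (less n)
  have pu: "p \<omega> \<in> units G" if "\<omega> \<in> space M" for \<omega> using measurable_space[OF p that] by simp
  have fm: "(\<lambda>\<omega>. inner_prod (H (p \<omega>)) (fund E j (p \<omega>)) (fund E k (p \<omega>))) \<in> borel_measurable M" for j k
    using measurable_compose[OF p, of "\<lambda>x. inner_prod (H x) (fund E j x) (fund E k x)" borel] hilb
    by (simp add: hilbert_bundle_def)
  have [measurable]: "(\<lambda>\<omega>. gs_coeff (H (p \<omega>)) (fd (p \<omega>)) k (\<zeta> \<omega>)) \<in> borel_measurable M" if "k < n" for k
    by (rule less.IH[OF that less.prems])
  have [measurable]: "(\<lambda>\<omega>. gs_coeff (H (p \<omega>)) (fd (p \<omega>)) k (fund E n (p \<omega>))) \<in> borel_measurable M" if "k < n" for k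
    by (rule less.IH[OF that _ fm]) (simp add: fibre_embedding(9) pu)
  have 1: "(\<lambda>\<omega>. inner_prod (H (p \<omega>)) (\<zeta> \<omega>) (fund E n (p \<omega>))) \<in> borel_measurable M"
  proof (subst measurable_cong)
    show "inner_prod (H (p \<omega>)) (\<zeta> \<omega>) (fund E n (p \<omega>)) = cnj (inner_prod (H (p \<omega>)) (fund E n (p \<omega>)) (\<zeta> \<omega>))"
      if "\<omega> \<in> space M" for \<omega>
      using fibre_embedding(9,14)[OF pu[OF that]] less.prems(1)[OF that] by blast
    show "(\<lambda>\<omega>. cnj (inner_prod (H (p \<omega>)) (fund E n (p \<omega>)) (\<zeta> \<omega>))) \<in> borel_measurable M"
      by (rule measurable_compose[OF less.prems(2) measurable_cnj])
  qed
  have 2: "(\<lambda>\<omega>. \<Sum>k<n. cnj (gs_coeff (H (p \<omega>)) (fd (p \<omega>)) k (fund E n (p \<omega>))) * gs_coeff (H (p \<omega>)) (fd (p \<omega>)) k (\<zeta> \<omega>)) \<in> borel_measurable M"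
    by (intro borel_measurable_sum borel_measurable_times measurable_compose[OF _ measurable_cnj]) auto
  have 3: "(\<lambda>\<omega>. \<Sum>k<n. (cmod (gs_coeff (H (p \<omega>)) (fd (p \<omega>)) k (fund E n (p \<omega>))))\<^sup>2) \<in> borel_measurable M"
    by (intro borel_measurable_sum borel_measurable_power borel_measurable_norm) auto
  have 4: "(\<lambda>\<omega>. complex_of_real (sqrt (Re (inner_prod (H (p \<omega>)) (fund E n (p \<omega>)) (fund E n (p \<omega>))) -
     (\<Sum>k<n. (cmod (gs_coeff (H (p \<omega>)) (fd (p \<omega>)) k (fund E n (p \<omega>))))\<^sup>2)))) \<in> borel_measurable M"
    using 3 measurable_compose[OF fm[of n n] borel_measurable_Re] by measurable
  have fdn: "fd x n = fund E n x" for x by (simp add: fd_def)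
  show ?case
    unfolding gs_coeff.simps[of _ _ n] fdn by (intro borel_measurable_divide borel_measurable_diff 1 2 4)
qed

text \<open>These functions belong to the family that generates \<open>iso_borel\<close>, so this is
  the measurability of \<pi> tested on generators.\<close>

lemma matrix_coefficient_measurable:
  "(\<lambda>g. inner_prod (H (r g)) (fund E n (r g)) (V g (fund E k (s g)))) \<in> borel_measurable borel"
proof (rule measurableI)
  fix B :: "complex set" assume B: "B \<in> sets borel"
  let ?I = "arr (iso_groupoid (unit_borel G) E)"
  let ?S = "{(x, W, y) \<in> ?I. inner_prod (H x) (fund E n x) (W (fund E k y)) \<in> B}"
  have "?S \<in> sets (iso_borel (unit_borel G) E)"
    unfolding iso_borel_def Let_def using B by (intro in_measure_of) auto
  from measurable_sets[OF \<pi>_measurable this] have "\<pi> -` ?S \<in> sets borel" by simp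
  moreover have "g \<in> \<pi> -` ?S \<longleftrightarrow> inner_prod (H (r g)) (fund E n (r g)) (V g (fund E k (s g))) \<in> B" for g
    using V_unitary[of g] by (simp add: \<pi>_eq[of g] iso_groupoid_def)
  ultimately show "(\<lambda>g. inner_prod (H (r g)) (fund E n (r g)) (V g (fund E k (s g)))) -` B \<inter> space borel \<in> sets borel"
    by (simp add: vimage_def)
qed simp

text \<open>Measurability of \<pi> concerns fundamental sections only. Moving \<open>V g\<close>
  across the inner product leaves \<open>V (i g)\<close> on a fundamental section, whose coordinates
  over \<open>s g\<close> come from matrix coefficients. Pairing them with \<open>F (s g)\<close>
  and applying the Gram-Schmidt recursion over \<open>r g\<close> gives the coordinates
  sought.\<close>

lemma U_measurable_section:
  assumes F: "\<And>x. x \<in> units G \<Longrightarrow> F x \<in> K x" and meas: "\<And>n. (\<lambda>x. coord (F x) n) \<in> borel_measurable \<mu>"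
  shows "(\<lambda>g. coord (U g (F (s g))) n) \<in> borel_measurable borel"
proof -
  define \<xi> where "\<xi> x = J_inv x (F x)" for x
  have \<xi>: "\<xi> x \<in> carrier (H x)" "J x (\<xi> x) = F x" if "x \<in> units G" for x
    using J_inv[OF F[OF that]] by (simp_all add: \<xi>_def)
  have Vf: "V (i g) (fund E k (r g)) \<in> carrier (H (s g))" for g k
    using V_closed[of "fund E k (r g)" "i g"] by (simp add: fibre_embedding(9))
  have 1: "(\<lambda>g. coord (J (s g) (V (i g) (fund E k (r g)))) j) \<in> borel_measurable borel" for j k
  proof -
    have "(\<lambda>g. gs_coeff (H (s g)) (fd (s g)) j (V (i g) (fund E k (r g)))) \<in> borel_measurable borel"
    proof (rule gs_coeff_measurable[OF src_measurable_unit Vf])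
      show "(\<lambda>g. inner_prod (H (s g)) (fund E n (s g)) (V (i g) (fund E k (r g)))) \<in> borel_measurable borel" for n
        using measurable_compose[OF inv_measurable matrix_coefficient_measurable[of n k]] by simp
    qed
    then show ?thesis by (simp add: fibre_embedding(6) Vf)
  qed
  have 2: "(\<lambda>g. inner_prod (H (r g)) (fund E k (r g)) (V g (\<xi> (s g)))) \<in> borel_measurable borel" for k
  proof -
    have "inner_prod (H (r g)) (fund E k (r g)) (V g (\<xi> (s g))) = cinner (J (s g) (V (i g) (fund E k (r g)))) (F (s g))" for g
      using V_adjoint[of "\<xi> (s g)" g "fund E k (r g)"] \<xi>[of "s g"] Vf[of g k] fibre_embedding(3)[of "s g" "V (i g) (fund E k (r g))" "\<xi> (s g)"]
      by (simp add: fibre_embedding(9))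
    moreover have "(\<lambda>g. cinner (J (s g) (V (i g) (fund E k (r g)))) (F (s g))) \<in> borel_measurable borel"
      by (intro measurable_cinner 1 measurable_compose[OF ends_measurable_mu(1) meas])
    ultimately show ?thesis by simp
  qed
  have V\<xi>: "V g (\<xi> (s g)) \<in> carrier (H (r g))" for g by (rule V_closed) (simp add: \<xi>)
  have "(\<lambda>g. gs_coeff (H (r g)) (fd (r g)) n (V g (\<xi> (s g)))) \<in> borel_measurable borel"
    by (rule gs_coeff_measurable[OF rng_measurable_unit V\<xi> 2])
  moreover have "coord (U g (F (s g))) n = gs_coeff (H (r g)) (fd (r g)) n (V g (\<xi> (s g)))" for g
    using fibre_embedding(6)[of "r g" "V g (\<xi> (s g))"] V\<xi>[of g] by (simp add: U_def \<xi>_def)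
  ultimately show ?thesis by simp
qed

sublocale ell2_representation G \<mu> K U
proof
  fix x v w a assume x: "x \<in> units G"
  show "0 \<in> K x" unfolding K_def using fibre_embedding(10,11)[OF x] by (intro image_eqI[of _ _ "\<zero>\<^bsub>H x\<^esub>"]) simp_all
  show "\<And>X. (\<And>n. X n \<in> K x) \<Longrightarrow> X \<longlonglongrightarrow> v \<Longrightarrow> v \<in> K x" by (rule fibre_embedding(8)[OF x])
  assume v: "v \<in> K x"
  then obtain v' where v': "v' \<in> carrier (H x)" "v = J x v'" by (rule K_E)
  have "cscale a v = J x (a \<odot>\<^bsub>H x\<^esub> v')" unfolding v'(2) by (rule fibre_embedding(2)[OF x v'(1), symmetric])
  then show "cscale a v \<in> K x" unfolding K_def using fibre_embedding(13)[OF x v'(1)] by blast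
  show "U x v = v" using v' x U_J[of v' x] V_unit[OF x v'(1)] by simp
  assume "w \<in> K x"
  then obtain w' where w': "w' \<in> carrier (H x)" "w = J x w'" by (rule K_E)
  have "v + w = J x (v' \<oplus>\<^bsub>H x\<^esub> w')" unfolding v'(2) w'(2) by (rule fibre_embedding(1)[OF x v'(1) w'(1), symmetric])
  then show "v + w \<in> K x" unfolding K_def using fibre_embedding(12)[OF x v'(1) w'(1)] by blast
next
  fix g v w a assume v: "v \<in> K (s g)"
  then obtain v' where v': "v' \<in> carrier (H (s g))" "v = J (s g) v'" by (rule K_E)
  show "U g v \<in> K (r g)" unfolding v'(2) U_J[OF v'(1)] K_def using V_closed[OF v'(1)] by blast
  show "U g (cscale a v) = cscale a (U g v)"
  proof -
    have "cscale a v = J (s g) (a \<odot>\<^bsub>H (s g)\<^esub> v')" using v' by (simp add: fibre_embedding(2))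
    then have "U g (cscale a v) = J (r g) (V g (a \<odot>\<^bsub>H (s g)\<^esub> v'))" using v' by (simp only: U_J fibre_embedding(13) ends_in_units)
    then show ?thesis using v' by (simp add: U_J fibre_embedding(2) V_scale V_closed)
  qed
  assume "w \<in> K (s g)"
  then obtain w' where w': "w' \<in> carrier (H (s g))" "w = J (s g) w'" by (rule K_E)
  show "U g (v + w) = U g v + U g w"
  proof -
    have "v + w = J (s g) (v' \<oplus>\<^bsub>H (s g)\<^esub> w')" using v' w' by (simp add: fibre_embedding(1))
    then have "U g (v + w) = J (r g) (V g (v' \<oplus>\<^bsub>H (s g)\<^esub> w'))"
      using v' w' by (simp only: U_J fibre_embedding(12) ends_in_units)
    then show ?thesis using v' w' by (simp add: U_J fibre_embedding(1) V_add V_closed)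
  qed
  show "cinner (U g v) (U g w) = cinner v w"
    using v' w' by (simp add: U_J fibre_embedding(3) V_closed V_inner)
next
  fix g h v assume gh: "s g = r h" and "v \<in> K (s h)"
  then obtain v' where v': "v' \<in> carrier (H (s h))" "v = J (s h) v'" by (elim K_E)
  have Vh: "V h v' \<in> carrier (H (s g))" using V_closed[OF v'(1)] gh by simp
  have "U (m g h) v = J (r g) (V g (V h v'))"
    using U_J[of v' "m g h"] v' gh V_mult[OF gh v'(1)] by simp
  also have "\<dots> = U g (J (s g) (V h v'))" using U_J[OF Vh] by simp
  also have "\<dots> = U g (U h v)" using U_J[OF v'(1)] v' gh by simp
  finally show "U (m g h) v = U g (U h v)" .
next
  fix F n assume "\<And>x. x \<in> units G \<Longrightarrow> F x \<in> K x" "\<And>n. (\<lambda>x. coord (F x) n) \<in> borel_measurable \<mu>"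
  then show "(\<lambda>g. coord (U g (F (s g))) n) \<in> borel_measurable borel" by (rule U_measurable_section)
qed

end

section \<open>Generators of standard Borel structures\<close>

definition analytic :: "(nat \<Rightarrow> nat) set \<Rightarrow> bool" where
  "analytic B \<longleftrightarrow> (\<exists>C :: ((nat \<Rightarrow> nat) \<times> (nat \<Rightarrow> nat)) set. closed C \<and> B = fst ` C)"

lemma continuous_on_eval [continuous_intros]:
  fixes g :: "'a::topological_space \<Rightarrow> 'i \<Rightarrow> 'b::topological_space"
  assumes "continuous_on S g"
  shows "continuous_on S (\<lambda>x. g x i)"
  using assms by (auto intro: continuous_on_product_then_coordinatewise)

lemma tendsto_fun_coordinatewise:
  fixes l :: "'i \<Rightarrow> 'b::topological_space"
  assumes "\<And>i. ((\<lambda>n. f n i) \<longlongrightarrow> l i) F"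
  shows "(f \<longlongrightarrow> l) F"
proof -
  have "limitin (product_topology (\<lambda>i. euclidean) UNIV) f l F"
    using assms by (simp add: limitin_componentwise)
  then show ?thesis by (simp add: euclidean_product_topology)
qed

lemma analytic_family:
  assumes "\<And>i. analytic (B i)"
  shows "\<exists>C :: 'i \<Rightarrow> ((nat \<Rightarrow> nat) \<times> (nat \<Rightarrow> nat)) set. \<forall>i. closed (C i) \<and> B i = fst ` C i"
  using assms unfolding analytic_def by (intro choice) blast

lemma analytic_closed: "closed B \<Longrightarrow> analytic B"
  unfolding analytic_def
  by (intro exI[of _ "B \<times> UNIV"]) (auto intro: closed_Times)

text \<open>The first entry of the witness names the index \<open>i\<close>, and the remaining
  entries are a witness for \<open>B i\<close>.\<close>

lemma analytic_UN:
  assumes "\<And>i::nat. analytic (B i)"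
  shows "analytic (\<Union>i. B i)"
proof -
  obtain C :: "nat \<Rightarrow> ((nat \<Rightarrow> nat) \<times> (nat \<Rightarrow> nat)) set" where C: "\<And>i. closed (C i)" "\<And>i. B i = fst ` C i"
    using analytic_family[of B, OF assms] by blast
  define D where "D = (\<Inter>i. {p. snd p 0 \<noteq> i} \<union> (\<lambda>p. (fst p, \<lambda>j. snd p (Suc j))) -` C i)"
  have 1: "closed ((\<lambda>p. snd p 0) -` {n. n \<noteq> i})" for i :: nat
    by (intro closed_vimage continuous_intros) (auto simp: closed_def open_discrete)
  have 2: "closed ((\<lambda>p. (fst p, \<lambda>j. snd p (Suc j))) -` C i)" for i
    by (intro closed_vimage C continuous_intros continuous_on_coordinatewise_then_product)
  have "closed D" unfolding D_def using 1 2 by (auto simp: vimage_def)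
  moreover have "(\<Union>i. B i) = fst ` D"
  proof (intro Set.set_eqI iffI)
    fix x assume "x \<in> (\<Union>i. B i)"
    then obtain i z where "(x, z) \<in> C i" using C(2) by force
    then have "(x, case_nat i z) \<in> D" by (auto simp: D_def)
    then show "x \<in> fst ` D" by force
  next
    fix x assume "x \<in> fst ` D"
    then obtain z where "(x, z) \<in> D" by auto
    then have "(x, \<lambda>j. z (Suc j)) \<in> C (z 0)" by (auto simp: D_def)
    then show "x \<in> (\<Union>i. B i)" using C(2) by force
  qed
  ultimately show ?thesis unfolding analytic_def by blast
qed

text \<open>One sequence carries witnesses for all \<open>B i\<close>, interleaved by
  \<open>prod_encode\<close>; this is the advantage of taking witnesses from the Baire
  space.\<close>

lemma analytic_INT:
  assumes "\<And>i::nat. analytic (B i)"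
  shows "analytic (\<Inter>i. B i)"
proof -
  obtain C :: "nat \<Rightarrow> ((nat \<Rightarrow> nat) \<times> (nat \<Rightarrow> nat)) set" where C: "\<And>i. closed (C i)" "\<And>i. B i = fst ` C i"
    using analytic_family[of B, OF assms] by blast
  define D where "D = (\<Inter>i. (\<lambda>p. (fst p, \<lambda>j. snd p (prod_encode (i, j)))) -` C i)"
  have "closed D" unfolding D_def
    by (intro closed_INT ballI closed_vimage C continuous_intros continuous_on_coordinatewise_then_product)
  moreover have "(\<Inter>i. B i) = fst ` D"
  proof (intro Set.set_eqI iffI)
    fix x assume "x \<in> (\<Inter>i. B i)"
    then have "\<forall>i. \<exists>z. (x, z) \<in> C i" using C(2) by force
    then obtain z where z: "\<And>i. (x, z i) \<in> C i" by metis
    have "(x, \<lambda>n. z (fst (prod_decode n)) (snd (prod_decode n))) \<in> D"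
      using z by (auto simp: D_def)
    then show "x \<in> fst ` D" by force
  next
    fix x assume "x \<in> fst ` D"
    then obtain z where "(x, z) \<in> D" by auto
    then have "(x, \<lambda>j. z (prod_encode (i, j))) \<in> C i" for i by (auto simp: D_def)
    then show "x \<in> (\<Inter>i. B i)" using C(2) by force
  qed
  ultimately show ?thesis unfolding analytic_def by blast
qed

text \<open>An open subset of a metrizable space is a countable union of closed sets.\<close>

lemma analytic_open:
  assumes "open (U :: (nat \<Rightarrow> nat) set)"
  shows "analytic U"
proof -
  have "euclidean = discrete_topology (UNIV :: nat set)"
    by (simp add: topology_eq open_discrete)
  then have "metrizable_space (euclidean :: nat topology)"
    by (simp add: metrizable_space_discrete_topology)
  then have "metrizable_space (product_topology (\<lambda>i::nat. euclidean :: nat topology) UNIV)"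
    by (simp add: metrizable_space_product_topology)
  then have "fsigma_in euclidean U"
    using assms by (intro open_imp_fsigma_in) (auto simp: euclidean_product_topology)
  then have "\<exists>C. (\<forall>n. closedin euclidean (C n)) \<and> (\<forall>n. C n \<subseteq> C (Suc n)) \<and> \<Union> (range C) = U"
    unfolding fsigma_in_ascending .
  then obtain C :: "nat \<Rightarrow> (nat \<Rightarrow> nat) set" where C: "\<forall>n. closedin euclidean (C n)" "\<Union> (range C) = U"
    by (elim exE conjE)
  have "analytic (\<Union>n. C n)"
    using C(1) by (intro analytic_UN analytic_closed) simp
  then show ?thesis using C(2) by simp
qed

text \<open>Analytic sets are not closed under complements, so the induction over the Borel sets
  carries a set and its complement together.\<close>

lemma analytic_borel:
  assumes "B \<in> sets borel"
  shows "analytic B" "analytic (- B)"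
proof -
  have "B \<in> sigma_sets UNIV {S. open S}"
    using assms by (simp add: borel_def)
  then have "analytic B \<and> analytic (- B)"
  proof induction
    case (Basic U)
    then show ?case by (auto intro: analytic_open analytic_closed)
  next
    case Empty
    then show ?case by (auto intro: analytic_closed)
  next
    case (Compl a)
    then show ?case by (simp add: Compl_eq_Diff_UNIV[symmetric])
  next
    case (Union a)
    then show ?case by (auto intro: analytic_UN analytic_INT simp: Compl_UN)
  qed
  then show "analytic B" "analytic (- B)" by auto
qed

text \<open>Lusin's separation argument: pieces of a closed set above the sets in question are
  inseparable all the way down to two points, which some \<open>G k\<close> nevertheless separates.\<close>

lemma separating_borel_sets_generate:
  fixes G :: "nat \<Rightarrow> (nat \<Rightarrow> nat) set"
  assumes A: "A \<in> sets borel" and G: "\<And>k. G k \<in> sets borel"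
    and sep: "\<And>a b. \<lbrakk>a \<in> A; b \<notin> A\<rbrakk> \<Longrightarrow> \<exists>k. (a \<in> G k) \<noteq> (b \<in> G k)"
  shows "A \<in> sigma_sets UNIV (range G)"
proof (rule ccontr)
  assume notin: "A \<notin> sigma_sets UNIV (range G)"
  let ?S = "sigma_sets UNIV (range G)"
  interpret S: sigma_algebra UNIV ?S by (rule sigma_algebra_sigma_sets) auto
  \<comment> \<open>Index \<open>0\<close> goes to \<open>A\<close>, and \<open>G k\<close> becomes
    \<open>G' (Suc k)\<close>, so that one construction treats all these sets.\<close>
  define G' where "G' = case_nat A G"
  have G'b: "G' k \<in> sets borel" for k using A G by (cases k) (auto simp: G'_def)
  obtain C :: "nat \<Rightarrow> ((nat \<Rightarrow> nat) \<times> (nat \<Rightarrow> nat)) set" where C: "\<And>k. closed (C k)" "\<And>k. G' k = fst ` C k"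
    using analytic_family[of G', OF analytic_borel(1)[OF G'b]] by blast
  obtain C' :: "nat \<Rightarrow> ((nat \<Rightarrow> nat) \<times> (nat \<Rightarrow> nat)) set" where C': "\<And>k. closed (C' k)" "\<And>k. - G' k = fst ` C' k"
    using analytic_family[of "\<lambda>k. - G' k", OF analytic_borel(2)[OF G'b]] by blast
  \<comment> \<open>Row \<open>k\<close> of the second component describes how the point lies to
    \<open>G' k\<close>: entry \<open>0\<close> is a flag, zero exactly for membership, and the
    later entries are a witness that the flag is right. \<open>Z\<close> collects the points with
    correct descriptions.\<close>
  define e where "e k = prod_encode (k, 0)" for k :: nat
  define pt where "pt k = (\<lambda>p :: (nat \<Rightarrow> nat) \<times> (nat \<Rightarrow> nat).
     (fst p, \<lambda>j. snd p (prod_encode (k, Suc j))))" for k :: nat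
  define Z where "Z = (\<Inter>k. ({p. snd p (e k) \<noteq> 0} \<union> pt k -` C k) \<inter> ({p. snd p (e k) = 0} \<union> pt k -` C' k))"
  have cl: "closed {p :: (nat \<Rightarrow> nat) \<times> (nat \<Rightarrow> nat). snd p i \<in> N}" for i N
  proof -
    have "closed ((\<lambda>p :: (nat \<Rightarrow> nat) \<times> (nat \<Rightarrow> nat). snd p i) -` N)"
      by (intro closed_vimage continuous_intros) (auto simp: closed_def open_discrete)
    then show ?thesis by (simp add: vimage_def)
  qed
  have clpt: "closed (pt k -` D)" if "closed D" for k D
    unfolding pt_def
    by (intro closed_vimage that continuous_intros continuous_on_coordinatewise_then_product)
  have "closed Z"
    unfolding Z_def using cl[of _ "-{0}"] cl[of _ "{0}"] clpt C(1) C'(1)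
    by (intro closed_INT ballI closed_Int closed_Un) auto
  have Z_iff: "p \<in> Z \<longleftrightarrow> (\<forall>k. if snd p (e k) = 0 then pt k p \<in> C k else pt k p \<in> C' k)" for p
    unfolding Z_def by (simp only: INT_iff Int_iff Un_iff mem_Collect_eq vimage_eq) (metis UNIV_I)
  have ZG: "(fst p \<in> G' k) = (snd p (e k) = 0)" if "p \<in> Z" for p k
  proof (cases "snd p (e k) = 0")
    case True
    then have "pt k p \<in> C k" using that by (metis Z_iff)
    then have "fst (pt k p) \<in> G' k" using C(2) by blast
    then show ?thesis using True by (simp add: pt_def)
  next
    case False
    then have "pt k p \<in> C' k" using that by (metis Z_iff)
    then have "fst (pt k p) \<in> - G' k" using C'(2) by blast
    then show ?thesis using False by (simp add: pt_def)
  qed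
  have ZU: "x \<in> fst ` Z" for x
  proof -
    have "\<exists>z. if x \<in> G' k then (x, z) \<in> C k else (x, z) \<in> C' k" for k
      using C(2)[of k] C'(2)[of k] by force
    then obtain z where z: "\<And>k. if x \<in> G' k then (x, z k) \<in> C k else (x, z k) \<in> C' k" by metis
    define w where "w n = (case prod_decode n of (k, j) \<Rightarrow>
       (case j of 0 \<Rightarrow> if x \<in> G' k then 0 else 1 | Suc j \<Rightarrow> z k j))" for n
    have "w (e k) = (if x \<in> G' k then 0 else 1)" "(\<lambda>j. w (prod_encode (k, Suc j))) = z k" for k
      by (auto simp: w_def e_def)
    then have "(x, w) \<in> Z" using z unfolding Z_iff by (simp add: pt_def)
    then show ?thesis by force
  qed
  define cyl :: "(nat \<Rightarrow> nat \<times> nat) \<Rightarrow> nat \<Rightarrow> ((nat \<Rightarrow> nat) \<times> (nat \<Rightarrow> nat)) set"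
    where "cyl \<beta> n = {p. \<forall>i<n. (fst p i, snd p i) = \<beta> i}" for \<beta> n
  have cyl_Suc: "cyl \<beta> n = (\<Union>c. cyl (\<beta>(n := c)) (Suc n))" for \<beta> n
    by (auto simp: cyl_def less_Suc_eq)
  have cyl_split: "fst ` (W \<inter> cyl \<beta> n) = (\<Union>c. fst ` (W \<inter> cyl (\<beta>(n := c)) (Suc n)))" for W \<beta> n
    by (simp only: cyl_Suc[of \<beta> n] Int_UN_distrib image_UN)
  define Z1 where "Z1 = Z \<inter> {p. snd p (e 0) = 0}"
  define Z2 where "Z2 = Z \<inter> {p. snd p (e 0) \<noteq> 0}"
  have Z12: "closed Z1" "closed Z2"
    using \<open>closed Z\<close> cl[of "e 0" "{0}"] cl[of "e 0" "-{0}"] by (auto simp: Z1_def Z2_def intro: closed_Int)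
  define insep where "insep S T \<longleftrightarrow> \<not> (\<exists>D\<in>?S. S \<subseteq> D \<and> T \<inter> D = {})" for S T :: "(nat \<Rightarrow> nat) set"
  \<comment> \<open>If \<open>D c d\<close> separates \<open>S c\<close> from \<open>T d\<close> for
    every pair, then the union over \<open>c\<close> of the intersections over \<open>d\<close>
    separates the two unions. Inseparability thus passes to some pair of pieces.\<close>
  have insep_UN: "\<exists>c d. insep (S c) (T d)" if "insep (\<Union>c. S c) (\<Union>d. T d)"
    for S T :: "nat \<times> nat \<Rightarrow> (nat \<Rightarrow> nat) set"
  proof (rule ccontr)
    assume "\<nexists>c d. insep (S c) (T d)"
    then have "\<forall>c d. \<exists>D\<in>?S. S c \<subseteq> D \<and> T d \<inter> D = {}" by (auto simp: insep_def)
    then obtain D where D: "\<And>c d. D c d \<in> ?S" "\<And>c d. S c \<subseteq> D c d" "\<And>c d. T d \<inter> D c d = {}" by metis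
    have "(\<Union>c. \<Inter>d. D c d) \<in> ?S"
    proof (intro S.countable_UN'' S.countable_INT'')
      show "D c d \<in> ?S" for c d by (rule D(1))
    qed (auto intro: S.top)
    moreover have "(\<Union>c. S c) \<subseteq> (\<Union>c. \<Inter>d. D c d)"
      using D(2) by (meson INT_greatest UN_mono subset_UNIV)
    moreover have "(\<Union>d. T d) \<inter> (\<Union>c. \<Inter>d. D c d) = {}"
      using D(3) by (simp add: disjoint_iff) metis
    ultimately show False using that unfolding insep_def by metis
  qed
  have "fst ` Z1 = A" "fst ` Z2 = - A"
  proof -
    have *: "x \<in> fst ` Z1 \<longleftrightarrow> x \<in> A" "x \<in> fst ` Z2 \<longleftrightarrow> x \<notin> A" for x
    proof -
      obtain p where "p \<in> Z" "x = fst p" using ZU[of x] by blast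
      then show "x \<in> fst ` Z1 \<longleftrightarrow> x \<in> A" "x \<in> fst ` Z2 \<longleftrightarrow> x \<notin> A"
        using ZG[of _ 0] unfolding Z1_def Z2_def G'_def image_iff by force+
    qed
    show "fst ` Z1 = A" "fst ` Z2 = - A" using * by blast+
  qed
  \<comment> \<open>The only set that separates \<open>A\<close> from its complement is
    \<open>A\<close> itself, which is assumed not to be generated.\<close>
  then have start: "insep (fst ` (Z1 \<inter> cyl \<beta> 0)) (fst ` (Z2 \<inter> cyl \<gamma> 0))" for \<beta> \<gamma>
    using notin by (auto simp: cyl_def insep_def) (metis Compl_disjoint2 Int_commute disjoint_eq_subset_Compl double_compl subset_antisym)
  have "\<exists>s. \<forall>n. insep (fst ` (Z1 \<inter> cyl (fst (s n)) n)) (fst ` (Z2 \<inter> cyl (snd (s n)) n)) \<and>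
     (\<forall>i<n. fst (s (Suc n)) i = fst (s n) i \<and> snd (s (Suc n)) i = snd (s n) i)"
  proof (rule dependent_nat_choice)
    show "\<exists>s. insep (fst ` (Z1 \<inter> cyl (fst s) 0)) (fst ` (Z2 \<inter> cyl (snd s) 0))"
      using start by blast
  next
    fix s n assume "insep (fst ` (Z1 \<inter> cyl (fst s) n)) (fst ` (Z2 \<inter> cyl (snd s) n))"
    then have "insep (\<Union>c. fst ` (Z1 \<inter> cyl ((fst s)(n := c)) (Suc n))) (\<Union>d. fst ` (Z2 \<inter> cyl ((snd s)(n := d)) (Suc n)))"
      by (simp only: cyl_split[of Z1 "fst s" n] cyl_split[of Z2 "snd s" n])
    then obtain c d where "insep (fst ` (Z1 \<inter> cyl ((fst s)(n := c)) (Suc n))) (fst ` (Z2 \<inter> cyl ((snd s)(n := d)) (Suc n)))"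
      using insep_UN by blast
    then show "\<exists>t. insep (fst ` (Z1 \<inter> cyl (fst t) (Suc n))) (fst ` (Z2 \<inter> cyl (snd t) (Suc n))) \<and>
       (\<forall>i<n. fst t i = fst s i \<and> snd t i = snd s i)"
      by (intro exI[of _ "((fst s)(n := c), (snd s)(n := d))"]) auto
  qed
  then obtain s where s: "\<And>n. insep (fst ` (Z1 \<inter> cyl (fst (s n)) n)) (fst ` (Z2 \<inter> cyl (snd (s n)) n))"
    "\<And>n i. i < n \<Longrightarrow> fst (s (Suc n)) i = fst (s n) i \<and> snd (s (Suc n)) i = snd (s n) i" by metis
  \<comment> \<open>Each stage fixes one more entry and keeps the earlier ones, so the branch can be
    read off diagonally.\<close>
  define \<beta> where "\<beta> i = fst (s (Suc i)) i" for i
  define \<gamma> where "\<gamma> i = snd (s (Suc i)) i" for i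
  have agree: "fst (s n) i = \<beta> i \<and> snd (s n) i = \<gamma> i" if "i < n" for n i
    using that
  proof (induction n)
    case (Suc n)
    then show ?case using s(2)[of i n] by (cases "i = n") (auto simp: \<beta>_def \<gamma>_def)
  qed auto
  have "cyl (fst (s n)) n = cyl \<beta> n" "cyl (snd (s n)) n = cyl \<gamma> n" for n
    using agree by (auto simp: cyl_def)
  then have ins: "insep (fst ` (Z1 \<inter> cyl \<beta> n)) (fst ` (Z2 \<inter> cyl \<gamma> n))" for n
    using s(1)[of n] by simp
  \<comment> \<open>Points of \<open>W\<close> in longer and longer cylinders converge to the
    branch. Closedness then places the branch in \<open>W\<close>, which is the reason for working
    above the sets, in \<open>Z\<close>.\<close>
  have lim: "(fst \<circ> \<delta>, snd \<circ> \<delta>) \<in> W" if "closed W" and ne: "\<And>n. W \<inter> cyl \<delta> n \<noteq> {}" for W \<delta>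
  proof -
    have "\<forall>n. \<exists>q. q \<in> W \<inter> cyl \<delta> n" using ne by blast
    from choice[OF this] obtain p where p: "\<And>n. p n \<in> W \<inter> cyl \<delta> n" by blast
    have *: "(\<lambda>n. fst (p n)) \<longlonglongrightarrow> (fst \<circ> \<delta>)" "(\<lambda>n. snd (p n)) \<longlonglongrightarrow> (snd \<circ> \<delta>)"
    proof -
      have ev: "eventually (\<lambda>n. fst (p n) i = fst (\<delta> i) \<and> snd (p n) i = snd (\<delta> i)) sequentially" for i
        using p by (intro eventually_sequentiallyI[of "Suc i"]) (force simp: cyl_def prod_eq_iff)
      then have "(\<lambda>n. fst (p n) i) \<longlonglongrightarrow> (fst \<circ> \<delta>) i" "(\<lambda>n. snd (p n) i) \<longlonglongrightarrow> (snd \<circ> \<delta>) i" for i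
        using eventually_mono[OF ev[of i]] by (auto intro!: tendsto_eventually)
      then show "(\<lambda>n. fst (p n)) \<longlonglongrightarrow> (fst \<circ> \<delta>)" "(\<lambda>n. snd (p n)) \<longlonglongrightarrow> (snd \<circ> \<delta>)"
        by (auto intro: tendsto_fun_coordinatewise)
    qed
    have "p \<longlonglongrightarrow> (fst \<circ> \<delta>, snd \<circ> \<delta>)"
      using tendsto_Pair[OF *] by simp
    then show ?thesis using closed_sequentially[OF that(1)] p by blast
  qed
  have "Z1 \<inter> cyl \<beta> n \<noteq> {}" "Z2 \<inter> cyl \<gamma> n \<noteq> {}" for n
    using ins[of n] by (auto simp: insep_def dest: bspec[OF _ S.empty_sets] bspec[OF _ S.top])
  then have pq: "(fst \<circ> \<beta>, snd \<circ> \<beta>) \<in> Z1" "(fst \<circ> \<gamma>, snd \<circ> \<gamma>) \<in> Z2" using lim Z12 by auto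
  then have "fst \<circ> \<beta> \<in> A" "fst \<circ> \<gamma> \<notin> A"
    using ZG[of _ 0] by (auto simp: Z1_def Z2_def G'_def)
  then obtain k where k: "(fst \<circ> \<beta> \<in> G k) \<noteq> (fst \<circ> \<gamma> \<in> G k)" using sep by blast
  \<comment> \<open>Cylinders of length \<open>Suc ?i\<close> fix the flag of \<open>G k\<close>.
    Membership in \<open>G k\<close> is then constant on each piece, so \<open>G k\<close> or its
    complement separates two pieces that were inseparable.\<close>
  let ?i = "e (Suc k)"
  have Gk: "(fst p \<in> G k) = (snd p ?i = 0)" if "p \<in> Z" for p
    using ZG[OF that, of "Suc k"] by (simp add: G'_def)
  have 1: "(fst p \<in> G k) = (fst \<circ> \<beta> \<in> G k)" if "p \<in> Z1 \<inter> cyl \<beta> (Suc ?i)" for p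
    using that Gk[of p] Gk[of "(fst \<circ> \<beta>, snd \<circ> \<beta>)"] pq by (auto simp: cyl_def Z1_def prod_eq_iff)
  have 2: "(fst p \<in> G k) = (fst \<circ> \<gamma> \<in> G k)" if "p \<in> Z2 \<inter> cyl \<gamma> (Suc ?i)" for p
    using that Gk[of p] Gk[of "(fst \<circ> \<gamma>, snd \<circ> \<gamma>)"] pq by (auto simp: cyl_def Z2_def prod_eq_iff)
  define P where "P = fst ` (Z1 \<inter> cyl \<beta> (Suc ?i))"
  define Q where "Q = fst ` (Z2 \<inter> cyl \<gamma> (Suc ?i))"
  have "G k \<in> ?S" "- G k \<in> ?S" by (auto simp: Compl_eq_Diff_UNIV intro: sigma_sets.intros)
  moreover have "P \<subseteq> G k \<and> Q \<inter> G k = {} \<or> P \<subseteq> - G k \<and> Q \<inter> (- G k) = {}"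
  proof (cases "fst \<circ> \<beta> \<in> G k")
    case True
    then have "P \<subseteq> G k" "Q \<inter> G k = {}" using 1 2 k unfolding P_def Q_def by fastforce+
    then show ?thesis by blast
  next
    case False
    then have "P \<subseteq> - G k" "Q \<inter> (- G k) = {}" using 1 2 k unfolding P_def Q_def by fastforce+
    then show ?thesis by blast
  qed
  ultimately show False
    using ins[of "Suc ?i"] unfolding insep_def P_def[symmetric] Q_def[symmetric] by metis
qed

text \<open>A sequence of indices into a countable dense set is sent to the limit of the indexed
  points if these are rapidly Cauchy, and to a fixed point otherwise. Every point is the limit of
  such a sequence.\<close>

lemma completely_metrizable_borel_surjection:
  assumes T: "completely_metrizable_space T" "second_countable T" "topspace T \<noteq> {}"
  obtains \<phi> :: "(nat \<Rightarrow> nat) \<Rightarrow> 'a" where "range \<phi> = topspace T"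
    "\<And>U. openin T U \<Longrightarrow> \<phi> -` U \<in> sets borel"
proof -
  obtain M d where "Metric_space M d" and mc: "Metric_space.mcomplete M d" and T_eq: "T = Metric_space.mtopology M d"
    using T(1) unfolding completely_metrizable_space_def by blast
  then interpret Metric_space M d by simp
  have top: "topspace T = M" by (simp add: T_eq)
  obtain D where D: "countable D" "D \<subseteq> M" "mtopology closure_of D = M"
    using second_countable_imp_separable_space[OF T(2)] unfolding separable_space_def T_eq by auto
  have ne: "D \<noteq> {}" using D(3) T(3) top by auto
  define c where "c = from_nat_into D"
  have c: "c n \<in> M" for n using from_nat_into[OF ne, of n] D(2) by (auto simp: c_def)
  have dense: "\<exists>n. d x (c n) < r" if "x \<in> M" "r > 0" for x r
  proof -
    have "x \<in> mtopology closure_of D" using D(3) that by simp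
    then have "\<forall>r>0. \<exists>y\<in>D. y \<in> mball x r" by (simp add: metric_closure_of)
    then obtain y where "y \<in> D" "y \<in> mball x r" using \<open>r > 0\<close> by blast
    then show ?thesis using from_nat_into_surj[OF D(1), of y] by (auto simp: c_def)
  qed
  define S where "S = {\<alpha> :: nat \<Rightarrow> nat. \<forall>n. d (c (\<alpha> n)) (c (\<alpha> (Suc n))) \<le> (1/2)^n}"
  have tail: "d (c (\<alpha> n)) (c (\<alpha> (n + k))) \<le> 2 * (1/2)^n - 2 * (1/2)^(n + k)" if "\<alpha> \<in> S" for \<alpha> n k
  proof (induction k)
    case 0
    then show ?case using c by simp
  next
    case (Suc k)
    have "d (c (\<alpha> (n + k))) (c (\<alpha> (Suc (n + k)))) \<le> (1/2)^(n + k)" using that by (simp add: S_def)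
    moreover have "d (c (\<alpha> n)) (c (\<alpha> (n + Suc k))) \<le> d (c (\<alpha> n)) (c (\<alpha> (n + k))) + d (c (\<alpha> (n + k))) (c (\<alpha> (Suc (n + k))))"
      using triangle c by simp
    ultimately show ?case using Suc by simp
  qed
  then have tail': "d (c (\<alpha> n)) (c (\<alpha> (n + k))) \<le> 2 * (1/2)^n" if "\<alpha> \<in> S" for \<alpha> n k
    using that by (smt (verit) zero_le_power zero_le_divide_1_iff)
  have h_nonneg: "0 \<le> (1/2::real)^n" for n by simp
  have small: "\<exists>n. 2 * (1/2)^n < r" if "r > 0" for r :: real
    using real_arch_pow_inv[of "r/2" "1/2"] that by (auto simp: mult.commute)
  have "\<exists>x. limitin mtopology (\<lambda>n. c (\<alpha> n)) x sequentially" if "\<alpha> \<in> S" for \<alpha>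
  proof -
    have "MCauchy (\<lambda>n. c (\<alpha> n))"
      unfolding MCauchy_def
    proof (intro conjI allI impI)
      show "range (\<lambda>n. c (\<alpha> n)) \<subseteq> M" using c by auto
      fix r :: real assume "r > 0"
      then obtain N where N: "2 * (1/2)^N < r/2" using small[of "r/2"] by auto
      have "d (c (\<alpha> n)) (c (\<alpha> m)) < r" if "N \<le> n" "N \<le> m" for n m
      proof -
        have "d (c (\<alpha> N)) (c (\<alpha> n)) < r/2" "d (c (\<alpha> N)) (c (\<alpha> m)) < r/2"
          using tail'[OF \<open>\<alpha> \<in> S\<close>, of N "n - N"] tail'[OF \<open>\<alpha> \<in> S\<close>, of N "m - N"] that N by auto
        then show ?thesis
          using triangle[of "c (\<alpha> n)" "c (\<alpha> N)" "c (\<alpha> m)"] commute[of "c (\<alpha> N)" "c (\<alpha> n)"] c by simp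
      qed
      then show "\<exists>N. \<forall>n n'. N \<le> n \<longrightarrow> N \<le> n' \<longrightarrow> d (c (\<alpha> n)) (c (\<alpha> n')) < r" by blast
    qed
    then show ?thesis using mc unfolding mcomplete_def by blast
  qed
  then obtain L where L: "\<And>\<alpha>. \<alpha> \<in> S \<Longrightarrow> limitin mtopology (\<lambda>n. c (\<alpha> n)) (L \<alpha>) sequentially" by metis
  define \<phi> where "\<phi> \<alpha> = (if \<alpha> \<in> S then L \<alpha> else c 0)" for \<alpha>
  have \<phi>M: "\<phi> \<alpha> \<in> M" for \<alpha>
    using L[of \<alpha>] c by (auto simp: \<phi>_def limitin_metric)
  have \<phi>_close: "d (c (\<alpha> n)) (\<phi> \<alpha>) \<le> 2 * (1/2)^n" if "\<alpha> \<in> S" for \<alpha> n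
  proof -
    have "L \<alpha> \<in> mcball (c (\<alpha> n)) (2 * (1/2)^n)"
    proof (rule limitin_closedin[OF L[OF that] closedin_mcball])
      show "\<forall>\<^sub>F m in sequentially. c (\<alpha> m) \<in> mcball (c (\<alpha> n)) (2 * (1/2)^n)"
        using tail'[OF that, of n] c by (intro eventually_sequentiallyI[of n]) (metis in_mcball le_add_diff_inverse)
    qed simp
    then show ?thesis using that by (simp add: \<phi>_def)
  qed
  have sing: "{\<alpha> :: nat \<Rightarrow> nat. P (\<alpha> n)} \<in> sets borel" for P n
  proof -
    have "open ((\<lambda>\<alpha>::nat\<Rightarrow>nat. \<alpha> n) -` {k. P k})"
      by (intro open_vimage open_discrete continuous_intros)
    then show ?thesis by (simp add: vimage_def)
  qed
  have Sb: "S \<in> sets borel"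
  proof -
    have "{\<alpha>. d (c (\<alpha> n)) (c (\<alpha> (Suc n))) \<le> (1/2)^n} \<in> sets borel" for n
    proof -
      have "open ((\<lambda>\<alpha>::nat\<Rightarrow>nat. (\<alpha> n, \<alpha> (Suc n))) -` {k. d (c (fst k)) (c (snd k)) \<le> (1/2)^n})"
        by (intro open_vimage continuous_intros) (auto simp: open_prod_def intro!: exI[of _ "{_}"] open_discrete)
      then show ?thesis by (simp add: vimage_def)
    qed
    moreover have "S = (\<Inter>n. {\<alpha>. d (c (\<alpha> n)) (c (\<alpha> (Suc n))) \<le> (1/2)^n})" by (auto simp: S_def)
    ultimately show ?thesis by auto
  qed
  show thesis
  proof
    show "range \<phi> = topspace T"
    proof (intro equalityI subsetI)
      fix x assume "x \<in> topspace T"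
      then have "x \<in> M" by (simp add: top)
      \<comment> \<open>The factor \<open>1/4\<close> leaves room for the triangle inequality: the
        bounds for \<open>n\<close> and \<open>Suc n\<close> add up to less than
        \<open>(1/2)^n\<close>.\<close>
      have "\<exists>k. d x (c k) < (1/2)^n / 4" for n
        by (rule dense[OF \<open>x \<in> M\<close>]) simp
      then obtain \<alpha> where \<alpha>: "\<And>n. d x (c (\<alpha> n)) < (1/2)^n / 4" by metis
      have "d (c (\<alpha> n)) (c (\<alpha> (Suc n))) \<le> (1/2)^n" for n
      proof -
        have "d (c (\<alpha> n)) (c (\<alpha> (Suc n))) \<le> d x (c (\<alpha> n)) + d x (c (\<alpha> (Suc n)))"
          using triangle[of "c (\<alpha> n)" x "c (\<alpha> (Suc n))"] \<open>x \<in> M\<close> c by (simp add: commute)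
        then show ?thesis
          using \<alpha>[of n] \<alpha>[of "Suc n"] h_nonneg[of n] power_Suc[of "1/2::real" n] by linarith
      qed
      then have S: "\<alpha> \<in> S" by (simp add: S_def)
      have "d x (\<phi> \<alpha>) = 0"
      proof (rule ccontr)
        assume "d x (\<phi> \<alpha>) \<noteq> 0"
        then have "d x (\<phi> \<alpha>) / 4 > 0" using nonneg[of x "\<phi> \<alpha>"] by linarith
        then obtain n where n: "2 * (1/2)^n < d x (\<phi> \<alpha>) / 4" using small by blast
        have "d x (\<phi> \<alpha>) \<le> d x (c (\<alpha> n)) + d (c (\<alpha> n)) (\<phi> \<alpha>)"
          using triangle \<open>x \<in> M\<close> c \<phi>M by simp
        also have "\<dots> \<le> (1/2)^n / 4 + 2 * (1/2)^n" using \<alpha>[of n] \<phi>_close[OF S, of n] by linarith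
        finally show False using n h_nonneg[of n] by linarith
      qed
      then have "x = \<phi> \<alpha>" using \<open>x \<in> M\<close> \<phi>M by simp
      then show "x \<in> range \<phi>" by simp
    qed (auto simp: \<phi>M top)
  next
    fix U assume U: "openin T U"
    \<comment> \<open>The limit lies within \<open>2 * (1/2)^n\<close> of the \<open>n\<close>-th
      point, so membership in \<open>U\<close> is decided by some closed ball. For fixed
      \<open>n\<close> the condition involves the single entry \<open>\<alpha> n\<close>, which
      makes it Borel.\<close>
    have *: "\<phi> \<alpha> \<in> U \<longleftrightarrow> (\<exists>n. mcball (c (\<alpha> n)) (2 * (1/2)^n) \<subseteq> U)" if "\<alpha> \<in> S" for \<alpha>
    proof
      assume "\<phi> \<alpha> \<in> U"
      then obtain r where r: "r > 0" "mball (\<phi> \<alpha>) r \<subseteq> U"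
        using U by (auto simp: T_eq openin_mtopology)
      obtain n where n: "2 * (1/2)^n < r/2" using small[of "r/2"] r by auto
      have "y \<in> mball (\<phi> \<alpha>) r" if "y \<in> mcball (c (\<alpha> n)) (2 * (1/2)^n)" for y
        using that triangle[of "\<phi> \<alpha>" "c (\<alpha> n)" y] \<phi>_close[OF \<open>\<alpha> \<in> S\<close>, of n] n \<phi>M[of \<alpha>] c[of "\<alpha> n"] by (auto simp: commute)
      then show "\<exists>n. mcball (c (\<alpha> n)) (2 * (1/2)^n) \<subseteq> U" using r by blast
    next
      assume "\<exists>n. mcball (c (\<alpha> n)) (2 * (1/2)^n) \<subseteq> U"
      then show "\<phi> \<alpha> \<in> U" using \<phi>_close[OF that] c \<phi>M by (meson in_mcball subsetD)
    qed
    have "\<phi> -` U = S \<inter> (\<Union>n. {\<alpha>. mcball (c (\<alpha> n)) (2 * (1/2)^n) \<subseteq> U}) \<union> (- S \<inter> {\<alpha>. c 0 \<in> U})"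
    proof (intro Set.set_eqI)
      show "\<alpha> \<in> \<phi> -` U \<longleftrightarrow> \<alpha> \<in> S \<inter> (\<Union>n. {\<alpha>. mcball (c (\<alpha> n)) (2 * (1/2)^n) \<subseteq> U}) \<union> (- S \<inter> {\<alpha>. c 0 \<in> U})" for \<alpha>
        using *[of \<alpha>] by (cases "\<alpha> \<in> S") (simp_all add: \<phi>_def)
    qed
    also have "\<dots> \<in> sets borel"
      using Sb sing by (intro sets.Un sets.Int sets.countable_UN borel_comp) auto
    finally show "\<phi> -` U \<in> sets borel" .
  qed
qed

text \<open>The sets are pulled back to the Baire space along a Borel surjection. This map need not
  be injective, which is why \<open>separating_borel_sets_generate\<close> asks only that points of
  the set be separated from points outside it; surjectivity brings the generated set back.\<close>

theorem standard_borel_separating_sets_generate: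
  fixes G :: "nat \<Rightarrow> 'a set"
  assumes M: "standard_borel M" and G: "\<And>k. G k \<in> sets M"
    and sep: "\<And>x y. \<lbrakk>x \<in> space M; y \<in> space M; \<And>k. (x \<in> G k) = (y \<in> G k)\<rbrakk> \<Longrightarrow> x = y"
  shows "sets M = sigma_sets (space M) (range G)"
proof (cases "space M = {}")
  case True
  show ?thesis
  proof (intro equalityI subsetI)
    fix A assume "A \<in> sets M"
    then have "A = {}" using sets.sets_into_space[of A M] True by auto
    then show "A \<in> sigma_sets (space M) (range G)" by (simp add: sigma_sets.Empty)
  next
    fix A assume "A \<in> sigma_sets (space M) (range G)"
    then show "A \<in> sets M" using sets.sigma_sets_subset[of "range G" M] G by auto
  qed
next
  case False
  obtain T where T: "topspace T = space M" "completely_metrizable_space T" "second_countable T"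
    "sets M = sigma_sets (space M) {U. openin T U}"
    using M unfolding standard_borel_def by blast
  obtain \<phi> :: "(nat \<Rightarrow> nat) \<Rightarrow> 'a" where \<phi>: "range \<phi> = space M" "\<And>U. openin T U \<Longrightarrow> \<phi> -` U \<in> sets borel"
    using completely_metrizable_borel_surjection[OF T(2,3)] False T(1) by metis
  have "\<phi> \<in> measurable borel (sigma (space M) {U. openin T U})"
  proof (rule measurable_measure_of)
    show "{U. openin T U} \<subseteq> Pow (space M)" using openin_subset[of T] T(1) by auto
    show "\<phi> \<in> space borel \<rightarrow> space M" using \<phi>(1) by auto
  qed (use \<phi>(2) in auto)
  moreover have "sets (sigma (space M) {U. openin T U}) = sets M"
    using T openin_subset[of T] by (subst sets_measure_of) auto
  ultimately have meas: "\<phi> \<in> measurable borel M" by (simp cong: measurable_cong_sets)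
  show ?thesis
  proof (intro equalityI subsetI)
    fix A assume A: "A \<in> sets M"
    have "\<phi> -` A \<in> sigma_sets UNIV (range (\<lambda>k. \<phi> -` G k))"
    proof (rule separating_borel_sets_generate)
      show "\<phi> -` A \<in> sets borel" "\<phi> -` G k \<in> sets borel" for k
        using measurable_sets[OF meas A] measurable_sets[OF meas G] by auto
      show "\<exists>k. (a \<in> \<phi> -` G k) \<noteq> (b \<in> \<phi> -` G k)" if "a \<in> \<phi> -` A" "b \<notin> \<phi> -` A" for a b
      proof (rule ccontr)
        assume "\<not> ?thesis"
        then have "(\<phi> a \<in> G k) = (\<phi> b \<in> G k)" for k by auto
        moreover have "\<phi> a \<in> space M" "\<phi> b \<in> space M" using \<phi>(1) by auto
        ultimately have "\<phi> a = \<phi> b" using sep by blast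
        then show False using that by simp
      qed
    qed
    also have "sigma_sets UNIV (range (\<lambda>k. \<phi> -` G k)) = {\<phi> -` B \<inter> UNIV |B. B \<in> sigma_sets (space M) (range G)}"
      using sigma_sets_vimage_commute[of \<phi> UNIV "space M" "range G"] \<phi>(1)
      by (auto simp: image_image setcompr_eq_image)
    finally obtain B where B: "B \<in> sigma_sets (space M) (range G)" "\<phi> -` A = \<phi> -` B" by auto
    have "B \<subseteq> space M" using sigma_sets_into_sp[OF _ B(1)] sets.sets_into_space[OF G] by blast
    then have "A = B" using B(2) sets.sets_into_space[OF A] \<phi>(1) by (auto simp: set_eq_iff image_iff) (metis (no_types, lifting) rangeE subsetD vimageI vimageE)+
    then show "A \<in> sigma_sets (space M) (range G)" using B by simp
  next
    fix A assume "A \<in> sigma_sets (space M) (range G)"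
    then show "A \<in> sets M" using sets.sigma_sets_subset[of "range G" M] G by auto
  qed
qed

section \<open>Measured property (T)\<close>

lemma countable_separating_open_sets:
  obtains B :: "nat \<Rightarrow> 'g::{second_countable_topology, t2_space} set" where
    "\<And>j. open (B j)" "\<And>x y. (\<And>j. (x \<in> B j) = (y \<in> B j)) \<Longrightarrow> x = y"
proof -
  obtain \<B> :: "'g set set" where \<B>: "countable \<B>" "topological_basis \<B>" using ex_countable_basis by blast
  have "\<Union>\<B> = UNIV" using topological_basisE[OF \<B>(2) open_UNIV] by blast
  then have ne: "\<B> \<noteq> {}" by auto
  have rng: "range (from_nat_into \<B>) = \<B>" using \<B>(1) ne by simp
  show thesis
  proof
    show "open (from_nat_into \<B> j)" for j using topological_basis_open[OF \<B>(2)] rng by blast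
    show "x = y" if "\<And>j. (x \<in> from_nat_into \<B> j) = (y \<in> from_nat_into \<B> j)" for x y
    proof (rule ccontr)
      assume "x \<noteq> y"
      then obtain W where W: "open W" "x \<in> W" "y \<notin> W" using hausdorff[of x y] by blast
      obtain b where b: "b \<in> \<B>" "x \<in> b" "b \<subseteq> W" using topological_basisE[OF \<B>(2) W(1,2)] by blast
      then obtain j where "b = from_nat_into \<B> j" using rng by blast
      then show False using b W(3) that[of j] by blast
    qed
  qed
qed

context bundle_representation
begin

lemma fund_inner_eq:
  assumes "x \<in> units G" "v \<in> carrier (H x)"
  shows "inner_prod (H x) (fund E n x) v = cinner (J x (fund E n x)) (J x v)"
  using assms by (simp add: fibre_embedding(3,9))

lemma J_fund_measurable: "(\<lambda>x. coord (J x (fund E k x)) n) \<in> borel_measurable \<mu>"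
proof -
  have "(\<lambda>x. gs_coeff (H x) (fd x) n (fund E k x)) \<in> borel_measurable (unit_borel G)"
    by (rule gs_coeff_measurable[OF measurable_ident, unfolded id_def])
       (use hilb in \<open>auto simp: hilbert_bundle_def fibre_embedding(9)\<close>)
  then have "(\<lambda>x. gs_coeff (H x) (fd x) n (fund E k x)) \<in> borel_measurable \<mu>" by (simp add: measurable_mu_cong)
  then show ?thesis
    by (subst measurable_cong[of _ _ "\<lambda>x. gs_coeff (H x) (fd x) n (fund E k x)"]) (simp_all add: fibre_embedding(6,9))
qed

text \<open>The Borel structure of the bundle is generated by the projection and the functions
  \<open>(x, v) \<mapsto> \<langle>\<xi>\<^sub>n(x), v\<rangle>\<close>, as they separate the points of a standard Borel space.\<close>

lemma weakly_measurable_section: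
  assumes \<xi>: "\<And>x. x \<in> units G \<Longrightarrow> \<xi> x \<in> carrier (H x)"
    and meas: "\<And>n. (\<lambda>x. inner_prod (H x) (fund E n x) (\<xi> x)) \<in> borel_measurable \<mu>"
  shows "(\<lambda>x. (x, \<xi> x)) \<in> measurable \<mu> (total E)"
proof -
  have sp: "space (total E) = (SIGMA x:units G. carrier (H x))" and std: "standard_borel (total E)"
    and fst_meas: "fst \<in> measurable (total E) (unit_borel G)"
    and inner_meas: "\<And>n. (\<lambda>(x, v). inner_prod (H x) (fund E n x) v) \<in> borel_measurable (total E)"
    and sep: "\<And>x v w. \<lbrakk>x \<in> units G; v \<in> carrier (H x); w \<in> carrier (H x);
      \<And>n. inner_prod (H x) (fund E n x) v = inner_prod (H x) (fund E n x) w\<rbrakk> \<Longrightarrow> v = w"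
    using hilb unfolding hilbert_bundle_def by simp_all
  obtain B :: "nat \<Rightarrow> 'g set" where B: "\<And>j. open (B j)" "\<And>x y. (\<And>j. (x \<in> B j) = (y \<in> B j)) \<Longrightarrow> x = y"
    using countable_separating_open_sets by blast
  define part where "part b z = (if b then Re z else Im z)" for b z
  \<comment> \<open>Superlevel sets, at rational levels, of the real and imaginary parts of the
    coefficients, and preimages of separating open sets of units. The index type is countable, and
    \<open>from_nat\<close> enumerates it below.\<close>
  define P :: "(nat \<times> bool \<times> rat) + nat \<Rightarrow> ('g \<times> 'v) set" where
    "P k = (case k of
       Inl (n, b, q) \<Rightarrow> {p \<in> space (total E). real_of_rat q < part b (inner_prod (H (fst p)) (fund E n (fst p)) (snd p))}
     | Inr j \<Rightarrow> {p \<in> space (total E). fst p \<in> B j})" for k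
  have part_meas: "part b \<in> borel_measurable borel" for b
    unfolding part_def by (cases b) simp_all
  have P_total: "P k \<in> sets (total E)" for k
  proof (cases k)
    case (Inl a)
    obtain n b q where a: "a = (n, b, q)" by (cases a)
    have "(\<lambda>p. part b (inner_prod (H (fst p)) (fund E n (fst p)) (snd p))) \<in> borel_measurable (total E)"
      using measurable_compose[OF inner_meas[of n] part_meas[of b]] by (simp add: case_prod_beta)
    from borel_measurable_less[OF borel_measurable_const this] show ?thesis by (simp add: Inl a P_def)
  next
    case (Inr j)
    have "B j \<inter> units G \<in> sets (unit_borel G)" using B(1)[of j] by (simp add: sets_unit_borel sets.Int)
    from measurable_sets[OF fst_meas this]
    have "fst -` (B j \<inter> units G) \<inter> space (total E) \<in> sets (total E)" .
    moreover have "fst -` (B j \<inter> units G) \<inter> space (total E) = P k" by (auto simp: Inr P_def sp)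
    ultimately show ?thesis by simp
  qed
  have gen: "sets (total E) = sigma_sets (space (total E)) (range (\<lambda>n. P (from_nat n)))"
  proof (rule standard_borel_separating_sets_generate[OF std P_total])
    fix p p' assume p: "p \<in> space (total E)" "p' \<in> space (total E)"
      and "\<And>k. (p \<in> P (from_nat k)) = (p' \<in> P (from_nat k))"
    then have eq: "(p \<in> P k) = (p' \<in> P k)" for k by (metis from_nat_to_nat)
    have "fst p = fst p'" by (rule B(2)) (use eq[of "Inr _"] p in \<open>simp add: P_def\<close>)
    then obtain x v w where xvw: "p = (x, v)" "p' = (x, w)" by (metis prod.collapse)
    then have x: "x \<in> units G" "v \<in> carrier (H x)" "w \<in> carrier (H x)" using p by (simp_all add: sp)
    have "part b (inner_prod (H x) (fund E n x) v) = part b (inner_prod (H x) (fund E n x) w)" for b n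
    proof (rule ccontr)
      assume "part b (inner_prod (H x) (fund E n x) v) \<noteq> part b (inner_prod (H x) (fund E n x) w)"
      then obtain q where "(real_of_rat q < part b (inner_prod (H x) (fund E n x) v)) \<noteq>
          (real_of_rat q < part b (inner_prod (H x) (fund E n x) w))"
        by (metis linorder_neqE_linordered_idom not_less_iff_gr_or_eq of_rat_dense)
      then show False using eq[of "Inl (n, b, q)"] p by (simp add: P_def xvw)
    qed
    from this[of True] this[of False] have "inner_prod (H x) (fund E n x) v = inner_prod (H x) (fund E n x) w" for n
      by (simp add: part_def complex_eq_iff)
    then show "p = p'" using sep[OF x] by (simp add: xvw)
  qed
  show ?thesis
  proof (rule measurable_sigma_sets[OF gen])
    show "range (\<lambda>n. P (from_nat n)) \<subseteq> Pow (space (total E))" using sets.sets_into_space[OF P_total] by blast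
    show "(\<lambda>x. (x, \<xi> x)) \<in> space \<mu> \<rightarrow> space (total E)" using \<xi> by (simp add: sp)
    fix Q assume "Q \<in> range (\<lambda>n. P (from_nat n))"
    then obtain k where Q: "Q = P k" by blast
    show "(\<lambda>x. (x, \<xi> x)) -` Q \<inter> space \<mu> \<in> sets \<mu>"
    proof (cases k)
      case (Inl a)
      obtain n b q where a: "a = (n, b, q)" by (cases a)
      have "(\<lambda>x. part b (inner_prod (H x) (fund E n x) (\<xi> x))) \<in> borel_measurable \<mu>"
        by (rule measurable_compose[OF meas part_meas])
      from borel_measurable_less[OF borel_measurable_const this]
      have "{x \<in> units G. real_of_rat q < part b (inner_prod (H x) (fund E n x) (\<xi> x))} \<in> sets \<mu>" by simp
      moreover have "(\<lambda>x. (x, \<xi> x)) -` Q \<inter> space \<mu> = {x \<in> units G. real_of_rat q < part b (inner_prod (H x) (fund E n x) (\<xi> x))}"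
        using \<xi> by (auto simp: Q Inl a P_def sp)
      ultimately show ?thesis by simp
    next
      case (Inr j)
      have "(\<lambda>x. (x, \<xi> x)) -` Q \<inter> space \<mu> = units G \<inter> B j"
        using \<xi> by (auto simp: Q Inr P_def sp)
      then show ?thesis using B(1)[of j] by (simp add: mu_setsI sets.Int)
    qed
  qed
qed

lemma section_embedding:
  assumes "(\<lambda>x. (x, \<xi> x)) \<in> measurable \<mu> (total E)"
  shows "x \<in> units G \<Longrightarrow> \<xi> x \<in> carrier (H x)" "(\<lambda>x. coord (J x (\<xi> x)) n) \<in> borel_measurable \<mu>"
proof -
  have sp: "space (total E) = (SIGMA x:units G. carrier (H x))"
    and inner_meas: "\<And>n. (\<lambda>(x, v). inner_prod (H x) (fund E n x) v) \<in> borel_measurable (total E)"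
    using hilb unfolding hilbert_bundle_def by simp_all
  show c: "\<xi> x \<in> carrier (H x)" if "x \<in> units G" for x
    using measurable_space[OF assms, of x] that by (simp add: sp)
  have "(\<lambda>x. gs_coeff (H x) (fd x) n (\<xi> x)) \<in> borel_measurable \<mu>"
  proof (rule gs_coeff_measurable[of "\<lambda>x. x"])
    show "(\<lambda>x. x) \<in> measurable \<mu> (unit_borel G)" using measurable_ident by (simp add: measurable_mu_cong id_def)
    show "(\<lambda>x. inner_prod (H x) (fund E k x) (\<xi> x)) \<in> borel_measurable \<mu>" for k
      using measurable_compose[OF assms inner_meas[of k]] by simp
  qed (simp add: c)
  then show "(\<lambda>x. coord (J x (\<xi> x)) n) \<in> borel_measurable \<mu>"
    by (subst measurable_cong[of _ _ "\<lambda>x. gs_coeff (H x) (fd x) n (\<xi> x)"]) (simp_all add: fibre_embedding(6) c)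
qed

text \<open>The sections are moved into \<open>ell2\<close> coordinates, where
  \<open>exists_invariant\<close> and \<open>ergodic_normalized\<close> apply, and the resulting
  section is moved back through \<open>J_inv\<close>; it is this return that rests on
  \<open>weakly_measurable_section\<close>.\<close>

lemma almost_invariant_imp_invariant:
  assumes T: "topological_property_T TYPE('i \<Rightarrow> complex) G" and erg: "ergodic_measure G \<mu>"
    and almost: "almost_contains_unit_invariant_sections G \<mu> E \<pi>"
  shows "contains_unit_invariant_section G \<mu> E \<pi>"
proof -
  obtain \<xi> :: "nat \<Rightarrow> 'g \<Rightarrow> 'v" where unit: "\<And>n. unit_section \<mu> E (\<xi> n)"
    and lim: "AE g in \<nu>. (\<lambda>n. hnorm (H (r g)) (\<xi> n (r g) \<ominus>\<^bsub>H (r g)\<^esub> V g (\<xi> n (s g)))) \<longlonglongrightarrow> 0"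
    using almost unfolding almost_contains_unit_invariant_sections_def by blast
  have \<xi>_meas: "(\<lambda>x. (x, \<xi> n x)) \<in> measurable \<mu> (total E)" and \<xi>_norm: "AE x in \<mu>. hnorm (H x) (\<xi> n x) = 1" for n
    using unit[of n] by (auto simp: unit_section_def)
  note c = section_embedding(1)[OF \<xi>_meas]
  \<comment> \<open>The sections have norm one only almost everywhere. Cutting off to
    \<open>0\<close> elsewhere gives the bound \<open>1\<close> at every point, also off the unit
    space, as \<open>exists_invariant\<close> demands.\<close>
  define F where "F n x = (if norm (J x (\<xi> n x)) = 1 then J x (\<xi> n x) else 0)" for n x
  have F_sec: "F n \<in> sec" for n
    unfolding sec_def
  proof (intro CollectI conjI ballI allI)
    show "F n x \<in> K x" if "x \<in> units G" for x
      using c[OF that, of n] K_zero[OF that] by (auto simp: F_def K_def)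
    have "{x \<in> space \<mu>. norm (J x (\<xi> n x)) = 1} \<in> sets \<mu>"
      using measurable_norm_ell2[OF section_embedding(2)[OF \<xi>_meas[of n]]] by measurable
    then have "(\<lambda>x. if norm (J x (\<xi> n x)) = 1 then coord (J x (\<xi> n x)) k else 0) \<in> borel_measurable \<mu>" for k
      by (intro measurable_If section_embedding(2)[OF \<xi>_meas]) simp_all
    moreover have "coord (F n x) k = (if norm (J x (\<xi> n x)) = 1 then coord (J x (\<xi> n x)) k else 0)" for k x
      by (simp add: F_def)
    ultimately show "(\<lambda>x. coord (F n x) k) \<in> borel_measurable \<mu>" for k by simp
  qed
  have F_le: "norm (F n x) \<le> 1" for n x by (simp add: F_def)
  have AE_J: "AE x in \<mu>. \<forall>n. norm (J x (\<xi> n x)) = 1"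
    unfolding AE_all_countable
  proof
    fix n show "AE x in \<mu>. norm (J x (\<xi> n x)) = 1"
      using \<xi>_norm[of n] AE_space[of \<mu>] by eventually_elim (simp add: fibre_embedding(5) c)
  qed
  have F_AE: "AE x in \<mu>. norm (F n x) = 1" for n
    using AE_J by eventually_elim (simp add: F_def)
  have "AE g in \<nu>. (\<lambda>n. norm (F n (r g) - U g (F n (s g)))) \<longlonglongrightarrow> 0"
    using lim AE_rng[OF AE_J] AE_src[OF AE_J]
  proof eventually_elim
    case (elim g)
    have "norm (F n (r g) - U g (F n (s g))) = hnorm (H (r g)) (\<xi> n (r g) \<ominus>\<^bsub>H (r g)\<^esub> V g (\<xi> n (s g)))" for n
    proof -
      interpret S: separating_sequence "H (r g)" "fd (r g)" by (rule separating) simp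
      have k: "\<xi> n (s g) \<in> carrier (H (s g))" "\<xi> n (r g) \<in> carrier (H (r g))" by (simp_all add: c)
      have "F n (r g) = J (r g) (\<xi> n (r g))" "F n (s g) = J (s g) (\<xi> n (s g))"
        using elim(2,3) by (simp_all add: F_def)
      then have "F n (r g) - U g (F n (s g)) = J (r g) (\<xi> n (r g) \<ominus>\<^bsub>H (r g)\<^esub> V g (\<xi> n (s g)))"
        using k by (simp add: U_J fibre_embedding(7) V_closed)
      then show ?thesis using k V_closed[OF k(1)] by (simp add: fibre_embedding(5))
    qed
    then show ?case using elim(1) by simp
  qed
  note lim_F = this
  obtain code :: "('g \<Rightarrow> ell2) \<Rightarrow> 'i \<Rightarrow> complex" where code: "\<forall>F F'.
     (\<forall>n. (\<lambda>x. coord (F x) n) \<in> borel_measurable \<mu>) \<longrightarrow> (\<forall>n. (\<lambda>x. coord (F' x) n) \<in> borel_measurable \<mu>) \<longrightarrow>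
     (code F = code F' \<longleftrightarrow> (AE x in \<mu>. F x = F' x))"
    using AE_class_code by blast
  \<comment> \<open>The code takes values in the universe for which property (T) is assumed, so the
    space of sections is among the Hilbert spaces to which it applies.\<close>
  interpret C: coded_representation G \<mu> K U code
    by unfold_locales (use code in \<open>simp add: sec_def\<close>)
  obtain \<eta> where \<eta>: "\<eta> \<in> L2" "\<not> (AE x in \<mu>. \<eta> x = 0)" "AE g in \<nu>. U g (\<eta> (s g)) = \<eta> (r g)"
    using C.exists_invariant[OF T F_sec F_le F_AE lim_F] by blast
  obtain \<zeta> where \<zeta>: "\<zeta> \<in> sec" "AE x in \<mu>. norm (\<zeta> x) = 1" "AE g in \<nu>. U g (\<zeta> (s g)) = \<zeta> (r g)"
    using ergodic_normalized[OF erg L2D(1)[OF \<eta>(1)] \<eta>(2,3)] by blast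
  define \<theta> where "\<theta> x = J_inv x (\<zeta> x)" for x
  have \<theta>: "\<theta> x \<in> carrier (H x)" "J x (\<theta> x) = \<zeta> x" if "x \<in> units G" for x
    using J_inv[OF secD(1)[OF \<zeta>(1) that]] by (simp_all add: \<theta>_def)
  have "(\<lambda>x. (x, \<theta> x)) \<in> measurable \<mu> (total E)"
  proof (rule weakly_measurable_section[OF \<theta>(1)])
    fix n
    have "(\<lambda>x. cinner (J x (fund E n x)) (\<zeta> x)) \<in> borel_measurable \<mu>"
      by (intro measurable_cinner J_fund_measurable secD(2)[OF \<zeta>(1)])
    then show "(\<lambda>x. inner_prod (H x) (fund E n x) (\<theta> x)) \<in> borel_measurable \<mu>"
      by (subst measurable_cong[of _ _ "\<lambda>x. cinner (J x (fund E n x)) (\<zeta> x)"]) (simp_all add: fund_inner_eq \<theta>)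
  qed
  moreover have "AE x in \<mu>. hnorm (H x) (\<theta> x) = 1"
    using \<zeta>(2) AE_space[of \<mu>] by eventually_elim (use fibre_embedding(5) \<theta> in fastforce)
  moreover have "AE g in \<nu>. \<theta> (r g) = V g (\<theta> (s g))"
    using \<zeta>(3)
  proof eventually_elim
    case (elim g)
    have "J (r g) (V g (\<theta> (s g))) = J (r g) (\<theta> (r g))"
      using elim U_J[OF \<theta>(1), of g] \<theta>(2) by simp
    then show ?case
      using fibre_embedding(4)[of "r g" "V g (\<theta> (s g))" "\<theta> (r g)"] V_closed[OF \<theta>(1), of g] \<theta>(1)[of "r g"] by simp
  qed
  ultimately show ?thesis
    unfolding contains_unit_invariant_section_def unit_section_def by blast
qed

end

theorem theorem5p12:
  fixes G :: "'g::{second_countable_topology, t2_space} groupoid"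
  assumes "locally_compact_space (euclidean :: 'g topology)"
    and "etale_groupoid G"
    and "compact (units G)"
    and "topological_property_T TYPE('i \<Rightarrow> complex) G"
  shows "\<forall>\<mu>. radon_probability G \<mu> \<and> invariant_measure G \<mu> \<and> ergodic_measure G \<mu> \<longrightarrow>
           measured_property_T TYPE('v) G \<mu>"
proof (intro allI impI)
  fix \<mu> assume \<mu>: "radon_probability G \<mu> \<and> invariant_measure G \<mu> \<and> ergodic_measure G \<mu>"
  interpret invariant_space G \<mu>
    using assms \<mu> by unfold_locales auto
  show "measured_property_T TYPE('v) G \<mu>"
    unfolding measured_property_T_def
  proof (intro allI impI)
    fix E :: "('g, 'v) hbundle" and \<pi>
    assume "groupoid_representation G E \<pi>"
    then interpret bundle_representation G \<mu> E \<pi> by unfold_locales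
    assume "almost_contains_unit_invariant_sections G \<mu> E \<pi>"
    then show "contains_unit_invariant_section G \<mu> E \<pi>"
      using \<mu> assms(4) by (intro almost_invariant_imp_invariant) auto
  qed
qed

end
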